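(* Let $\alpha>0$ be fixed. For each $N$ let $G$ be an $N\times N$ matrix from the complex induced Ginibre ensemble with rectangularity index $L=\alpha N$, and let $R_N=\frac{r_{max}^{(N)}(G)}{\sqrt{(1+\alpha)N}}$ be the scaled spectral radius. Set $\gamma_{\alpha,N}=\log\sqrt{(1+\alpha)N/2\pi}-\log\log N$. Then for every $x\in\mathbb R$, $$\lim_{N\to+\infty}P\left[R_N\le 1+\sqrt{\frac{\gamma_{\alpha,N}}{2(1+\alpha)N}}+\frac{x}{2\sqrt{2(1+\alpha)N\,\gamma_{\alpha,N}}}\right]=e^{-e^{-x}}.$$ Accordingly, as $N\to\infty$, $R_N$ is approximated in distribution by $1+T_{\alpha,N}+\xi_{\alpha,N}$, where $T_{\alpha,N}=\sqrt{\frac{\gamma_{\alpha,N}}{2(1+\alpha)N}}$ and $\xi_{\alpha,N}=\frac{X}{2\sqrt{2(1+\alpha)N\gamma_{\alpha,N}}}$ with $X$ a standard Gumbel random variable for maxima; that is, $2\sqrt{2(1+\alpha)N\gamma_{\alpha,N}}\,\left(R_N-1-T_{\alpha,N}\right)$ converges in distribution to $X$.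
   Context: The complex induced Ginibre ensemble with rectangularity index $L\ge0$ is the set of $N\times N$ complex matrices $G$ with density (with respect to Lebesgue measure on the entries) proportional to $\left(\det G^\dagger G\right)^{L}\exp\left(-\mathrm{Tr}\,G^\dagger G\right)$. The joint density of its eigenvalues $\lambda_1,\dots,\lambda_N\in\mathbb C$ is $\frac{1}{Z_N}\prod_{j<k}|\lambda_k-\lambda_j|^2\prod_{j=1}^N|\lambda_j|^{2L}\exp\left(-\sum_{j=1}^N|\lambda_j|^2\right)$ with $Z_N=N!\,\pi^N\prod_{k=1}^N\Gamma(k+L)$. The spectral radius is $r_{max}^{(N)}(G)=\max_j|\lambda_j|$. The standard Gumbel distribution for maxima has cumulative distribution function $e^{-e^{-x}}$, $x\in\mathbb R$. *)

theory Defs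
  imports
    "HOL-Probability.Probability"
    "Jordan_Normal_Form.Schur_Decomposition"
    "Jordan_Normal_Form.Spectral_Radius"
begin

text \<open>The dimension varies along the limit, so matrices are those of \<open>Jordan_Normal_Form\<close>
  (type \<open>complex mat\<close>), which carry their dimension as a value. As HOL-Analysis has a constant
  \<open>det\<close> for type-indexed matrices, the determinant is written with its qualified name.\<close>

definition mat_trace :: "'a :: comm_monoid_add mat \<Rightarrow> 'a" where
  "mat_trace A = (\<Sum>i<dim_row A. A $$ (i, i))"

text \<open>Lebesgue measure on the entries of an \<open>N \<times> N\<close> complex matrix, i.e. on
  \<open>\<complex>\<^bsup>N\<times>N\<^esup>\<close>. Its points are functions on index pairs that are \<open>undefined\<close> outside
  \<open>{..<N} \<times> {..<N}\<close>; hence the \<open>restrict\<close> in the map from matrices to such points.\<close>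

definition entries_lborel :: "nat \<Rightarrow> (nat \<times> nat \<Rightarrow> complex) measure" where
  "entries_lborel N = Pi\<^sub>M ({..<N} \<times> {..<N}) (\<lambda>_. lborel)"

definition mat_entries :: "nat \<Rightarrow> complex mat \<Rightarrow> nat \<times> nat \<Rightarrow> complex" where
  "mat_entries N A = restrict (\<lambda>ij. A $$ ij) ({..<N} \<times> {..<N})"

text \<open>The determinant and trace below are nonnegative reals, so \<open>Re\<close> only changes the type.
  For \<open>L = 0\<close> the convention \<open>0 powr 0 = 0\<close> affects singular matrices only, a null set.\<close>

definition induced_ginibre_weight :: "real \<Rightarrow> complex mat \<Rightarrow> real" where
  "induced_ginibre_weight L A =
     Re (Determinant.det (mat_adjoint A * A)) powr L * exp (- Re (mat_trace (mat_adjoint A * A)))"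

text \<open>\<open>G\<close> is a random \<open>N \<times> N\<close> matrix on the probability space \<open>M\<close>, distributed according to the
  complex induced Ginibre ensemble with rectangularity index \<open>L\<close>. The constant \<open>c\<close> is the
  normalisation left implicit in ``density proportional to''.\<close>

definition induced_ginibre :: "'a measure \<Rightarrow> nat \<Rightarrow> real \<Rightarrow> ('a \<Rightarrow> complex mat) \<Rightarrow> bool" where
  "induced_ginibre M N L G \<longleftrightarrow>
     prob_space M \<and>
     (\<forall>\<omega>\<in>space M. G \<omega> \<in> carrier_mat N N) \<and>
     (\<exists>c>0. distributed M (entries_lborel N) (\<lambda>\<omega>. mat_entries N (G \<omega>))
              (\<lambda>z. ennreal (c * induced_ginibre_weight L (mat N N z))))"

definition scaled_spectral_radius :: "real \<Rightarrow> nat \<Rightarrow> complex mat \<Rightarrow> real" where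
  "scaled_spectral_radius \<alpha> N A = spectral_radius A / sqrt ((1 + \<alpha>) * real N)"

definition gumbel_gamma :: "real \<Rightarrow> nat \<Rightarrow> real" where
  "gumbel_gamma \<alpha> N = ln (sqrt ((1 + \<alpha>) * real N / (2 * pi))) - ln (ln (real N))"

text \<open>The law of a standard Gumbel random variable for maxima.\<close>

definition std_gumbel :: "real measure" where
  "std_gumbel = interval_measure (\<lambda>x. exp (- exp (- x)))"

lemma
  shows real_distribution_std_gumbel: "real_distribution std_gumbel"
    and cdf_std_gumbel: "cdf std_gumbel = (\<lambda>x. exp (- exp (- x)))"
proof -
  let ?F = "\<lambda>x::real. exp (- exp (- x))"
  have mono: "?F x \<le> ?F y" if "x \<le> y" for x y
    using that by simp
  have cont: "continuous (at_right a) ?F" for a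
    by (intro continuous_intros)
  have bot: "(?F \<longlongrightarrow> 0) at_bot"
    by (rule filterlim_compose[OF exp_at_bot])
       (auto simp: filterlim_uminus_at_bot intro!: filterlim_compose[OF exp_at_top]
         filterlim_uminus_at_top_at_bot)
  have "((\<lambda>x::real. exp (- x)) \<longlongrightarrow> 0) at_top"
    by (rule filterlim_compose[OF exp_at_bot filterlim_uminus_at_bot_at_top])
  then have top: "(?F \<longlongrightarrow> 1) at_top"
    using tendsto_exp[OF tendsto_minus] by fastforce
  show "real_distribution std_gumbel"
    unfolding std_gumbel_def by (rule real_distribution_interval_measure[OF mono cont bot top])
  show "cdf std_gumbel = ?F"
    unfolding std_gumbel_def by (rule cdf_interval_measure[OF mono cont bot])
qed

end

theory Submission
  imports Defs "HOL-Complex_Analysis.Conformal_Mappings" "HOL-Real_Asymp.Real_Asymp"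
begin

text \<open>
  Write a matrix with eigenvalue \<open>z\<close> and eigenvector \<open>(u, 1)\<close> as a conjugate of a block triangular matrix
  with diagonal blocks \<open>B\<close> and \<open>z\<close> and off-diagonal row \<open>w\<close>. Almost every matrix of size \<open>n + 1\<close> arises
  from exactly \<open>n + 1\<close> choices of \<open>(z, u, w, B)\<close>, with Jacobian \<open>|det (z - B)|\<^sup>2\<close>. The Gaussian integrals over \<open>w\<close> and
  \<open>u\<close> contribute a constant independent of \<open>z\<close> and \<open>B\<close>, and iterating this deflation yields the eigenvalue density up
  to a constant. Expanding the squared Vandermonde determinant, rotation invariance leaves
  \<open>P(r\<^sub>m\<^sub>a\<^sub>x \<le> r) = (\<Prod>k<N. 1 - Q (L + k + 1) (r\<^sup>2))\<close>, where \<open>Q s\<close> is the normalised upper incomplete Gamma function. The sum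
  of the \<open>Q\<close> is squeezed between double geometric series, and Stirling's formula shows that it tends to \<open>exp (- x)\<close>.\<close>

section \<open>The area formula for holomorphic functions\<close>

text \<open>The eigenvector is kept in the chart \<open>(u, 1)\<close> instead of being normalised,
  so no measure on unitary groups or flags enters: every substitution is linear in the entries or
  holomorphic in one variable. In a matrix A with leading block D, last column c and last row w, the
  corner entry making z an eigenvalue is z - w (z - D)^-1 c, a rational function of z with
  derivative chi_A'(z) / chi_D(z). Substituting c = (z - D) u cancels the denominator, and passing
  to B = D - u w turns chi_A'(z) into chi_B(z). The price of the chart is that the conjugating
  matrix is not unitary: the Frobenius norm has to be split by completing the square in w and
  conjugating B with (1 + u u^H)^(1/2), after which the variables separate. For the limit, the
  double geometric series evaluates to about sqrt (S / (2 pi)) exp (- 2 S \<delta>^2) / ln N with S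
  = (1 + \<alpha>) N, where 1 + \<delta> is the threshold for the scaled radius; \<gamma> is defined
  to absorb this prefactor. Truncating the series for the lower bound requires 1 / \<delta> to be
  small against sqrt N, which holds since \<gamma> tends to infinity.\<close>

no_notation vec_index (infixl "$" 100)
no_notation scalar_prod (infix "\<bullet>" 70)

text \<open>Change of variables with a Jacobian determinant,
  \<open>has_measure_differentiable_image\<close>, lives on \<open>real^'n\<close>; this pair of
  mutually inverse linear maps carries it over to the complex plane.\<close>

definition to_vec :: "complex \<Rightarrow> real^2" where
  "to_vec z = (\<chi> i. if i = 1 then Re z else Im z)"

definition of_vec :: "real^2 \<Rightarrow> complex" where
  "of_vec v = Complex (v $ 1) (v $ 2)"

lemma of_vec_to_vec [simp]: "of_vec (to_vec z) = z"
  by (simp add: of_vec_def to_vec_def)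

lemma to_vec_of_vec [simp]: "to_vec (of_vec v) = v"
  by (simp add: of_vec_def to_vec_def Finite_Cartesian_Product.vec_eq_iff forall_2)

lemma linear_to_vec: "linear to_vec"
  by (rule linearI) (auto simp: to_vec_def Finite_Cartesian_Product.vec_eq_iff)

lemma linear_of_vec: "linear of_vec"
  by (rule linearI) (auto simp: of_vec_def complex_eq_iff)

lemma bounded_linear_to_vec: "bounded_linear to_vec"
  using linear_to_vec by (rule linear_linear[THEN iffD2])

lemma bounded_linear_of_vec: "bounded_linear of_vec"
  using linear_of_vec by (rule linear_linear[THEN iffD2])

lemma borel_measurable_to_vec [measurable]: "to_vec \<in> borel_measurable borel"
  by (intro borel_measurable_continuous_onI linear_continuous_on bounded_linear_to_vec)

lemma borel_measurable_of_vec [measurable]: "of_vec \<in> borel_measurable borel"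
  by (intro borel_measurable_continuous_onI linear_continuous_on bounded_linear_of_vec)

text \<open>Both measures agree on boxes, whose side lengths \<open>to_vec\<close>
  preserves.\<close>

lemma distr_lborel_to_vec: "distr lborel borel to_vec = lborel"
proof (rule lborel_eqI[symmetric])
  fix l u :: "real^2"
  assume le: "\<And>b. b \<in> Basis \<Longrightarrow> l \<bullet> b \<le> u \<bullet> b"
  have le': "l $ i \<le> u $ i" for i
    using le[of "axis i 1"] by (simp add: inner_axis)
  have "to_vec -` box l u = box (of_vec l) (of_vec u)"
    by (auto simp: box_def Basis_complex_def Basis_vec_def inner_axis to_vec_def of_vec_def forall_2)
  then have "emeasure (distr lborel borel to_vec) (box l u) = emeasure lborel (box (of_vec l) (of_vec u))"
    by (simp add: emeasure_distr)
  also have "\<dots> = ennreal (\<Prod>b\<in>Basis. (of_vec u - of_vec l) \<bullet> b)"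
    using le' by (intro emeasure_lborel_box) (auto simp: Basis_complex_def of_vec_def)
  also have "(\<Prod>b\<in>Basis. (of_vec u - of_vec l) \<bullet> b) = (u $ 1 - l $ 1) * (u $ 2 - l $ 2)"
    by (simp add: Basis_complex_def of_vec_def)
  also have "\<dots> = (\<Prod>b\<in>Basis. (u - l) \<bullet> b)"
  proof -
    have B: "(Basis :: (real^2) set) = {axis 1 1, axis 2 1}"
      by (auto simp: Basis_vec_def) (metis exhaust_2)
    have ne: "axis 1 1 \<noteq> (axis 2 1 :: real^2)"
      by (simp add: axis_eq_axis)
    show ?thesis unfolding B using ne by (simp add: inner_axis)
  qed
  finally show "emeasure (distr lborel borel to_vec) (box l u) = ennreal (\<Prod>b\<in>Basis. (u - l) \<bullet> b)" .
qed simp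

text \<open>Multiplication by \<open>c\<close> is the real matrix with rows (Re c, - Im c) and (Im
  c, Re c); hence the real Jacobian of a holomorphic map is the squared modulus of its
  derivative.\<close>

lemma det_complex_mult: "Determinants.det (matrix (\<lambda>h. to_vec (c * of_vec h))) = (cmod c)\<^sup>2"
proof -
  have "Determinants.det (matrix (\<lambda>h. to_vec (c * of_vec h))) = Re c * Re c + Im c * Im c"
    by (simp add: det_2 matrix_def to_vec_def of_vec_def axis_def)
  then show ?thesis
    using cmod_power2[of c] by (simp add: power2_eq_square)
qed

text \<open>The inverse of an injective holomorphic map is holomorphic on the open image, so the
  image of a Borel set is a preimage under a continuous map.\<close>

lemma borel_holomorphic_image:
  assumes V: "open V" "g holomorphic_on V" "inj_on g V" and E: "E \<subseteq> V" "E \<in> sets borel"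
  shows "g ` E \<in> sets borel"
proof -
  obtain h where h: "h holomorphic_on (g ` V)" "\<And>z. z \<in> V \<Longrightarrow> h (g z) = z"
    using holomorphic_has_inverse[OF V(2,1,3)] by metis
  have opn: "open (g ` V)"
    by (rule open_mapping_thm3[OF V(2,1,3)])
  have "g ` E = g ` V \<inter> h -` E"
    using h(2) E(1) by force
  moreover have "h \<in> borel_measurable (restrict_space borel (g ` V))"
    using holomorphic_on_imp_continuous_on[OF h(1)] by (rule borel_measurable_continuous_on_restrict)
  then have "h -` E \<inter> (g ` V) \<in> sets (restrict_space borel (g ` V))"
    using E(2) by (auto dest!: measurable_sets simp: space_restrict_space)
  then have "h -` E \<inter> (g ` V) \<in> sets borel"
    using opn by (auto simp: sets_restrict_space_iff)
  ultimately show ?thesis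
    by (simp add: Int_commute)
qed

text \<open>Boundedness of the image keeps its measure finite, as the gauge-integral form of the
  change of variables requires; \<open>nn_integral_holomorphic_inj\<close> removes it by
  exhaustion.\<close>

lemma emeasure_holomorphic_image:
  assumes V: "open V" "g holomorphic_on V" "inj_on g V" and E: "E \<subseteq> V" "E \<in> sets borel"
    and bdd: "bounded (g ` E)"
  shows "emeasure lborel (g ` E) = (\<integral>\<^sup>+z\<in>E. ennreal ((cmod (deriv g z))\<^sup>2) \<partial>lborel)"
proof -
  have gE: "g ` E \<in> sets borel"
    by (rule borel_holomorphic_image[OF V E])
  define f where "f = to_vec \<circ> g \<circ> of_vec"
  have im: "to_vec ` A = of_vec -` A" for A
    by (auto simp: image_iff) (metis to_vec_of_vec)
  have tvb: "to_vec ` A \<in> sets borel" if "A \<in> sets borel" for A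
    using measurable_sets[OF borel_measurable_of_vec that] by (simp add: im)
  have tve: "emeasure lborel (to_vec ` A) = emeasure lborel A" if "A \<in> sets borel" for A
  proof -
    have "emeasure lborel (to_vec ` A) = emeasure (distr lborel borel to_vec) (to_vec ` A)"
      by (simp add: distr_lborel_to_vec)
    also have "\<dots> = emeasure lborel (to_vec -` (to_vec ` A))"
      using tvb[OF that] by (simp add: emeasure_distr)
    also have "to_vec -` (to_vec ` A) = A"
      by (auto simp: im)
    finally show ?thesis .
  qed
  have fE: "f ` (to_vec ` E) = to_vec ` (g ` E)"
    by (simp add: f_def image_image)
  have der: "(f has_derivative (\<lambda>h. to_vec (deriv g (of_vec x) * of_vec h))) (at x within to_vec ` E)"
    if "x \<in> to_vec ` E" for x
  proof -
    have "of_vec x \<in> V" using that E by auto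
    then have "(g has_field_derivative deriv g (of_vec x)) (at (of_vec x))"
      using V by (simp add: holomorphic_derivI)
    then have "(g has_derivative (\<lambda>h. deriv g (of_vec x) * h)) (at (of_vec x))"
      by (simp add: has_field_derivative_def)
    from diff_chain_at[OF bounded_linear_imp_has_derivative[OF bounded_linear_of_vec] this]
    have "(g \<circ> of_vec has_derivative (\<lambda>h. deriv g (of_vec x) * of_vec h)) (at x)"
      by (simp add: o_def)
    from diff_chain_at[OF this bounded_linear_imp_has_derivative[OF bounded_linear_to_vec]]
    show ?thesis
      by (simp add: f_def o_def has_derivative_at_withinI)
  qed
  have inj: "inj_on f (to_vec ` E)"
  proof (rule inj_onI)
    fix x y assume "x \<in> to_vec ` E" "y \<in> to_vec ` E" "f x = f y"
    then show "x = y" using V(3) E(1)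
      by (auto simp: f_def inj_on_def) (metis subsetD of_vec_to_vec)
  qed
  have gElm: "g ` E \<in> lmeasurable"
    using bdd gE by (intro bounded_set_imp_lmeasurable) auto
  have fin: "emeasure lborel (to_vec ` (g ` E)) < \<infinity>"
    using tve[OF gE] emeasure_bounded_finite[OF bdd] by simp
  have lm: "f ` (to_vec ` E) \<in> lmeasurable"
    unfolding fE using tvb[OF gE] fin
    by (auto simp: fmeasurable_def emeasure_completion)
  have 1: "((\<lambda>x. \<bar>Determinants.det (matrix (\<lambda>h. to_vec (deriv g (of_vec x) * of_vec h)))\<bar>) has_integral
      measure lebesgue (f ` (to_vec ` E))) (to_vec ` E)"
    using has_measure_differentiable_image[OF _ der inj, of "measure lebesgue (f ` (to_vec ` E))"] lm
      tvb[OF E(2)] by auto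
  have "emeasure lborel (g ` E) = emeasure lborel (f ` (to_vec ` E))"
    using fE tve[OF gE] by simp
  also have "\<dots> = ennreal (measure lebesgue (f ` (to_vec ` E)))"
    using fin fE tvb[OF gE] by (simp add: emeasure_eq_ennreal_measure measure_completion)
  also have "\<dots> = (\<integral>\<^sup>+x\<in>to_vec ` E. ennreal ((cmod (deriv g (of_vec x)))\<^sup>2) \<partial>lborel)"
    using nn_integral_has_integral_lebesgue'[OF _ 1] by (simp add: det_complex_mult)
  also have "\<dots> = (\<integral>\<^sup>+x\<in>to_vec ` E. ennreal ((cmod (deriv g (of_vec x)))\<^sup>2) \<partial>distr lborel borel to_vec)"
    by (simp add: distr_lborel_to_vec)
  also have "\<dots> = (\<integral>\<^sup>+z. ennreal ((cmod (deriv g (of_vec (to_vec z))))\<^sup>2) * indicator (to_vec ` E) (to_vec z) \<partial>lborel)"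
  proof (rule nn_integral_distr)
    \<comment> \<open>\<open>deriv g\<close> is controlled only on \<open>V\<close>; a copy extended
      by 0 supplies global measurability.\<close>
    define d where "d z = (if z \<in> V then deriv g z else 0)" for z
    have d: "d \<in> borel_measurable borel"
    proof -
      have "continuous_on V (deriv g)"
        using V by (intro holomorphic_on_imp_continuous_on holomorphic_deriv)
      then show ?thesis unfolding d_def using V(1)
        by (intro borel_measurable_continuous_on_if) auto
    qed
    have "(\<lambda>x. ennreal ((cmod (d (of_vec x)))\<^sup>2) * indicator (to_vec ` E) x) \<in> borel_measurable borel"
      using d tvb[OF E(2)] by measurable
    also have "(\<lambda>x. ennreal ((cmod (d (of_vec x)))\<^sup>2) * indicator (to_vec ` E) x) =
       (\<lambda>x. ennreal ((cmod (deriv g (of_vec x)))\<^sup>2) * indicator (to_vec ` E) x)"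
      using E(1) by (auto simp: d_def indicator_def fun_eq_iff)
    finally show "(\<lambda>x. ennreal ((cmod (deriv g (of_vec x)))\<^sup>2) * indicator (to_vec ` E) x)
      \<in> borel_measurable (distr lborel borel to_vec)" by simp
  qed simp
  also have "\<dots> = (\<integral>\<^sup>+z\<in>E. ennreal ((cmod (deriv g z))\<^sup>2) \<partial>lborel)"
    by (intro nn_integral_cong) (auto simp: im indicator_def)
  finally show "emeasure lborel (g ` E) = (\<integral>\<^sup>+z\<in>E. ennreal ((cmod (deriv g z))\<^sup>2) \<partial>lborel)" .
qed

text \<open>Both sides integrate \<open>f\<close>: one against the push-forward of |g'|^2 times area
  on \<open>E\<close>, the other against area on the image. Equality of these measures is tested on
  bounded pieces, where the preceding lemma applies, and passes to the limit.\<close>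

lemma nn_integral_holomorphic_inj:
  assumes V: "open V" "g holomorphic_on V" "inj_on g V" and E: "E \<subseteq> V" "E \<in> sets borel"
    and f [measurable]: "f \<in> borel_measurable borel"
  shows "(\<integral>\<^sup>+z. f (g z) * ennreal ((cmod (deriv g z))\<^sup>2) * indicator E z \<partial>lborel)
    = (\<integral>\<^sup>+a. f a * indicator (g ` E) a \<partial>lborel)"
proof -
  define d where "d z = (if z \<in> V then deriv g z else 0)" for z
  define G where "G z = (if z \<in> V then g z else 0)" for z
  have [measurable]: "d \<in> borel_measurable borel"
  proof -
    have "continuous_on V (deriv g)"
      using V by (intro holomorphic_on_imp_continuous_on holomorphic_deriv)
    then show ?thesis unfolding d_def using V(1)
      by (intro borel_measurable_continuous_on_if) auto
  qed
  have [measurable]: "G \<in> borel_measurable borel"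
    unfolding G_def using V(1) holomorphic_on_imp_continuous_on[OF V(2)]
    by (intro borel_measurable_continuous_on_if) auto
  have [measurable]: "E \<in> sets borel" "g ` E \<in> sets borel"
    using E(2) borel_holomorphic_image[OF V E] by auto
  define \<mu> where "\<mu> = distr (density lborel (\<lambda>z. ennreal ((cmod (d z))\<^sup>2) * indicator E z)) borel G"
  define \<nu> where "\<nu> = density lborel (indicator (g ` E) :: complex \<Rightarrow> ennreal)"
  have "\<mu> = \<nu>"
  proof (rule measure_eqI)
    show "sets \<mu> = sets \<nu>" by (simp add: \<mu>_def \<nu>_def)
    fix T assume "T \<in> sets \<mu>"
    then have T [measurable]: "T \<in> sets borel" by (simp add: \<mu>_def)
    define T' where "T' n = T \<inter> cball 0 (real n)" for n
    have [measurable]: "T' n \<in> sets borel" for n by (simp add: T'_def)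
    have eq: "emeasure \<mu> (T' n) = emeasure \<nu> (T' n)" for n
    proof -
      define F where "F = E \<inter> G -` T' n"
      have F: "F \<subseteq> V" "F \<in> sets borel"
        using E(1) measurable_sets_borel[of G borel "T' n"] by (auto simp: F_def)
      have gF: "g ` F = g ` E \<inter> T' n"
        using E(1) by (auto simp: F_def G_def)
      have "emeasure \<mu> (T' n) = (\<integral>\<^sup>+z. ennreal ((cmod (d z))\<^sup>2) * indicator E z * indicator (G -` T' n) z \<partial>lborel)"
        using measurable_sets_borel[of G borel "T' n"]
        by (simp add: \<mu>_def emeasure_distr emeasure_density)
      also have "\<dots> = (\<integral>\<^sup>+z\<in>F. ennreal ((cmod (deriv g z))\<^sup>2) \<partial>lborel)"
        using E(1) by (intro nn_integral_cong) (auto simp: F_def d_def indicator_def)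
      also have "\<dots> = emeasure lborel (g ` F)"
        by (rule emeasure_holomorphic_image[OF V F, symmetric])
           (auto simp: gF T'_def intro: bounded_subset[OF bounded_cball[of 0 "real n"]])
      also have "\<dots> = emeasure \<nu> (T' n)"
        unfolding gF \<nu>_def by (simp add: emeasure_density indicator_inter_arith[symmetric])
      finally show ?thesis .
    qed
    have un: "(\<Union>n. T' n) = T"
      using real_arch_simple by (auto simp: T'_def)
    have inc: "incseq T'"
      by (force simp: incseq_def T'_def)
    have "emeasure \<mu> T = (SUP n. emeasure \<mu> (T' n))"
      using SUP_emeasure_incseq[of T' \<mu>] inc by (simp add: un \<mu>_def image_subset_iff)
    also have "\<dots> = (SUP n. emeasure \<nu> (T' n))"
      by (simp add: eq)
    also have "\<dots> = emeasure \<nu> T"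
      using SUP_emeasure_incseq[of T' \<nu>] inc by (simp add: un \<nu>_def image_subset_iff)
    finally show "emeasure \<mu> T = emeasure \<nu> T" .
  qed
  then have "(\<integral>\<^sup>+a. f a \<partial>\<mu>) = (\<integral>\<^sup>+a. f a \<partial>\<nu>)" by simp
  also have "(\<integral>\<^sup>+a. f a \<partial>\<mu>) = (\<integral>\<^sup>+z. ennreal ((cmod (d z))\<^sup>2) * indicator E z * f (G z) \<partial>lborel)"
    by (simp add: \<mu>_def nn_integral_distr nn_integral_density)
  also have "\<dots> = (\<integral>\<^sup>+z. f (g z) * ennreal ((cmod (deriv g z))\<^sup>2) * indicator E z \<partial>lborel)"
    using E(1) by (intro nn_integral_cong) (auto simp: d_def G_def indicator_def mult.commute)
  also have "(\<integral>\<^sup>+a. f a \<partial>\<nu>) = (\<integral>\<^sup>+a. f a * indicator (g ` E) a \<partial>lborel)"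
    by (simp add: \<nu>_def nn_integral_density mult.commute)
  finally show ?thesis .
qed

text \<open>Around a point with nonzero derivative \<open>g\<close> is injective on a ball;
  countably many such open sets, made disjoint, reduce the claim to the injective case. Critical
  points carry no mass on the left because the Jacobian vanishes there, and almost every value is
  taken at exactly \<open>m\<close> regular points.\<close>

lemma nn_integral_holomorphic_multiplicity:
  assumes U: "open U" "g holomorphic_on U" and f [measurable]: "f \<in> borel_measurable borel"
    and card: "AE a in lborel. finite {z \<in> U. g z = a \<and> deriv g z \<noteq> 0} \<and>
                 card {z \<in> U. g z = a \<and> deriv g z \<noteq> 0} = m"
  shows "(\<integral>\<^sup>+z. f (g z) * ennreal ((cmod (deriv g z))\<^sup>2) * indicator U z \<partial>lborel)
    = of_nat m * (\<integral>\<^sup>+a. f a \<partial>lborel)"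
proof -
  define U0 where "U0 = {z \<in> U. deriv g z \<noteq> 0}"
  define \<F> where "\<F> = {V. open V \<and> V \<subseteq> U \<and> inj_on g V}"
  obtain \<F>' where F': "\<F>' \<subseteq> \<F>" "countable \<F>'" "\<Union>\<F>' = \<Union>\<F>"
    using Lindelof[of \<F>] by (auto simp: \<F>_def)
  have "{} \<in> \<F>" by (simp add: \<F>_def)
  \<comment> \<open>The empty set is added so that the enumeration is onto even when the subcover is
    empty.\<close>
  define V where "V = from_nat_into (insert {} \<F>')"
  have rV: "range V = insert {} \<F>'"
    unfolding V_def using F'(2) by (intro range_from_nat_into) auto
  have VF: "open (V i)" "V i \<subseteq> U" "inj_on g (V i)" for i
  proof -
    have "V i \<in> insert {} \<F>'" unfolding rV[symmetric] by (rule rangeI)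
    then have "V i \<in> \<F>" using F'(1) \<open>{} \<in> \<F>\<close> by (metis insert_iff subsetD)
    then show "open (V i)" "V i \<subseteq> U" "inj_on g (V i)" by (auto simp: \<F>_def)
  qed
  have U0: "U0 \<subseteq> (\<Union>i. V i)"
  proof
    fix z assume z: "z \<in> U0"
    then obtain r where r: "r > 0" "ball z r \<subseteq> U" "inj_on g (ball z r)"
      using has_complex_derivative_locally_injective[OF U(2), of z] U(1) by (auto simp: U0_def)
    then have "ball z r \<in> \<F>" by (simp add: \<F>_def)
    then have "z \<in> \<Union>\<F>" using r(1) by (intro UnionI[of "ball z r"]) auto
    then have "z \<in> \<Union>\<F>'" by (simp only: F'(3))
    then have "z \<in> \<Union>(insert {} \<F>')" by simp
    then show "z \<in> (\<Union>i. V i)" unfolding rV[symmetric] .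
  qed
  have hol': "g holomorphic_on V i" for i
    using U(2) VF(2) holomorphic_on_subset by blast
  have op0: "open U0"
  proof -
    have "continuous_on U (deriv g)"
      using U by (intro holomorphic_on_imp_continuous_on holomorphic_deriv)
    then have "open (U \<inter> deriv g -` (- {0}))"
      by (rule continuous_open_preimage) (use U in auto)
    then show ?thesis by (simp add: U0_def vimage_def Int_def)
  qed
  define E where "E i = U0 \<inter> disjointed V i" for i
  have EV: "E i \<subseteq> V i" for i
    using disjointed_subset[of V i] by (auto simp: E_def)
  have [measurable]: "V i \<in> sets borel" "U0 \<in> sets borel" for i
    using VF(1) op0 by auto
  have Eb [measurable]: "E i \<in> sets borel" for i
  proof -
    have "range (disjointed V) \<subseteq> sets borel"
      by (rule sets.range_disjointed_sets) auto
    then show ?thesis unfolding E_def by (intro sets.Int) auto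
  qed
  have disj: "disjoint_family E"
    using disjoint_family_disjointed[of V] by (auto simp: disjoint_family_on_def E_def)
  have UE: "(\<Union>i. E i) = U0"
    using U0 UN_disjointed_eq[of V] by (auto simp: E_def)
  have [measurable]: "g ` E i \<in> sets borel" for i
    by (rule borel_holomorphic_image[OF VF(1) hol' VF(3) EV Eb])
  have "(\<integral>\<^sup>+z. f (g z) * ennreal ((cmod (deriv g z))\<^sup>2) * indicator U z \<partial>lborel) =
    (\<integral>\<^sup>+z. (\<Sum>i. f (g z) * ennreal ((cmod (deriv g z))\<^sup>2) * indicator (E i) z) \<partial>lborel)"
  proof (intro nn_integral_cong)
    fix z
    have "(\<Sum>i. f (g z) * ennreal ((cmod (deriv g z))\<^sup>2) * indicator (E i) z) =
      f (g z) * ennreal ((cmod (deriv g z))\<^sup>2) * indicator U0 z"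
      by (simp add: suminf_indicator[OF disj] UE)
    then show "f (g z) * ennreal ((cmod (deriv g z))\<^sup>2) * indicator U z =
      (\<Sum>i. f (g z) * ennreal ((cmod (deriv g z))\<^sup>2) * indicator (E i) z)"
      by (auto simp: U0_def indicator_def)
  qed
  also have "\<dots> = (\<Sum>i. \<integral>\<^sup>+z. f (g z) * ennreal ((cmod (deriv g z))\<^sup>2) * indicator (E i) z \<partial>lborel)"
  proof (rule nn_integral_suminf)
    fix i
    define d where "d z = (if z \<in> U then deriv g z else 0)" for z
    define G where "G z = (if z \<in> U then g z else 0)" for z
    have [measurable]: "d \<in> borel_measurable borel"
    proof -
      have "continuous_on U (deriv g)"
        using U by (intro holomorphic_on_imp_continuous_on holomorphic_deriv)
      then show ?thesis unfolding d_def using U(1)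
        by (intro borel_measurable_continuous_on_if) auto
    qed
    have [measurable]: "G \<in> borel_measurable borel"
      unfolding G_def using U(1) holomorphic_on_imp_continuous_on[OF U(2)]
      by (intro borel_measurable_continuous_on_if) auto
    have "(\<lambda>z. f (G z) * ennreal ((cmod (d z))\<^sup>2) * indicator (E i) z) \<in> borel_measurable lborel"
      by measurable
    also have "(\<lambda>z. f (G z) * ennreal ((cmod (d z))\<^sup>2) * indicator (E i) z) =
      (\<lambda>z. f (g z) * ennreal ((cmod (deriv g z))\<^sup>2) * indicator (E i) z)"
      using EV[of i] VF(2)[of i] by (auto simp: fun_eq_iff G_def d_def indicator_def)
    finally show "(\<lambda>z. f (g z) * ennreal ((cmod (deriv g z))\<^sup>2) * indicator (E i) z) \<in> borel_measurable lborel" .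
  qed
  also have "\<dots> = (\<Sum>i. \<integral>\<^sup>+a. f a * indicator (g ` E i) a \<partial>lborel)"
    by (intro suminf_cong nn_integral_holomorphic_inj[OF VF(1) hol' VF(3) EV Eb f])
  also have "\<dots> = (\<integral>\<^sup>+a. (\<Sum>i. f a * indicator (g ` E i) a) \<partial>lborel)"
    by (rule nn_integral_suminf[symmetric]) auto
  also have "\<dots> = (\<integral>\<^sup>+a. of_nat m * f a \<partial>lborel)"
  proof (rule nn_integral_cong_AE, use card in eventually_elim)
    case (elim a)
    define F where "F = {z \<in> U. g z = a \<and> deriv g z \<noteq> 0}"
    have F: "finite F" "card F = m" using elim by (auto simp: F_def)
    have FU: "F \<subseteq> U0" by (auto simp: F_def U0_def)
    \<comment> \<open>By injectivity on \<open>V i\<close> a piece holds at most one preimage of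
      \<open>a\<close>, so counting the pieces whose image contains \<open>a\<close> counts its
      regular preimages.\<close>
    have ind: "indicator (g ` E i) a = (\<Sum>z\<in>F. indicator (E i) z :: ennreal)" for i
    proof (cases "a \<in> g ` E i")
      case True
      then obtain z where z: "z \<in> E i" "a = g z" by auto
      then have zF: "z \<in> F" by (auto simp: F_def E_def U0_def)
      have uniq: "w = z" if "w \<in> F" "w \<in> E i" for w
        using that z EV[of i] VF(3)[of i] by (auto simp: F_def inj_on_def)
      have ind: "indicator (E i) w = (if w = z then 1 else 0 :: ennreal)" if "w \<in> F" for w
      proof (cases "w = z")
        case False
        then have "w \<notin> E i" using uniq that by blast
        then show ?thesis using False by simp
      qed (use z in simp)
      have "(\<Sum>z\<in>F. indicator (E i) z :: ennreal) = (\<Sum>w\<in>F. if w = z then 1 else 0)"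
        by (intro sum.cong refl ind)
      then show ?thesis using zF F True by simp
    next
      case False
      then have "w \<notin> E i" if "w \<in> F" for w using that by (auto simp: F_def)
      then show ?thesis using False by simp
    qed
    have "(\<Sum>i. f a * indicator (g ` E i) a) = f a * (\<Sum>i. \<Sum>z\<in>F. indicator (E i) z)"
      by (simp add: ind)
    also have "(\<Sum>i. \<Sum>z\<in>F. indicator (E i) z :: ennreal) = (\<Sum>z\<in>F. \<Sum>i. indicator (E i) z)"
      by (rule suminf_sum) simp
    also have "\<dots> = (\<Sum>z\<in>F. 1)"
      using FU by (intro sum.cong) (auto simp: suminf_indicator[OF disj] UE)
    finally show ?case using F by (simp add: mult.commute)
  qed
  also have "\<dots> = of_nat m * (\<integral>\<^sup>+a. f a \<partial>lborel)"
    by (rule nn_integral_cmult) simp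
  finally show ?thesis .
qed

lemma nn_integral_complex_affine:
  fixes d t :: complex
  assumes "d \<noteq> 0" and f: "f \<in> borel_measurable borel"
  shows "(\<integral>\<^sup>+z. f (d * z + t) \<partial>lborel) * ennreal ((cmod d)\<^sup>2) = (\<integral>\<^sup>+z. f z \<partial>lborel)"
proof -
  have [measurable]: "f \<in> borel_measurable borel" by (rule f)
  have inj: "inj (\<lambda>z. d * z + t)" using assms by (auto simp: inj_def)
  have der: "deriv (\<lambda>z. d * z + t) z = d" for z
    by (rule DERIV_imp_deriv) (auto intro!: derivative_eq_intros)
  have ran: "range (\<lambda>z. d * z + t) = UNIV"
  proof (intro equalityI subsetI)
    fix w show "w \<in> range (\<lambda>z. d * z + t)"
      using assms by (intro range_eqI[of _ _ "(w - t) / d"]) auto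
  qed auto
  have hol: "(\<lambda>z. d * z + t) holomorphic_on UNIV"
    by (intro holomorphic_intros)
  have "(\<integral>\<^sup>+z. f (d * z + t) \<partial>lborel) * ennreal ((cmod d)\<^sup>2) = (\<integral>\<^sup>+z. f (d * z + t) * ennreal ((cmod d)\<^sup>2) \<partial>lborel)"
    by (rule nn_integral_multc[symmetric]) measurable
  also have "\<dots> = (\<integral>\<^sup>+z. f (d * z + t) * ennreal ((cmod (deriv (\<lambda>z. d * z + t) z))\<^sup>2) * indicator UNIV z \<partial>lborel)"
    unfolding der by simp
  also have "\<dots> = (\<integral>\<^sup>+a. f a * indicator (range (\<lambda>z. d * z + t)) a \<partial>lborel)"
    by (rule nn_integral_holomorphic_inj[OF open_UNIV hol inj _ _ f]) auto
  also have "\<dots> = (\<integral>\<^sup>+z. f z \<partial>lborel)"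
    unfolding ran by simp
  finally show ?thesis .
qed

section \<open>Linear changes of variables\<close>

interpretation cprod: product_sigma_finite "\<lambda>_. lborel :: complex measure"
  by standard

abbreviation cleb :: "'i set \<Rightarrow> ('i \<Rightarrow> complex) measure" where
  "cleb I \<equiv> Pi\<^sub>M I (\<lambda>_. lborel)"

lemma sigma_finite_cleb [simp, intro]: "finite I \<Longrightarrow> sigma_finite_measure (cleb I)"
  by (rule cprod.sigma_finite)

lemma pair_sigma_finite_cleb: "finite I \<Longrightarrow> finite K \<Longrightarrow> pair_sigma_finite (cleb I) (cleb K)"
  by (simp add: pair_sigma_finite_def)

text \<open>Every coordinate contributes one factor |d|^2, by the affine substitution in the
  plane.\<close>

lemma nn_integral_cleb_affine:
  fixes d :: complex
  assumes d: "d \<noteq> 0" and fin: "finite I" and f: "f \<in> borel_measurable (cleb I)"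
  shows "(\<integral>\<^sup>+x. f (\<lambda>i\<in>I. d * x i + t i) \<partial>cleb I) * ennreal ((cmod d) ^ (2 * card I))
    = (\<integral>\<^sup>+x. f x \<partial>cleb I)"
  using fin f
proof (induction I arbitrary: f rule: finite_induct)
  case empty
  then show ?case
    by (simp add: PiM_empty nn_integral_count_space_finite restrict_def)
next
  case (insert i I)
  note [measurable] = insert.prems
  interpret sigma_finite_measure "cleb I" using insert.hyps by simp
  define c where "c = ennreal ((cmod d)\<^sup>2)"
  have upd [measurable]: "(\<lambda>p. (fst p)(i := snd p)) \<in> measurable (cleb I \<Otimes>\<^sub>M lborel) (cleb (insert i I))"
    using measurable_add_dim[of i I "\<lambda>_. lborel :: complex measure"] by (simp add: case_prod_unfold)
  have trm [measurable]: "(\<lambda>x. \<lambda>k\<in>J. d * x k + t k) \<in> measurable (cleb J) (cleb J)" for J :: "'a set"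
    by (intro measurable_restrict) simp
  define H where "H x = (\<integral>\<^sup>+y. f (x(i := y)) \<partial>lborel)" for x
  have fm: "(\<lambda>p. f ((fst p)(i := snd p))) \<in> borel_measurable (cleb I \<Otimes>\<^sub>M lborel)"
    by measurable
  have H [measurable]: "H \<in> borel_measurable (cleb I)"
    unfolding H_def using fm by (intro lborel.borel_measurable_nn_integral) (simp add: case_prod_unfold)
  have "(\<integral>\<^sup>+x. f (\<lambda>k\<in>insert i I. d * x k + t k) \<partial>cleb (insert i I)) =
     (\<integral>\<^sup>+x. (\<integral>\<^sup>+y. f (\<lambda>k\<in>insert i I. d * (x(i := y)) k + t k) \<partial>lborel) \<partial>cleb I)"
    by (rule cprod.product_nn_integral_insert) (use insert.hyps in auto)
  also have "\<dots> = (\<integral>\<^sup>+x. (\<integral>\<^sup>+y. f ((\<lambda>k\<in>I. d * x k + t k)(i := d * y + t i)) \<partial>lborel) \<partial>cleb I)"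
    using insert.hyps by (intro nn_integral_cong arg_cong[of _ _ f]) (auto simp: fun_eq_iff)
  finally have "(\<integral>\<^sup>+x. f (\<lambda>k\<in>insert i I. d * x k + t k) \<partial>cleb (insert i I)) * c =
     (\<integral>\<^sup>+x. (\<integral>\<^sup>+y. f ((\<lambda>k\<in>I. d * x k + t k)(i := d * y + t i)) \<partial>lborel) * c \<partial>cleb I)"
    by (subst nn_integral_multc) auto
  also have "\<dots> = (\<integral>\<^sup>+x. H (\<lambda>k\<in>I. d * x k + t k) \<partial>cleb I)"
  proof (intro nn_integral_cong)
    fix x assume "x \<in> space (cleb I)"
    then have "(\<lambda>k\<in>I. d * x k + t k) \<in> space (cleb I)" by (simp add: space_PiM)
    then have "(\<lambda>y. f ((\<lambda>k\<in>I. d * x k + t k)(i := y))) \<in> borel_measurable borel"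
      using measurable_compose[OF measurable_Pair1' fm, of "\<lambda>k\<in>I. d * x k + t k"] by simp
    from nn_integral_complex_affine[OF d this, of "t i"]
    show "(\<integral>\<^sup>+y. f ((\<lambda>k\<in>I. d * x k + t k)(i := d * y + t i)) \<partial>lborel) * c = H (\<lambda>k\<in>I. d * x k + t k)"
      by (simp add: H_def c_def)
  qed
  finally have "(\<integral>\<^sup>+x. f (\<lambda>k\<in>insert i I. d * x k + t k) \<partial>cleb (insert i I)) * c *
      ennreal ((cmod d) ^ (2 * card I)) = (\<integral>\<^sup>+x. H x \<partial>cleb I)"
    by (simp only: insert.IH[OF H])
  also have "\<dots> = (\<integral>\<^sup>+x. f x \<partial>cleb (insert i I))"
    unfolding H_def by (rule cprod.product_nn_integral_insert[symmetric]) (use insert in auto)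
  finally have "(\<integral>\<^sup>+x. f (\<lambda>k\<in>insert i I. d * x k + t k) \<partial>cleb (insert i I)) *
      (c * ennreal ((cmod d) ^ (2 * card I))) = (\<integral>\<^sup>+x. f x \<partial>cleb (insert i I))"
    by (simp only: mult.assoc)
  moreover have "c * ennreal ((cmod d) ^ (2 * card I)) = ennreal ((cmod d) ^ (2 * card (insert i I)))"
    using insert.hyps by (simp add: c_def ennreal_mult[symmetric] power_add power2_eq_square)
  ultimately show ?case by (simp only:)
qed

lemma nn_integral_cleb_fold:
  assumes "finite I" "finite K" "I \<inter> K = {}" and [measurable]: "f \<in> borel_measurable (cleb (I \<union> K))"
  shows "(\<integral>\<^sup>+x. f x \<partial>cleb (I \<union> K)) = (\<integral>\<^sup>+x. \<integral>\<^sup>+y. f (merge I K (x, y)) \<partial>cleb K \<partial>cleb I)"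
    and "(\<integral>\<^sup>+x. f x \<partial>cleb (I \<union> K)) = (\<integral>\<^sup>+y. \<integral>\<^sup>+x. f (merge I K (x, y)) \<partial>cleb I \<partial>cleb K)"
proof -
  show *: "(\<integral>\<^sup>+x. f x \<partial>cleb (I \<union> K)) = (\<integral>\<^sup>+x. \<integral>\<^sup>+y. f (merge I K (x, y)) \<partial>cleb K \<partial>cleb I)"
    by (rule cprod.product_nn_integral_fold) (use assms in auto)
  show "(\<integral>\<^sup>+x. f x \<partial>cleb (I \<union> K)) = (\<integral>\<^sup>+y. \<integral>\<^sup>+x. f (merge I K (x, y)) \<partial>cleb I \<partial>cleb K)"
    unfolding * by (rule pair_sigma_finite.Fubini'[symmetric, OF pair_sigma_finite_cleb])
      (use assms in \<open>auto simp: case_prod_unfold\<close>)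
qed

lemma merge_section_measurable:
  assumes "f \<in> borel_measurable (cleb (I \<union> K))" "y \<in> space (cleb K)"
  shows "(\<lambda>x. f (merge I K (x, y))) \<in> borel_measurable (cleb I)"
  using measurable_compose[OF measurable_Pair2'[OF assms(2)] measurable_compose[OF measurable_merge assms(1)]]
  by simp

text \<open>For each fixed \<open>y\<close> the map is a translation of the \<open>x\<close> block,
  so the inner integral is unchanged.\<close>

lemma nn_integral_cleb_shear:
  assumes I: "finite I" "finite K" "I \<inter> K = {}" and f [measurable]: "f \<in> borel_measurable (cleb (I \<union> K))"
  shows "(\<integral>\<^sup>+y. \<integral>\<^sup>+x. f (merge I K (\<lambda>p\<in>I. x p + t y p, y)) \<partial>cleb I \<partial>cleb K) = (\<integral>\<^sup>+x. f x \<partial>cleb (I \<union> K))"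
proof -
  have "(\<integral>\<^sup>+x. f (merge I K (\<lambda>p\<in>I. x p + t y p, y)) \<partial>cleb I) = (\<integral>\<^sup>+x. f (merge I K (x, y)) \<partial>cleb I)"
    if "y \<in> space (cleb K)" for y
    using nn_integral_cleb_affine[of 1 I "\<lambda>x. f (merge I K (x, y))" "t y"] merge_section_measurable[OF f that] I
    by simp
  then show ?thesis
    using nn_integral_cleb_fold(2)[OF I f] by (simp cong: nn_integral_cong)
qed

text \<open>The column index set \<open>J\<close> is kept general: \<open>{n}\<close> serves for
  substituting a single column, \<open>{..<n}\<close> for multiplying square matrices.\<close>

definition left_mult :: "nat \<Rightarrow> 'j set \<Rightarrow> (nat \<Rightarrow> nat \<Rightarrow> complex) \<Rightarrow> (nat \<times> 'j \<Rightarrow> complex) \<Rightarrow> nat \<times> 'j \<Rightarrow> complex" where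
  "left_mult n J R x = (\<lambda>p\<in>{..<n} \<times> J. \<Sum>k<n. R (fst p) k * x (k, snd p))"

lemma measurable_left_mult [measurable]:
  "left_mult n J R \<in> measurable (cleb ({..<n} \<times> J)) (cleb ({..<n} \<times> J))"
  unfolding left_mult_def
proof (rule measurable_restrict)
  fix p assume "p \<in> {..<n} \<times> J"
  then have "(\<lambda>x. x (k, snd p)) \<in> borel_measurable (cleb ({..<n} \<times> J))" if "k < n" for k
    using that measurable_component_singleton[of "(k, snd p)" "{..<n} \<times> J" "\<lambda>_. lborel :: complex measure"] by auto
  then show "(\<lambda>x. \<Sum>k<n. R (fst p) k * x (k, snd p)) \<in> measurable (cleb ({..<n} \<times> J)) lborel"
    unfolding measurable_lborel1 by (intro borel_measurable_sum borel_measurable_times) auto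
qed

text \<open>One step of block elimination with pivot \<open>R n n\<close>: the matrix is a unit
  upper triangular one times a block lower triangular one whose leading block is the Schur
  complement.\<close>

lemma det_Suc_Schur:
  fixes R :: "nat \<Rightarrow> nat \<Rightarrow> complex"
  assumes "R n n \<noteq> 0"
  shows "Determinant.det (mat (Suc n) (Suc n) (\<lambda>(i, j). R i j)) =
    R n n * Determinant.det (mat n n (\<lambda>(i, j). R i j - R i n * R n j / R n n))"
proof -
  define P where "P = four_block_mat (1\<^sub>m n) (mat n 1 (\<lambda>(i, j). R i n / R n n)) (0\<^sub>m 1 n) (1\<^sub>m 1)"
  define Q where "Q = four_block_mat (mat n n (\<lambda>(i, j). R i j - R i n * R n j / R n n)) (0\<^sub>m n 1)
     (mat 1 n (\<lambda>(i, j). R n j)) (mat 1 1 (\<lambda>_. R n n))"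
  have P: "P \<in> carrier_mat (Suc n) (Suc n)" and Q: "Q \<in> carrier_mat (Suc n) (Suc n)"
    unfolding P_def Q_def carrier_mat_def by auto
  have "P * Q = mat (Suc n) (Suc n) (\<lambda>(i, j). R i j)"
    unfolding P_def Q_def
    apply (subst mult_four_block_mat[where ?nr1.0=n and ?n1.0=n and ?n2.0=1 and ?nr2.0=1 and ?nc1.0=n and ?nc2.0=1])
    using assms by (auto intro!: eq_matI simp: scalar_prod_def four_block_mat_def less_Suc_eq)
  then have "Determinant.det (mat (Suc n) (Suc n) (\<lambda>(i, j). R i j)) = Determinant.det P * Determinant.det Q"
    using det_mult[OF P Q] by simp
  also have "Determinant.det P = 1"
  proof -
    have "Determinant.det P = prod_list (diag_mat P)"
      by (rule det_upper_triangular[OF _ P]) (auto simp: P_def upper_triangular_def four_block_mat_def)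
    also have "diag_mat P = replicate (Suc n) 1"
      using P by (auto simp: diag_mat_def P_def four_block_mat_def intro!: nth_equalityI simp del: upt_Suc replicate_Suc)
    finally show ?thesis by simp
  qed
  also have "Determinant.det Q = Determinant.det (mat n n (\<lambda>(i, j). R i j - R i n * R n j / R n n)) * R n n"
    unfolding Q_def
    by (subst det_four_block_mat_upper_right_zero[where n=n and m=1]) (auto simp: det_single)
  finally show ?thesis by simp
qed

text \<open>Gaussian elimination shows that the Jacobian is |det|^2 for each column in
  \<open>J\<close>: with a nonzero pivot the last row is an affine substitution, the other rows
  follow by induction on the Schur complement, and a shear remains. A zero pivot is repaired by a
  column operation.\<close>

lemma nn_integral_left_mult:
  fixes R :: "nat \<Rightarrow> nat \<Rightarrow> complex"
  assumes J: "finite J" and f: "f \<in> borel_measurable (cleb ({..<n} \<times> J))"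
    and det: "Determinant.det (mat n n (\<lambda>(i, j). R i j)) \<noteq> 0"
  shows "(\<integral>\<^sup>+x. f (left_mult n J R x) \<partial>cleb ({..<n} \<times> J)) *
      ennreal (cmod (Determinant.det (mat n n (\<lambda>(i, j). R i j))) ^ (2 * card J))
    = (\<integral>\<^sup>+x. f x \<partial>cleb ({..<n} \<times> J))"
  using f det
proof (induction n arbitrary: R f)
  case 0
  then show ?case
    by (simp add: PiM_empty nn_integral_count_space_finite left_mult_def restrict_def)
next
  case (Suc n)
  define I where "I = {..<n} \<times> J"
  define K where "K = {n} \<times> J"
  have fin: "finite I" "finite K" "I \<inter> K = {}" and un: "{..<Suc n} \<times> J = I \<union> K"
    using J by (auto simp: I_def K_def lessThan_Suc)
  have cardK: "card K = card J" by (simp add: K_def card_cartesian_product)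
  have main: "(\<integral>\<^sup>+x. f (left_mult (Suc n) J R x) \<partial>cleb (I \<union> K)) *
      ennreal (cmod (Determinant.det (mat (Suc n) (Suc n) (\<lambda>(i, j). R i j))) ^ (2 * card J))
    = (\<integral>\<^sup>+x. f x \<partial>cleb (I \<union> K))"
    if d: "R n n \<noteq> 0" and det: "Determinant.det (mat (Suc n) (Suc n) (\<lambda>(i, j). R i j)) \<noteq> 0"
      and f [measurable]: "f \<in> borel_measurable (cleb (I \<union> K))" for R f
  proof -
    define S where "S i j = R i j - R i n * R n j / R n n" for i j
    define D where "D = Determinant.det (mat n n (\<lambda>(i, j). S i j))"
    have detR: "Determinant.det (mat (Suc n) (Suc n) (\<lambda>(i, j). R i j)) = R n n * D"
      unfolding D_def S_def by (rule det_Suc_Schur[of R n, OF d])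
    have D0: "D \<noteq> 0" using det detR by auto
    define a where "a = ennreal (cmod (R n n) ^ (2 * card J))"
    define b where "b = ennreal (cmod D ^ (2 * card J))"
    have lm [measurable]: "left_mult (Suc n) J R \<in> measurable (cleb (I \<union> K)) (cleb (I \<union> K))"
      using measurable_left_mult[of "Suc n" J R] by (simp add: un)
    have lm' [measurable]: "left_mult n J S \<in> measurable (cleb I) (cleb I)"
      using measurable_left_mult[of n J S] by (simp add: I_def)
    \<comment> \<open>\<open>h\<close> is the integrand in terms of the new last row
      \<open>y\<close>; the old \<open>x\<close> then enters only through the Schur
      complement.\<close>
    define h where "h x y = f (merge I K (\<lambda>p\<in>I. left_mult n J S x p + R (fst p) n / R n n * y (n, snd p), y))" for x y
    have split: "left_mult (Suc n) J R (merge I K (x, y)) =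
       merge I K (\<lambda>p\<in>I. left_mult n J S x p + R (fst p) n / R n n * (\<lambda>p\<in>K. R n n * y p + (\<Sum>k<n. R n k * x (k, snd p))) (n, snd p),
         \<lambda>p\<in>K. R n n * y p + (\<Sum>k<n. R n k * x (k, snd p)))" for x y
    proof
      fix p :: "nat \<times> 'a"
      obtain i j where p: "p = (i, j)" by (cases p)
      consider "i < n" "j \<in> J" | "i = n" "j \<in> J" | "p \<notin> I \<union> K"
        by (auto simp: p I_def K_def)
      then show "left_mult (Suc n) J R (merge I K (x, y)) p =
         merge I K (\<lambda>p\<in>I. left_mult n J S x p + R (fst p) n / R n n * (\<lambda>p\<in>K. R n n * y p + (\<Sum>k<n. R n k * x (k, snd p))) (n, snd p),
         \<lambda>p\<in>K. R n n * y p + (\<Sum>k<n. R n k * x (k, snd p))) p"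
      proof cases
        case 1
        have "(\<Sum>k<n. S i k * x (k, j)) + R i n / R n n * (\<Sum>k<n. R n k * x (k, j)) = (\<Sum>k<n. R i k * x (k, j))"
          by (simp add: sum_distrib_left S_def sum.distrib[symmetric] algebra_simps)
        then show ?thesis using 1 d
          by (simp add: p left_mult_def merge_def I_def K_def distrib_left add_divide_distrib algebra_simps)
      next
        case 2
        then show ?thesis
          by (simp add: p left_mult_def merge_def I_def K_def algebra_simps)
      next
        case 3
        then show ?thesis using un by (simp add: left_mult_def merge_def)
      qed
    qed
    have hm [measurable]: "(\<lambda>z. h (fst z) (snd z)) \<in> borel_measurable (cleb I \<Otimes>\<^sub>M cleb K)"
      unfolding h_def
    proof (intro measurable_compose[OF _ f] measurable_compose[OF _ measurable_merge] measurable_Pair measurable_restrict)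
      fix p assume p: "p \<in> I"
      then have "(n, snd p) \<in> K" by (auto simp: I_def K_def)
      then have 1: "(\<lambda>z. snd z (n, snd p)) \<in> borel_measurable (cleb I \<Otimes>\<^sub>M cleb K)"
        using measurable_compose[OF measurable_snd measurable_component_singleton[of "(n, snd p)" K "\<lambda>_. lborel :: complex measure"]] by simp
      have 2: "(\<lambda>z. left_mult n J S (fst z) p) \<in> borel_measurable (cleb I \<Otimes>\<^sub>M cleb K)"
        using measurable_compose[OF measurable_compose[OF measurable_fst lm'] measurable_component_singleton[OF p, of "\<lambda>_. lborel :: complex measure"]] by simp
      show "(\<lambda>z. left_mult n J S (fst z) p + R (fst p) n / R n n * snd z (n, snd p)) \<in> measurable (cleb I \<Otimes>\<^sub>M cleb K) lborel"
        unfolding measurable_lborel1 using 1 2 by simp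
    qed auto
    have "(\<integral>\<^sup>+x. f (left_mult (Suc n) J R x) \<partial>cleb (I \<union> K)) =
      (\<integral>\<^sup>+x. \<integral>\<^sup>+y. f (left_mult (Suc n) J R (merge I K (x, y))) \<partial>cleb K \<partial>cleb I)"
      by (rule nn_integral_cleb_fold(1)[OF fin]) measurable
    also have "\<dots> = (\<integral>\<^sup>+x. \<integral>\<^sup>+y. h x (\<lambda>p\<in>K. R n n * y p + (\<Sum>k<n. R n k * x (k, snd p))) \<partial>cleb K \<partial>cleb I)"
      unfolding h_def split ..
    finally have "(\<integral>\<^sup>+x. f (left_mult (Suc n) J R x) \<partial>cleb (I \<union> K)) * a =
       (\<integral>\<^sup>+x. \<integral>\<^sup>+y. h x (\<lambda>p\<in>K. R n n * y p + (\<Sum>k<n. R n k * x (k, snd p))) \<partial>cleb K \<partial>cleb I) * a" by simp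
    also have "\<dots> = (\<integral>\<^sup>+x. (\<integral>\<^sup>+y. h x (\<lambda>p\<in>K. R n n * y p + (\<Sum>k<n. R n k * x (k, snd p))) \<partial>cleb K) * a \<partial>cleb I)"
    proof (rule nn_integral_multc[symmetric])
      have "(\<lambda>x. \<integral>\<^sup>+y. f (left_mult (Suc n) J R (merge I K (x, y))) \<partial>cleb K) \<in> borel_measurable (cleb I)"
        using fin by (intro sigma_finite_measure.borel_measurable_nn_integral) (auto simp: case_prod_unfold)
      then show "(\<lambda>x. \<integral>\<^sup>+y. h x (\<lambda>p\<in>K. R n n * y p + (\<Sum>k<n. R n k * x (k, snd p))) \<partial>cleb K) \<in> borel_measurable (cleb I)"
        unfolding split h_def .
    qed
    also have "\<dots> = (\<integral>\<^sup>+x. \<integral>\<^sup>+y. h x y \<partial>cleb K \<partial>cleb I)"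
    proof (intro nn_integral_cong)
      fix x assume "x \<in> space (cleb I)"
      then have "h x \<in> borel_measurable (cleb K)"
        using measurable_compose[OF measurable_Pair1' hm] by simp
      from nn_integral_cleb_affine[OF d fin(2) this, of "\<lambda>p. \<Sum>k<n. R n k * x (k, snd p)"]
      show "(\<integral>\<^sup>+y. h x (\<lambda>p\<in>K. R n n * y p + (\<Sum>k<n. R n k * x (k, snd p))) \<partial>cleb K) * a = (\<integral>\<^sup>+y. h x y \<partial>cleb K)"
        by (simp only: a_def cardK)
    qed
    also have "\<dots> = (\<integral>\<^sup>+y. \<integral>\<^sup>+x. h x y \<partial>cleb I \<partial>cleb K)"
      by (rule pair_sigma_finite.Fubini'[symmetric, OF pair_sigma_finite_cleb]) (use fin in \<open>auto simp: case_prod_unfold\<close>)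
    finally have "(\<integral>\<^sup>+x. f (left_mult (Suc n) J R x) \<partial>cleb (I \<union> K)) * a * b = (\<integral>\<^sup>+y. \<integral>\<^sup>+x. h x y \<partial>cleb I \<partial>cleb K) * b"
      by simp
    also have "\<dots> = (\<integral>\<^sup>+y. (\<integral>\<^sup>+x. h x y \<partial>cleb I) * b \<partial>cleb K)"
    proof (rule nn_integral_multc[symmetric])
      have "(\<lambda>z. h (snd z) (fst z)) \<in> borel_measurable (cleb K \<Otimes>\<^sub>M cleb I)"
        using measurable_compose[OF measurable_pair_swap' hm] by (simp add: case_prod_unfold)
      then show "(\<lambda>y. \<integral>\<^sup>+x. h x y \<partial>cleb I) \<in> borel_measurable (cleb K)"
        using fin by (intro sigma_finite_measure.borel_measurable_nn_integral) (auto simp: case_prod_unfold)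
    qed
    also have "\<dots> = (\<integral>\<^sup>+y. \<integral>\<^sup>+x. f (merge I K (\<lambda>p\<in>I. x p + R (fst p) n / R n n * y (n, snd p), y)) \<partial>cleb I \<partial>cleb K)"
    proof (intro nn_integral_cong)
      fix y assume y: "y \<in> space (cleb K)"
      define F where "F x = f (merge I K (\<lambda>p\<in>I. x p + R (fst p) n / R n n * y (n, snd p), y))" for x
      have "(\<lambda>x. \<lambda>p\<in>I. x p + R (fst p) n / R n n * y (n, snd p)) \<in> measurable (cleb I) (cleb I)"
        by (intro measurable_restrict) simp
      from measurable_compose[OF this merge_section_measurable[OF f y]]
      have "F \<in> borel_measurable (cleb I)" by (simp only: F_def[abs_def])
      then have "F \<in> borel_measurable (cleb ({..<n} \<times> J))" by (simp only: I_def)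
      from Suc.IH[OF this D0[unfolded D_def]]
      have "(\<integral>\<^sup>+x. F (left_mult n J S x) \<partial>cleb I) * b = (\<integral>\<^sup>+x. F x \<partial>cleb I)"
        by (simp only: I_def b_def D_def)
      then show "(\<integral>\<^sup>+x. h x y \<partial>cleb I) * b =
        (\<integral>\<^sup>+x. f (merge I K (\<lambda>p\<in>I. x p + R (fst p) n / R n n * y (n, snd p), y)) \<partial>cleb I)"
        by (simp only: F_def h_def)
    qed
    also have "\<dots> = (\<integral>\<^sup>+x. f x \<partial>cleb (I \<union> K))"
      by (rule nn_integral_cleb_shear[OF fin f])
    finally show ?thesis
      by (simp add: detR a_def b_def norm_mult power_mult_distrib ennreal_mult mult.assoc)
  qed
  have f: "f \<in> borel_measurable (cleb (I \<union> K))" using Suc.prems(1) by (simp add: un)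
  show ?case
  proof (cases "R n n = 0")
    case False
    show ?thesis unfolding un by (rule main[OF False Suc.prems(2) f])
  next
    case True
    have "\<exists>k<n. R n k \<noteq> 0"
    proof (rule ccontr)
      assume "\<not> (\<exists>k<n. R n k \<noteq> 0)"
      then have z: "R n k = 0" if "k \<le> n" for k using that True by (cases "k = n") auto
      have "mat (Suc n) (Suc n) (\<lambda>(i, j). R i j) =
        mat\<^sub>r (Suc n) (Suc n) (\<lambda>i. if i = n then 0\<^sub>v (Suc n) else row (mat (Suc n) (Suc n) (\<lambda>(i, j). R i j)) i)"
        using z by (intro eq_matI) auto
      also have "Determinant.det \<dots> = 0"
        by (rule det_row_0) auto
      finally show False using Suc.prems(2) by simp
    qed
    then obtain k where k: "k < n" "R n k \<noteq> 0" by blast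
    \<comment> \<open>Adding column \<open>k\<close> to column \<open>n\<close> keeps the
      determinant and corresponds to shearing row \<open>k\<close> of the argument by its last
      row.\<close>
    define R' where "R' i j = (if j = n then R i n + R i k else R i j)" for i j
    have R': "R' n n \<noteq> 0" using k True by (simp add: R'_def)
    have "mat (Suc n) (Suc n) (\<lambda>(i, j). R' i j) = addcol 1 n k (mat (Suc n) (Suc n) (\<lambda>(i, j). R i j))"
      using k by (intro eq_matI) (auto simp: R'_def)
    then have detR': "Determinant.det (mat (Suc n) (Suc n) (\<lambda>(i, j). R' i j)) = Determinant.det (mat (Suc n) (Suc n) (\<lambda>(i, j). R i j))"
      using det_addcol[of k "Suc n" n "mat (Suc n) (Suc n) (\<lambda>(i, j). R i j)" 1] k by simp
    have lm [measurable]: "left_mult (Suc n) J R \<in> measurable (cleb (I \<union> K)) (cleb (I \<union> K))" for R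
      using measurable_left_mult[of "Suc n" J R] by (simp add: un)
    note f [measurable]
    have "(\<integral>\<^sup>+x. f (left_mult (Suc n) J R x) \<partial>cleb (I \<union> K)) = (\<integral>\<^sup>+y. \<integral>\<^sup>+x. f (left_mult (Suc n) J R
         (merge I K (\<lambda>p\<in>I. x p + (if fst p = k then y (n, snd p) else 0), y))) \<partial>cleb I \<partial>cleb K)"
      by (rule nn_integral_cleb_shear[OF fin, symmetric]) measurable
    also have "\<dots> = (\<integral>\<^sup>+y. \<integral>\<^sup>+x. f (left_mult (Suc n) J R' (merge I K (x, y))) \<partial>cleb I \<partial>cleb K)"
    proof (intro nn_integral_cong arg_cong[of _ _ f])
      fix x y
      show "left_mult (Suc n) J R (merge I K (\<lambda>p\<in>I. x p + (if fst p = k then y (n, snd p) else 0), y)) =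
        left_mult (Suc n) J R' (merge I K (x, y))"
      proof
        fix p :: "nat \<times> 'a"
        obtain i j where p: "p = (i, j)" by (cases p)
        have "(\<Sum>l<n. R i l * (x (l, j) + (if l = k then y (n, j) else 0))) = (\<Sum>l<n. R i l * x (l, j)) + (\<Sum>l<n. if l = k then R i l * y (n, j) else 0)"
          unfolding sum.distrib[symmetric] by (intro sum.cong) (auto simp: distrib_left)
        also have "(\<Sum>l<n. if l = k then R i l * y (n, j) else 0) = R i k * y (n, j)"
          using k by (simp add: sum.delta)
        finally have e: "(\<Sum>l<n. R i l * (x (l, j) + (if l = k then y (n, j) else 0))) = (\<Sum>l<n. R i l * x (l, j)) + R i k * y (n, j)" .
        show "left_mult (Suc n) J R (merge I K (\<lambda>p\<in>I. x p + (if fst p = k then y (n, snd p) else 0), y)) p =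
          left_mult (Suc n) J R' (merge I K (x, y)) p"
        proof (cases "p \<in> {..<Suc n} \<times> J")
          case True
          then have j: "j \<in> J" by (simp add: p)
          have L: "(\<Sum>l<n. R i l * merge I K (\<lambda>p\<in>I. x p + (if fst p = k then y (n, snd p) else 0), y) (l, j)) =
              (\<Sum>l<n. R i l * x (l, j)) + R i k * y (n, j)"
            unfolding e[symmetric] using j by (intro sum.cong) (auto simp: merge_def I_def)
          have L': "(\<Sum>l<n. R' i l * merge I K (x, y) (l, j)) = (\<Sum>l<n. R i l * x (l, j))"
            using j by (intro sum.cong) (auto simp: merge_def I_def R'_def)
          have M: "merge I K (z, y) (n, j) = y (n, j)" for z
            using j by (simp add: merge_def I_def K_def)
          have "left_mult (Suc n) J R (merge I K (\<lambda>p\<in>I. x p + (if fst p = k then y (n, snd p) else 0), y)) p =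
             (\<Sum>l<n. R i l * x (l, j)) + R i k * y (n, j) + R i n * y (n, j)"
            using True by (simp only: left_mult_def p fst_conv snd_conv restrict_apply' sum.lessThan_Suc L M)
          moreover have "left_mult (Suc n) J R' (merge I K (x, y)) p = (\<Sum>l<n. R i l * x (l, j)) + R' i n * y (n, j)"
            using True by (simp only: left_mult_def p fst_conv snd_conv restrict_apply' sum.lessThan_Suc L' M)
          ultimately show ?thesis by (simp add: R'_def algebra_simps)
        qed (simp add: left_mult_def)
      qed
    qed
    also have "\<dots> = (\<integral>\<^sup>+x. f (left_mult (Suc n) J R' x) \<partial>cleb (I \<union> K))"
      by (rule nn_integral_cleb_fold(2)[OF fin, symmetric]) measurable
    finally have eq: "(\<integral>\<^sup>+x. f (left_mult (Suc n) J R x) \<partial>cleb (I \<union> K)) =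
      (\<integral>\<^sup>+x. f (left_mult (Suc n) J R' x) \<partial>cleb (I \<union> K))" .
    show ?thesis
      unfolding un eq detR'[symmetric] by (rule main[of R' f, OF R' _ f]) (simp only: detR' Suc.prems(2) not_False_eq_True)
  qed
qed

section \<open>The incomplete Gamma function\<close>

text \<open>As an extended nonnegative integral it needs no integrability arguments;
  \<open>upper_Gamma_finite\<close> supplies finiteness where real values are wanted.\<close>

definition upper_Gamma :: "real \<Rightarrow> real \<Rightarrow> ennreal" where
  "upper_Gamma s t = (\<integral>\<^sup>+y\<in>{t..}. ennreal (y powr (s - 1) * exp (- y)) \<partial>lborel)"

lemma upper_Gamma_zero: "s > 0 \<Longrightarrow> upper_Gamma s 0 = ennreal (Gamma s)"
  unfolding upper_Gamma_def
  using nn_integral_has_integral_lebesgue'[OF _ Gamma_integral_real[of s]]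
  by (simp add: exp_minus field_simps)

text \<open>Integration by parts. For \<open>t \<ge> s\<close> the derivative of
  \<open>- (y powr s * exp (- y))\<close> is nonnegative beyond \<open>t\<close>, so the fundamental
  theorem for nonnegative integrals applies directly.\<close>

lemma upper_Gamma_Suc:
  assumes "s > 0" "t \<ge> s"
  shows "upper_Gamma (s + 1) t = ennreal s * upper_Gamma s t + ennreal (t powr s * exp (- t))"
proof -
  have "(\<integral>\<^sup>+y\<in>{t..}. ennreal (y powr s * exp (- y) - s * y powr (s - 1) * exp (- y)) \<partial>lborel)
      = ennreal (0 - (- (t powr s * exp (- t))))"
  proof (rule nn_integral_FTC_atLeast)
    show "((\<lambda>y. - (y powr s * exp (- y))) has_real_derivative
        (y powr s * exp (- y) - s * y powr (s - 1) * exp (- y))) (at y)" if "t \<le> y" for y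
      using that assms by (auto intro!: derivative_eq_intros simp: field_simps powr_diff)
    show "0 \<le> y powr s * exp (- y) - s * y powr (s - 1) * exp (- y)" if "t \<le> y" for y
    proof -
      have "s * y powr (s - 1) \<le> y * y powr (s - 1)"
        using that assms by (intro mult_right_mono) auto
      also have "\<dots> = y powr s"
        using that assms by (simp add: powr_diff)
      finally show ?thesis by (simp add: mult_right_mono)
    qed
    show "((\<lambda>y. - (y powr s * exp (- y))) \<longlongrightarrow> 0) at_top"
      by real_asymp
  qed simp
  then have 1: "(\<integral>\<^sup>+y\<in>{t..}. ennreal (y powr s * exp (- y) - s * y powr (s - 1) * exp (- y)) \<partial>lborel)
      = ennreal (t powr s * exp (- t))" by simp
  have "upper_Gamma (s + 1) t = (\<integral>\<^sup>+y. ennreal s * (ennreal (y powr (s - 1) * exp (- y)) * indicator {t..} y)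
     + ennreal (y powr s * exp (- y) - s * y powr (s - 1) * exp (- y)) * indicator {t..} y \<partial>lborel)"
    unfolding upper_Gamma_def
  proof (intro nn_integral_cong)
    fix y :: real
    show "ennreal (y powr (s + 1 - 1) * exp (- y)) * indicator {t..} y =
      ennreal s * (ennreal (y powr (s - 1) * exp (- y)) * indicator {t..} y)
     + ennreal (y powr s * exp (- y) - s * y powr (s - 1) * exp (- y)) * indicator {t..} y"
    proof (cases "t \<le> y")
      case True
      have "s * y powr (s - 1) \<le> y * y powr (s - 1)"
        using True assms by (intro mult_right_mono) auto
      also have "\<dots> = y powr s"
        using True assms by (simp add: powr_diff)
      finally have "s * y powr (s - 1) * exp (- y) \<le> y powr s * exp (- y)" by (simp add: mult_right_mono)
      then show ?thesis using True assms
        by (simp add: ennreal_mult[symmetric] ennreal_plus[symmetric] mult.assoc del: ennreal_plus)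
    qed simp
  qed
  also have "\<dots> = ennreal s * upper_Gamma s t + ennreal (t powr s * exp (- t))"
    unfolding upper_Gamma_def
    by (subst nn_integral_add) (auto simp: nn_integral_cmult 1)
  finally show ?thesis .
qed

text \<open>The tangent bound ln (y / t) \<le> y / t - 1 dominates the integrand by an exponential
  of rate \<open>1 - (s - 1) / t\<close> that agrees with it at \<open>y = t\<close>.\<close>

lemma upper_Gamma_le:
  assumes "s \<ge> 1" "t > s - 1" "t > 0"
  shows "upper_Gamma s t \<le> ennreal (t powr (s - 1) * exp (- t) / (1 - (s - 1) / t))"
proof -
  define k where "k = 1 - (s - 1) / t"
  have k: "k > 0" using assms by (simp add: k_def field_simps)
  have 1: "(\<integral>\<^sup>+y\<in>{t..}. ennreal (t powr (s - 1) * exp (- (s - 1)) * exp (- k * y)) \<partial>lborel)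
      = ennreal (0 - (- (t powr (s - 1) * exp (- (s - 1)) * exp (- k * t) / k)))"
  proof (rule nn_integral_FTC_atLeast[where F = "\<lambda>y. - (t powr (s - 1) * exp (- (s - 1)) * exp (- k * y) / k)" and T = 0])
    show "((\<lambda>y. - (t powr (s - 1) * exp (- (s - 1)) * exp (- k * y) / k)) has_real_derivative
        t powr (s - 1) * exp (- (s - 1)) * exp (- k * y)) (at y)" for y
      using k by (auto intro!: derivative_eq_intros simp: field_simps)
    have "((\<lambda>y. exp (- (k * y))) \<longlongrightarrow> 0) at_top"
      using k by real_asymp
    from tendsto_mult_left[OF this, of "- (t powr (s - 1) * exp (- (s - 1)) / k)"]
    show "((\<lambda>y. - (t powr (s - 1) * exp (- (s - 1)) * exp (- k * y) / k)) \<longlongrightarrow> 0) at_top"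
      by simp
  qed auto
  have "upper_Gamma s t \<le> (\<integral>\<^sup>+y\<in>{t..}. ennreal (t powr (s - 1) * exp (- (s - 1)) * exp (- k * y)) \<partial>lborel)"
    unfolding upper_Gamma_def
  proof (intro nn_integral_mono)
    fix y :: real
    show "ennreal (y powr (s - 1) * exp (- y)) * indicator {t..} y \<le>
       ennreal (t powr (s - 1) * exp (- (s - 1)) * exp (- k * y)) * indicator {t..} y"
    proof (cases "t \<le> y")
      case True
      then have y: "y > 0" using assms by simp
      have "ln (y / t) \<le> y / t - 1"
        using y assms by (intro ln_le_minus_one) auto
      then have "(s - 1) * ln y \<le> (s - 1) * ln t + (s - 1) * (y / t - 1)"
        using assms y mult_left_mono[of "ln (y/t)" "y / t - 1" "s - 1"] by (simp add: ln_div algebra_simps)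
      then have "exp ((s - 1) * ln y - y) \<le> exp ((s - 1) * ln t - (s - 1) - k * y)"
        by (simp add: k_def algebra_simps)
      then have "y powr (s - 1) * exp (- y) \<le> t powr (s - 1) * exp (- (s - 1)) * exp (- k * y)"
        using y assms by (simp add: powr_def exp_diff exp_minus field_simps exp_add)
      then show ?thesis using True by (simp add: ennreal_leI)
    qed simp
  qed
  also have "\<dots> = ennreal (t powr (s - 1) * exp (- t) / k)"
  proof -
    have "exp (- (s - 1)) * exp (- k * t) = exp (- t)"
      using assms by (simp add: exp_add[symmetric] k_def field_simps)
    then show ?thesis unfolding 1 by (simp add: mult.assoc)
  qed
  finally show ?thesis by (simp add: k_def)
qed

lemma has_bochner_integral_Gamma:
  fixes s :: real
  assumes "s > -1"
  shows "has_bochner_integral lborel (\<lambda>y. indicator {0..} y * (y powr s * exp (- y))) (Gamma (s + 1))"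
proof (rule has_bochner_integral_nn_integral[rotated 3])
  have "(\<integral>\<^sup>+y. ennreal (indicator {0..} y * (y powr s * exp (- y))) \<partial>lborel) = upper_Gamma (s + 1) 0"
    unfolding upper_Gamma_def by (intro nn_integral_cong) (auto simp: indicator_def)
  also have "\<dots> = ennreal (Gamma (s + 1))" using assms by (intro upper_Gamma_zero) simp
  finally show "(\<integral>\<^sup>+y. ennreal (indicator {0..} y * (y powr s * exp (- y))) \<partial>lborel) = ennreal (Gamma (s + 1))" .
  show "0 \<le> Gamma (s + 1)" using assms by (intro less_imp_le Gamma_real_pos) simp
qed auto

section \<open>Stirling's formula for real arguments\<close>

lemma ln_one_plus_upper:
  fixes x :: real assumes "x \<ge> 0"
  shows "ln (1 + x) \<le> x - x\<^sup>2 / (2 * (1 + x))"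
proof -
  define h where "h x = x - x\<^sup>2 / (2 * (1 + x)) - ln (1 + x)" for x :: real
  have "h 0 \<le> h x"
  proof (rule DERIV_nonneg_imp_nondecreasing[OF assms])
    fix y :: real assume y: "0 \<le> y" "y \<le> x"
    have "(h has_real_derivative (1 - (2 * y * (2 * (1 + y)) - y\<^sup>2 * 2) / (2 * (1 + y))\<^sup>2 - 1 / (1 + y))) (at y)"
      unfolding h_def using y by (auto intro!: derivative_eq_intros simp: power2_eq_square)
    also have "1 - (2 * y * (2 * (1 + y)) - y\<^sup>2 * 2) / (2 * (1 + y))\<^sup>2 - 1 / (1 + y) = y\<^sup>2 / (2 * (1 + y)\<^sup>2)"
      using y by (simp add: divide_simps) (simp add: algebra_simps power2_eq_square)
    finally show "\<exists>z. (h has_real_derivative z) (at y) \<and> z \<ge> 0" by force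
  qed
  then show ?thesis by (simp add: h_def)
qed

lemma ln_one_minus_upper:
  fixes x :: real assumes "-1 < x" "x \<le> 0"
  shows "ln (1 + x) \<le> x - x\<^sup>2 / 2"
proof -
  define h where "h x = x - x\<^sup>2 / 2 - ln (1 + x)" for x :: real
  have "h 0 \<le> h x"
  proof (rule DERIV_nonpos_imp_nonincreasing[OF assms(2)])
    fix y :: real assume y: "x \<le> y" "y \<le> 0"
    have "(h has_real_derivative (- (y\<^sup>2) / (1 + y))) (at y)"
      unfolding h_def using y assms
      by (auto intro!: derivative_eq_intros simp: field_simps power2_eq_square)
    moreover have "- (y\<^sup>2) / (1 + y) \<le> 0" using y assms by (simp add: field_simps)
    ultimately show "\<exists>z. (h has_real_derivative z) (at y) \<and> z \<le> 0" by blast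
  qed
  then show ?thesis by (simp add: h_def)
qed

text \<open>Laplace's method: under y = s + sqrt s * v the integrand of Gamma (s + 1) becomes the
  expected prefactor times \<open>K s v\<close>, which tends to exp (- v^2 / 2); dominated
  convergence with majorant \<open>w\<close> gives the limit along real \<open>s\<close>.\<close>

lemma Gamma_Stirling:
  "((\<lambda>s::real. Gamma (s + 1) / (s powr s * exp (- s) * sqrt s)) \<longlongrightarrow> sqrt (2 * pi)) at_top"
proof -
  define K where "K s v = indicator {- sqrt s <..} v * exp (s * ln (1 + v / sqrt s) - sqrt s * v)" for s v :: real
  \<comment> \<open>The Gaussian covers v \<le> 0. For v > 0 and s \<ge> 1, where x = v / sqrt s
    \<le> v, the exponent is at most - v^2 / (2 (1 + v)) \<le> - (v - 1) / 2.\<close>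
  define w where "w v = exp (- v\<^sup>2 / 2) + indicator {0..} v * exp (- (v - 1) / 2)" for v :: real
  have gauss: "has_bochner_integral lborel (\<lambda>v::real. exp (- v\<^sup>2 / 2)) (sqrt (2 * pi))"
  proof -
    have "has_bochner_integral lborel (\<lambda>v. sqrt (2 * pi) * (std_normal_density v * v ^ (2 * 0))) (sqrt (2 * pi) * 1)"
      using std_normal_moment_even[of 0] by (intro has_bochner_integral_mult_right) simp
    then show ?thesis by (simp add: std_normal_density_def)
  qed
  have K: "Gamma (s + 1) = s powr s * exp (- s) * sqrt s * (\<integral>v. K s v \<partial>lborel)" if s: "s > 0" for s
  proof -
    have "Gamma (s + 1) = (\<integral>y. indicator {0..} y * (y powr s * exp (- y)) \<partial>lborel)"
      by (rule has_bochner_integral_integral_eq[OF has_bochner_integral_Gamma, symmetric]) (use s in simp)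
    also have "\<dots> = sqrt s * (\<integral>v. indicator {0..} (s + sqrt s * v) * ((s + sqrt s * v) powr s * exp (- (s + sqrt s * v))) \<partial>lborel)"
      using s lborel_integral_real_affine[of "sqrt s" "\<lambda>y. indicator {0..} y * (y powr s * exp (- y))" s] by simp
    also have "(\<integral>v. indicator {0..} (s + sqrt s * v) * ((s + sqrt s * v) powr s * exp (- (s + sqrt s * v))) \<partial>lborel)
      = (\<integral>v. (s powr s * exp (- s)) * K s v \<partial>lborel)"
    proof (intro Bochner_Integration.integral_cong refl)
      fix v :: real
      have ss: "sqrt s * sqrt s = s" using s by (simp add: less_imp_le)
      have eq: "s + sqrt s * v = sqrt s * (sqrt s + v)" using s by (simp add: distrib_left)
      have eq2: "s + sqrt s * v = s * (1 + v / sqrt s)"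
        using s ss by (simp add: field_simps)
      show "indicator {0..} (s + sqrt s * v) * ((s + sqrt s * v) powr s * exp (- (s + sqrt s * v))) = (s powr s * exp (- s)) * K s v"
      proof (cases "sqrt s + v > 0")
        case True
        then have pos: "1 + v / sqrt s > 0" using s by (simp add: field_simps)
        have "(s + sqrt s * v) powr s = s powr s * exp (s * ln (1 + v / sqrt s))"
          unfolding eq2 using pos s by (simp add: powr_mult) (simp add: powr_def)
        moreover have "s + sqrt s * v \<ge> 0" using True s by (simp add: eq)
        ultimately show ?thesis using True
          by (simp add: K_def exp_diff exp_minus exp_add field_simps)
      next
        case False
        then have "v \<le> - sqrt s" by simp
        \<comment> \<open>At the endpoint v = - sqrt s the value \<open>0 powr s = 0\<close> agrees
          with the cut-off in \<open>K\<close>.\<close>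
        moreover have "indicator {0..} (s + sqrt s * v) * ((s + sqrt s * v) powr s) = 0"
          using False s by (cases "sqrt s + v = 0") (auto simp: eq indicator_def mult_less_0_iff zero_le_mult_iff)
        ultimately show ?thesis by (simp add: K_def)
      qed
    qed
    also have "\<dots> = s powr s * exp (- s) * (\<integral>v. K s v \<partial>lborel)" by simp
    finally show ?thesis by (simp add: mult_ac)
  qed
  have "((\<lambda>s. \<integral>v. K s v \<partial>lborel) \<longlongrightarrow> (\<integral>v. exp (- v\<^sup>2 / 2) \<partial>lborel)) at_top"
  proof (rule integral_dominated_convergence_at_top[where w = w])
    show "K s \<in> borel_measurable lborel" for s
      unfolding K_def by measurable
    show "(\<lambda>v::real. exp (- v\<^sup>2 / 2)) \<in> borel_measurable lborel" by measurable
    have "integrable lborel (\<lambda>v::real. indicator {0..} v * exp (- (v - 1) / 2))"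
    proof (rule integrableI_nn_integral_finite)
      have "(\<integral>\<^sup>+v. ennreal (indicator {0..} v * exp (- (v - 1) / 2)) \<partial>lborel) =
        (\<integral>\<^sup>+v\<in>{0..}. ennreal (exp (- (v - 1) / 2)) \<partial>lborel)"
        by (intro nn_integral_cong) (auto simp: indicator_def)
      also have "\<dots> = ennreal (0 - (- 2 * exp (- (0 - 1) / 2)))"
      proof (rule nn_integral_FTC_atLeast[where F = "\<lambda>v. - 2 * exp (- (v - 1) / 2)" and T = 0])
        show "((\<lambda>v. - 2 * exp (- (v - 1) / 2)) has_real_derivative exp (- (v - 1) / 2)) (at v)" for v :: real
          by (auto intro!: derivative_eq_intros)
        show "((\<lambda>v::real. - 2 * exp (- (v - 1) / 2)) \<longlongrightarrow> 0) at_top" by real_asymp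
      qed auto
      finally show "(\<integral>\<^sup>+v. ennreal (indicator {0..} v * exp (- (v - 1) / 2)) \<partial>lborel) = ennreal (2 * exp (1 / 2))"
        by simp
    qed auto
    then show "integrable lborel w"
      unfolding w_def using gauss by (intro Bochner_Integration.integrable_add) (auto simp: has_bochner_integral_iff)
    show "\<forall>\<^sub>F s in at_top. AE v in lborel. norm (K s v) \<le> w v"
      using eventually_ge_at_top[of "1::real"]
    proof eventually_elim
      case (elim s)
      have "norm (K s v) \<le> w v" for v
      proof (cases "- sqrt s < v")
        case True
        define x where "x = v / sqrt s"
        have sq: "sqrt s \<ge> 1" "sqrt s * sqrt s = s" using elim by auto
        have v: "v = sqrt s * x" using sq by (simp add: x_def)
        have sv: "sqrt s * v = s * x" using sq by (metis v mult.assoc)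
        have vv: "v\<^sup>2 = s * x\<^sup>2" using sq by (simp add: v power_mult_distrib)
        have x: "x > -1" using True sq by (simp add: x_def field_simps)
        have Kv: "norm (K s v) = exp (s * (ln (1 + x) - x))"
          using True sv by (simp add: K_def x_def[symmetric] right_diff_distrib)
        show ?thesis
        proof (cases "v \<le> 0")
          case True
          then have "x \<le> 0" using sq by (simp add: x_def field_simps)
          then have "s * (ln (1 + x) - x) \<le> s * (- x\<^sup>2 / 2)"
            using ln_one_minus_upper[OF x] elim by (intro mult_left_mono) auto
          also have "\<dots> = - v\<^sup>2 / 2" by (simp add: vv)
          finally show ?thesis unfolding Kv w_def by (auto simp: indicator_def intro: add_increasing2)
        next
          case False
          then have x0: "x \<ge> 0" "x \<le> v" using sq by (auto simp: x_def field_simps mult_le_cancel_left1)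
          have "s * (ln (1 + x) - x) \<le> s * (- x\<^sup>2 / (2 * (1 + x)))"
            using ln_one_plus_upper[OF x0(1)] elim by (intro mult_left_mono) auto
          also have "\<dots> = - (v\<^sup>2 / (2 * (1 + x)))" by (simp add: vv)
          also have "\<dots> \<le> - (v\<^sup>2 / (2 * (1 + v)))"
            using x0 by (auto intro!: divide_left_mono)
          also have "\<dots> \<le> - (v - 1) / 2"
            using False by (simp add: field_simps power2_eq_square)
          finally show ?thesis unfolding Kv w_def using False by (auto simp: indicator_def intro: add_increasing)
        qed
      qed (auto simp: K_def w_def)
      then show ?case by simp
    qed
    show "AE v in lborel. ((\<lambda>s. K s v) \<longlongrightarrow> exp (- v\<^sup>2 / 2)) at_top"
    proof (rule AE_I2)
      fix v :: real
      have 1: "((\<lambda>s. exp (s * ln (1 + v / sqrt s) - sqrt s * v)) \<longlongrightarrow> exp (- v\<^sup>2 / 2)) at_top"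
      proof (rule tendsto_exp)
        have "((\<lambda>s::real. s * ln (1 + v / sqrt s) - sqrt s * v + v * v / 2) \<longlongrightarrow> 0) at_top"
        proof -
          consider "v = 0" | "v > 0" | "v < 0" by linarith
          then show ?thesis by cases (simp, real_asymp, real_asymp)
        qed
        from tendsto_diff[OF this tendsto_const[of "v * v / 2"]]
        show "((\<lambda>s. s * ln (1 + v / sqrt s) - sqrt s * v) \<longlongrightarrow> - v\<^sup>2 / 2) at_top"
          by (simp add: power2_eq_square)
      qed
      have "\<forall>\<^sub>F s in at_top. - sqrt s < v" by real_asymp
      then have "\<forall>\<^sub>F s in at_top. exp (s * ln (1 + v / sqrt s) - sqrt s * v) = K s v"
        by eventually_elim (simp add: K_def)
      from Lim_transform_eventually[OF 1 this]
      show "((\<lambda>s. K s v) \<longlongrightarrow> exp (- v\<^sup>2 / 2)) at_top" .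
    qed
  qed
  also have "(\<integral>v. exp (- v\<^sup>2 / 2) \<partial>lborel) = sqrt (2 * pi)"
    using gauss by (rule has_bochner_integral_integral_eq)
  finally show ?thesis
  proof (rule Lim_transform_eventually)
    show "\<forall>\<^sub>F s in at_top. (\<integral>v. K s v \<partial>lborel) = Gamma (s + 1) / (s powr s * exp (- s) * sqrt s)"
      using eventually_gt_at_top[of 0] by eventually_elim (simp add: K)
  qed
qed

section \<open>Density and tail of the Gamma distribution\<close>

definition Gamma_pdf :: "real \<Rightarrow> real \<Rightarrow> real" where
  "Gamma_pdf s t = t powr (s - 1) * exp (- t) / Gamma s"

definition Gamma_tail :: "real \<Rightarrow> real \<Rightarrow> real" where
  "Gamma_tail s t = enn2real (upper_Gamma s t) / Gamma s"

lemma Gamma_pdf_nonneg: "s > 0 \<Longrightarrow> 0 \<le> Gamma_pdf s t"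
  unfolding Gamma_pdf_def using Gamma_real_pos[of s] by simp

lemma Gamma_tail_nonneg: "s > 0 \<Longrightarrow> 0 \<le> Gamma_tail s t"
  unfolding Gamma_tail_def using Gamma_real_pos[of s] by simp

lemma upper_Gamma_finite: "s > 0 \<Longrightarrow> t \<ge> 0 \<Longrightarrow> upper_Gamma s t < \<infinity>"
proof -
  assume "s > 0" "t \<ge> 0"
  then have "upper_Gamma s t \<le> upper_Gamma s 0"
    unfolding upper_Gamma_def by (intro nn_integral_mono) (auto simp: indicator_def)
  then show ?thesis using upper_Gamma_zero[of s] \<open>s > 0\<close> by (auto intro: le_less_trans)
qed

lemma Gamma_pdf_plus1: "s > 0 \<Longrightarrow> t > 0 \<Longrightarrow> Gamma_pdf s t = Gamma_pdf (s + 1) t * (s / t)"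
proof -
  assume "s > 0" "t > 0"
  moreover from this have "s \<notin> \<int>\<^sub>\<le>\<^sub>0" by (auto elim!: nonpos_Ints_cases)
  then have "Gamma (s + 1) = s * Gamma s" by (rule Gamma_plus1)
  ultimately show ?thesis by (simp add: Gamma_pdf_def powr_diff)
qed

lemma Gamma_tail_plus1:
  assumes "s > 0" "t \<ge> s"
  shows "Gamma_tail (s + 1) t = Gamma_tail s t + Gamma_pdf (s + 1) t"
proof -
  have "s \<notin> \<int>\<^sub>\<le>\<^sub>0" using assms by (auto elim!: nonpos_Ints_cases)
  then have G: "Gamma (s + 1) = s * Gamma s" "Gamma s > 0" "Gamma (s + 1) > 0"
    using Gamma_plus1[of s] Gamma_real_pos[of s] Gamma_real_pos[of "s + 1"] assms by auto
  have "enn2real (upper_Gamma (s + 1) t) = s * enn2real (upper_Gamma s t) + t powr s * exp (- t)"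
    unfolding upper_Gamma_Suc[OF assms]
    using upper_Gamma_finite[of s t] assms
    by (subst enn2real_plus) (auto simp: ennreal_mult_less_top enn2real_mult)
  then show ?thesis using G(2,3) assms
    by (simp add: Gamma_tail_def Gamma_pdf_def add_divide_distrib) (simp add: G(1))
qed

lemma Gamma_tail_le:
  assumes "s \<ge> 1" "t > s - 1" "t > 0"
  shows "Gamma_tail s t \<le> Gamma_pdf s t / (1 - (s - 1) / t)"
proof -
  have "1 - (s - 1) / t > 0" using assms by (simp add: field_simps)
  then have "enn2real (upper_Gamma s t) \<le> t powr (s - 1) * exp (- t) / (1 - (s - 1) / t)"
    using upper_Gamma_le[OF assms] by (intro enn2real_leI) auto
  then have "Gamma_tail s t \<le> t powr (s - 1) * exp (- t) / (1 - (s - 1) / t) / Gamma s"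
    unfolding Gamma_tail_def using Gamma_real_pos[of s] assms by (intro divide_right_mono) auto
  then show ?thesis by (simp add: Gamma_pdf_def mult.commute)
qed

text \<open>Telescoping \<open>Gamma_tail_plus1\<close> and discarding the last remaining
  tail.\<close>

lemma Gamma_tail_ge_sum:
  assumes "t \<ge> s" "s > real m"
  shows "(\<Sum>i<m. Gamma_pdf (s - real i) t) \<le> Gamma_tail s t"
proof -
  have "k \<le> m \<Longrightarrow> Gamma_tail s t = (\<Sum>i<k. Gamma_pdf (s - real i) t) + Gamma_tail (s - real k) t" for k
  proof (induction k)
    case (Suc k)
    then have "Gamma_tail (s - real k) t = Gamma_tail (s - real (Suc k)) t + Gamma_pdf (s - real k) t"
      using Gamma_tail_plus1[of "s - real (Suc k)" t] assms by (simp add: algebra_simps)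
    then show ?case using Suc by simp
  qed simp
  from this[of m] show ?thesis using Gamma_tail_nonneg[of "s - real m" t] assms by simp
qed

text \<open>Lowering the shape by one multiplies the density by (shape - 1) / t, and all these
  ratios are at most \<open>s / t\<close>. The companion \<open>Gamma_pdf_ge_power\<close> bounds
  them below by \<open>(s - r) / t\<close> over at most \<open>r\<close> steps.\<close>

lemma Gamma_pdf_le_power:
  assumes "s > real j" "t > 0"
  shows "Gamma_pdf (s - real j) t \<le> Gamma_pdf s t * (s / t) ^ j"
  using assms(1)
proof (induction j)
  case (Suc j)
  have "Gamma_pdf (s - real (Suc j)) t = Gamma_pdf (s - real j) t * ((s - real (Suc j)) / t)"
    using Gamma_pdf_plus1[of "s - real (Suc j)" t] Suc.prems assms by (simp add: algebra_simps)
  also have "\<dots> \<le> (Gamma_pdf s t * (s / t) ^ j) * (s / t)"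
    using Suc Gamma_pdf_nonneg[of s t] assms(2) by (intro mult_mono divide_right_mono) auto
  finally show ?case by (simp add: mult_ac)
qed simp

lemma Gamma_pdf_ge_power:
  assumes "s > r" "t > 0" "real j \<le> r" "r \<ge> 0"
  shows "Gamma_pdf (s - real j) t \<ge> Gamma_pdf s t * ((s - r) / t) ^ j"
  using assms(3)
proof (induction j)
  case (Suc j)
  have "(Gamma_pdf s t * ((s - r) / t) ^ j) * ((s - r) / t) \<le> Gamma_pdf (s - real j) t * ((s - real (Suc j)) / t)"
    using Suc Gamma_pdf_nonneg[of "s - real j" t] assms by (intro mult_mono divide_right_mono) auto
  also have "\<dots> = Gamma_pdf (s - real (Suc j)) t"
    using Gamma_pdf_plus1[of "s - real (Suc j)" t] Suc.prems assms by (simp add: algebra_simps)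
  finally show ?case by (simp add: mult_ac)
qed simp

text \<open>Each tail is at most its density over \<open>1 - S / t\<close>, and the densities decay
  at least geometrically with ratio \<open>S / t\<close>; summing that series gives the second
  factor.\<close>

lemma sum_Gamma_tail_le:
  assumes "S \<ge> real n" "t > S" "S > 0"
  shows "(\<Sum>j<n. Gamma_tail (S - real j) t) \<le> Gamma_pdf S t / (1 - S / t)\<^sup>2"
proof -
  define q where "q = S / t"
  have q: "0 < q" "q < 1" using assms by (auto simp: q_def field_simps)
  have "(\<Sum>j<n. Gamma_tail (S - real j) t) \<le> (\<Sum>j<n. Gamma_pdf S t / (1 - q) * q ^ j)"
  proof (rule sum_mono)
    fix j assume "j \<in> {..<n}"
    then have s: "S - real j \<ge> 1" "S > real j" using assms by auto
    have "Gamma_tail (S - real j) t \<le> Gamma_pdf (S - real j) t / (1 - (S - real j - 1) / t)"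
      using assms s by (intro Gamma_tail_le) auto
    also have "\<dots> \<le> Gamma_pdf (S - real j) t / (1 - q)"
      using Gamma_pdf_nonneg[of "S - real j" t] s q assms
      by (intro divide_left_mono mult_pos_pos) (auto simp: q_def divide_right_mono field_simps)
    also have "\<dots> \<le> Gamma_pdf S t * q ^ j / (1 - q)"
      using Gamma_pdf_le_power[OF s(2), of t] assms q by (intro divide_right_mono) (auto simp: q_def)
    finally show "Gamma_tail (S - real j) t \<le> Gamma_pdf S t / (1 - q) * q ^ j" by simp
  qed
  also have "\<dots> = Gamma_pdf S t / (1 - q) * ((1 - q ^ n) / (1 - q))"
    unfolding sum_distrib_left[symmetric] using q by (simp add: sum_gp_strict)
  also have "\<dots> \<le> Gamma_pdf S t / (1 - q) * (1 / (1 - q))"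
    using q Gamma_pdf_nonneg[of S t] assms by (intro mult_left_mono divide_right_mono) auto
  finally show ?thesis by (simp add: q_def power2_eq_square)
qed

text \<open>Only the \<open>J\<close> largest shapes and \<open>J\<close> density terms of each tail
  are kept. At most \<open>2 * J\<close> steps are then taken below \<open>S\<close>, so every ratio
  is at least \<open>q\<close> and the sum dominates a product of two truncated geometric
  series.\<close>

lemma sum_Gamma_tail_ge:
  assumes "J \<le> n" "t > S" "S > 2 * real J" and that: "S \<ge> real n"
  defines "q \<equiv> (S - 2 * real J) / t"
  shows "(\<Sum>j<n. Gamma_tail (S - real j) t) \<ge> Gamma_pdf S t * ((1 - q ^ J) / (1 - q))\<^sup>2"
proof -
  have q: "0 < q" "q < 1" using assms by (auto simp: q_def field_simps)
  have "Gamma_pdf S t * ((1 - q ^ J) / (1 - q))\<^sup>2 = (\<Sum>j<J. \<Sum>i<J. Gamma_pdf S t * q ^ (j + i))"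
  proof -
    have "(\<Sum>j<J. \<Sum>i<J. Gamma_pdf S t * q ^ (j + i)) = Gamma_pdf S t * ((\<Sum>j<J. q ^ j) * (\<Sum>i<J. q ^ i))"
      by (simp only: sum_product power_add sum_distrib_left[of "Gamma_pdf S t"])
    then show ?thesis using q by (simp add: sum_gp_strict power2_eq_square)
  qed
  also have "\<dots> \<le> (\<Sum>j<J. Gamma_tail (S - real j) t)"
  proof (rule sum_mono)
    fix j assume j: "j \<in> {..<J}"
    have "(\<Sum>i<J. Gamma_pdf S t * q ^ (j + i)) \<le> (\<Sum>i<J. Gamma_pdf (S - real j - real i) t)"
    proof (rule sum_mono)
      fix i assume "i \<in> {..<J}"
      then show "Gamma_pdf S t * q ^ (j + i) \<le> Gamma_pdf (S - real j - real i) t"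
        using Gamma_pdf_ge_power[of "2 * real J" S t "j + i"] j assms by (simp add: q_def diff_diff_eq)
    qed
    also have "\<dots> \<le> Gamma_tail (S - real j) t"
      using j assms by (intro Gamma_tail_ge_sum) auto
    finally show "(\<Sum>i<J. Gamma_pdf S t * q ^ (j + i)) \<le> Gamma_tail (S - real j) t" .
  qed
  also have "\<dots> \<le> (\<Sum>j<n. Gamma_tail (S - real j) t)"
    using assms that by (intro sum_mono2) (auto intro!: Gamma_tail_nonneg)
  finally show ?thesis .
qed

text \<open>Sandwich from exp (- q / (1 - \<epsilon>)) \<le> 1 - q \<le> exp (- q) for 0 \<le> q
  \<le> \<epsilon> < 1; as the uniform bound vanishes, both outer products have the same
  limit.\<close>

lemma prod_one_minus_tendsto:
  fixes Q :: "nat \<Rightarrow> nat \<Rightarrow> real"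
  assumes Q: "\<forall>\<^sub>F n in sequentially. \<forall>k<m n. 0 \<le> Q n k \<and> Q n k \<le> \<epsilon> n"
    and eps: "\<epsilon> \<longlonglongrightarrow> 0" and S: "(\<lambda>n. \<Sum>k<m n. Q n k) \<longlonglongrightarrow> c"
  shows "(\<lambda>n. \<Prod>k<m n. 1 - Q n k) \<longlonglongrightarrow> exp (- c)"
proof (rule tendsto_sandwich)
  have ev: "\<forall>\<^sub>F n in sequentially. \<epsilon> n < 1/2"
    using order_tendstoD(2)[OF eps, of "1/2"] by simp
  show "\<forall>\<^sub>F n in sequentially. (\<Prod>k<m n. 1 - Q n k) \<le> exp (- (\<Sum>k<m n. Q n k))"
    using Q ev
  proof eventually_elim
    case (elim n)
    have "(\<Prod>k<m n. 1 - Q n k) \<le> (\<Prod>k<m n. exp (- Q n k))"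
    proof (intro prod_mono conjI)
      fix k assume "k \<in> {..<m n}"
      then show "0 \<le> 1 - Q n k" "1 - Q n k \<le> exp (- Q n k)"
        using elim(1)[rule_format, of k] elim(2) exp_ge_add_one_self[of "- Q n k"] by auto
    qed
    then show ?case by (simp add: exp_sum sum_negf[symmetric])
  qed
  show "\<forall>\<^sub>F n in sequentially. exp (- ((\<Sum>k<m n. Q n k) / (1 - \<epsilon> n))) \<le> (\<Prod>k<m n. 1 - Q n k)"
    using Q ev
  proof eventually_elim
    case (elim n)
    have "(\<Prod>k<m n. exp (- (Q n k / (1 - \<epsilon> n)))) \<le> (\<Prod>k<m n. 1 - Q n k)"
    proof (intro prod_mono conjI)
      fix k assume "k \<in> {..<m n}"
      then have q: "0 \<le> Q n k" "Q n k \<le> \<epsilon> n" using elim(1) by auto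
      then have q1: "1 - Q n k > 0" using elim(2) by simp
      have "1 / (1 - Q n k) = 1 + Q n k / (1 - Q n k)" using q1 by (simp add: field_simps)
      also have "\<dots> \<le> exp (Q n k / (1 - Q n k))" by (rule exp_ge_add_one_self)
      also have "\<dots> \<le> exp (Q n k / (1 - \<epsilon> n))"
        using q q1 elim(2) by (auto intro!: divide_left_mono)
      finally show "exp (- (Q n k / (1 - \<epsilon> n))) \<le> 1 - Q n k"
        using q1 by (simp add: exp_minus field_simps)
    qed auto
    then show ?case by (simp add: exp_sum sum_negf[symmetric] sum_divide_distrib)
  qed
  show "(\<lambda>n. exp (- (\<Sum>k<m n. Q n k))) \<longlonglongrightarrow> exp (- c)"
    by (intro tendsto_intros S)
  have "(\<lambda>n. exp (- ((\<Sum>k<m n. Q n k) / (1 - \<epsilon> n)))) \<longlonglongrightarrow> exp (- (c / (1 - 0)))"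
    by (intro tendsto_intros S eps) auto
  then show "(\<lambda>n. exp (- ((\<Sum>k<m n. Q n k) / (1 - \<epsilon> n)))) \<longlonglongrightarrow> exp (- c)" by simp
qed

section \<open>The Gumbel limit\<close>

locale gumbel_scaling =
  fixes \<alpha> x :: real assumes \<alpha>: "\<alpha> > 0"
begin

text \<open>\<open>S N\<close> is both the largest Gamma shape, \<alpha> N + N, and the squared
  radius used for scaling; \<open>\<delta> N\<close> is the offset from 1 in the event, and
  \<open>t N\<close> the squared threshold for the unscaled spectral radius.\<close>

definition "S N = (1 + \<alpha>) * real N"
definition "\<gamma> N = gumbel_gamma \<alpha> N"
definition "\<delta> N = sqrt (\<gamma> N / (2 * S N)) + x / (2 * sqrt (2 * S N * \<gamma> N))"
definition "t N = S N * (1 + \<delta> N)\<^sup>2"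

text \<open>Since \<gamma> grows like half of ln N, the factor ln N inside exp (- \<gamma>) can be
  traded for 2 \<gamma>; the bound on the cube controls the third-order error of ln (1 +
  \<delta>).\<close>

lemma gamma_at_top: "filterlim \<gamma> at_top sequentially"
  and ln_over_gamma: "(\<lambda>N. ln (real N) / \<gamma> N) \<longlonglongrightarrow> 2"
  and gamma_cubed: "(\<lambda>N. \<gamma> N ^ 3 / real N) \<longlonglongrightarrow> 0"
proof -
  define c where "c = (1 + \<alpha>) / (2 * pi)"
  have c: "c > 0" using \<alpha> by (simp add: c_def)
  have g: "\<gamma> = (\<lambda>N. ln (sqrt (c * real N)) - ln (ln (real N)))"
    by (auto simp: \<gamma>_def gumbel_gamma_def c_def fun_eq_iff)
  show "filterlim \<gamma> at_top sequentially" unfolding g using c by real_asymp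
  show "(\<lambda>N. ln (real N) / \<gamma> N) \<longlonglongrightarrow> 2" unfolding g using c by real_asymp
  show "(\<lambda>N. \<gamma> N ^ 3 / real N) \<longlonglongrightarrow> 0" unfolding g using c by real_asymp
qed

lemma S_at_top: "filterlim S at_top sequentially"
  unfolding S_def using \<alpha> by real_asymp

lemma gamma_S_pos: "\<forall>\<^sub>F N in sequentially. \<gamma> N > 0 \<and> S N > 0"
  using filterlim_at_top_dense[THEN iffD1, OF gamma_at_top, rule_format, of 0]
    filterlim_at_top_dense[THEN iffD1, OF S_at_top, rule_format, of 0]
  by eventually_elim simp

text \<open>The leading term can be factored out because sqrt (\<gamma> / (2 S)) = \<gamma> / sqrt
  (2 S \<gamma>), which rests on \<gamma> being eventually positive.\<close>

lemma delta_eq: "\<forall>\<^sub>F N in sequentially. \<gamma> N > 0 \<and> S N > 0 \<and> \<delta> N = sqrt (\<gamma> N / (2 * S N)) * (1 + x / (2 * \<gamma> N))"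
  using filterlim_at_top_dense[THEN iffD1, OF gamma_at_top, rule_format, of 0]
    filterlim_at_top_dense[THEN iffD1, OF S_at_top, rule_format, of 0]
proof eventually_elim
  case (elim N)
  have "x / (2 * sqrt (2 * S N * \<gamma> N)) = sqrt (\<gamma> N / (2 * S N)) * (x / (2 * \<gamma> N))"
  proof -
    have "sqrt (\<gamma> N / (2 * S N)) = \<gamma> N / sqrt (2 * S N * \<gamma> N)"
      using elim by (simp add: real_sqrt_divide real_sqrt_mult field_simps)
    then show ?thesis using elim by simp
  qed
  then show ?case using elim by (simp add: \<delta>_def distrib_left)
qed

lemma inv_gamma: "(\<lambda>N. c / \<gamma> N) \<longlonglongrightarrow> 0"
  by (intro tendsto_divide_0[OF tendsto_const] filterlim_at_top_imp_at_infinity gamma_at_top)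

lemma delta_factor_tendsto: "(\<lambda>N. 1 + x / (2 * \<gamma> N)) \<longlonglongrightarrow> 1"
  using tendsto_add[OF tendsto_const[of 1] inv_gamma[of "x / 2"]] by (simp add: field_simps)

text \<open>The point of the scaling: up to x^2 / (4 \<gamma>), which vanishes, the exponent 2 S
  \<delta>^2 is \<gamma> + x. Exponentiated, \<gamma> absorbs the algebraic prefactors and x gives
  exp (- x).\<close>

lemma S_delta_sq: "\<forall>\<^sub>F N in sequentially. 2 * S N * (\<delta> N)\<^sup>2 = \<gamma> N + x + x\<^sup>2 / (4 * \<gamma> N)"
  using delta_eq
proof eventually_elim
  case (elim N)
  have "2 * S N * (\<delta> N)\<^sup>2 = 2 * S N * ((sqrt (\<gamma> N / (2 * S N)))\<^sup>2 * (1 + x / (2 * \<gamma> N))\<^sup>2)"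
    using elim by (simp add: power_mult_distrib)
  also have "\<dots> = \<gamma> N * (1 + x / (2 * \<gamma> N))\<^sup>2"
    using elim by simp
  also have "\<dots> = \<gamma> N + x + x\<^sup>2 / (4 * \<gamma> N)"
    using elim by (simp add: field_simps power2_eq_square)
  finally show ?case .
qed

text \<open>S \<delta>^3 is of order sqrt (\<gamma>^3 / N), so the expansion of 2 S ln (1 +
  \<delta>) may stop after the quadratic term.\<close>

lemma S_delta_cubed: "(\<lambda>N. S N * \<delta> N ^ 3) \<longlonglongrightarrow> 0"
proof -
  have "(\<lambda>N. sqrt (\<gamma> N ^ 3 / real N * (1 / (8 * (1 + \<alpha>)))) * (1 + x / (2 * \<gamma> N)) ^ 3) \<longlonglongrightarrow>
    sqrt (0 * (1 / (8 * (1 + \<alpha>)))) * 1 ^ 3"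
    by (intro tendsto_intros gamma_cubed delta_factor_tendsto)
  then have 1: "(\<lambda>N. sqrt (\<gamma> N ^ 3 / real N * (1 / (8 * (1 + \<alpha>)))) * (1 + x / (2 * \<gamma> N)) ^ 3) \<longlonglongrightarrow> 0" by simp
  show ?thesis
  proof (rule Lim_transform_eventually[OF 1], use delta_eq in eventually_elim)
    case (elim N)
    have "S N * sqrt (\<gamma> N / (2 * S N)) ^ 3 = sqrt ((S N)\<^sup>2 * (\<gamma> N / (2 * S N)) ^ 3)"
      using elim by (simp add: real_sqrt_mult real_sqrt_power)
    also have "(S N)\<^sup>2 * (\<gamma> N / (2 * S N)) ^ 3 = \<gamma> N ^ 3 / (8 * S N)"
      using elim by (simp add: power_divide power_mult_distrib power2_eq_square power3_eq_cube)
    also have "\<dots> = \<gamma> N ^ 3 / real N * (1 / (8 * (1 + \<alpha>)))"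
      by (simp add: S_def)
    finally show ?case using elim by (simp add: power_mult_distrib)
  qed
qed

lemma delta_pos: "\<forall>\<^sub>F N in sequentially. \<delta> N > 0"
  using delta_eq order_tendstoD(1)[OF delta_factor_tendsto, of 0, simplified]
  by eventually_elim simp

text \<open>The effective length 1 / \<delta> of the geometric series is thus negligible against
  sqrt N, which lets \<open>sum_tail\<close> truncate at about sqrt N terms.\<close>

lemma delta_sqrt_N: "filterlim (\<lambda>N. \<delta> N * sqrt (real N)) at_top sequentially"
proof -
  have 1: "filterlim (\<lambda>N. sqrt (\<gamma> N * (1 / (2 * (1 + \<alpha>))))) at_top sequentially"
    using \<alpha> by (intro filterlim_compose[OF sqrt_at_top] filterlim_at_top_mult_tendsto_pos[OF tendsto_const _ gamma_at_top]) auto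
  have "filterlim (\<lambda>N. sqrt (\<gamma> N * (1 / (2 * (1 + \<alpha>)))) * (1 + x / (2 * \<gamma> N))) at_top sequentially"
    by (rule filterlim_at_top_mult_tendsto_pos[OF delta_factor_tendsto _ 1]) simp
  then show ?thesis
  proof (rule filterlim_mono_eventually[OF _ order.refl order.refl])
    show "\<forall>\<^sub>F N in sequentially. sqrt (\<gamma> N * (1 / (2 * (1 + \<alpha>)))) * (1 + x / (2 * \<gamma> N)) = \<delta> N * sqrt (real N)"
      using delta_eq
    proof eventually_elim
      case (elim N)
      have "sqrt (\<gamma> N / (2 * S N)) * sqrt (real N) = sqrt (\<gamma> N * (1 / (2 * (1 + \<alpha>))))"
      proof -
        have "real N > 0" using elim \<alpha> by (simp add: S_def zero_less_mult_iff)
        then show ?thesis unfolding real_sqrt_mult[symmetric] using \<alpha> by (simp add: S_def)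
      qed
      then show ?case using elim by simp
    qed
  qed
qed

text \<open>Follows from \<open>S_delta_cubed\<close> and S tending to infinity by taking a cube
  root.\<close>

lemma delta_0: "\<delta> \<longlonglongrightarrow> 0"
proof -
  have "(\<lambda>N. (\<delta> N) ^ 3) \<longlonglongrightarrow> 0"
  proof -
    have "(\<lambda>N. 1 / S N * (S N * \<delta> N ^ 3)) \<longlonglongrightarrow> 0 * 0"
      by (intro tendsto_mult S_delta_cubed tendsto_divide_0[OF tendsto_const] filterlim_at_top_imp_at_infinity S_at_top)
    then have 1: "(\<lambda>N. 1 / S N * (S N * \<delta> N ^ 3)) \<longlonglongrightarrow> 0" by simp
    show ?thesis by (rule Lim_transform_eventually[OF 1], use delta_eq in eventually_elim) simp
  qed
  then have "(\<lambda>N. root 3 ((\<delta> N) ^ 3)) \<longlonglongrightarrow> root 3 0" by (rule tendsto_real_root)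
  then show ?thesis by (simp add: odd_real_root_power_cancel)
qed

lemma delta_at_right: "filterlim \<delta> (at_right 0) sequentially"
  using delta_0 delta_pos by (auto simp: filterlim_at elim: eventually_mono)

lemma Stirling_S: "(\<lambda>N. Gamma (S N + 1) / (S N powr S N * exp (- S N) * sqrt (S N))) \<longlonglongrightarrow> sqrt (2 * pi)"
  by (rule filterlim_compose[OF Gamma_Stirling S_at_top])

text \<open>This is the value of the full double geometric series. Stirling turns the density into
  about exp (- 2 S \<delta>^2) / sqrt (2 pi S), and 1 - S / t is about 2 \<delta>; with 4 \<delta>^2
  about ln N / S the definition of \<gamma> leaves exactly exp (- x).\<close>

lemma Gamma_pdf_S_t_tendsto: "(\<lambda>N. Gamma_pdf (S N) (t N) / (1 - S N / t N)\<^sup>2) \<longlonglongrightarrow> exp (- x)"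
proof -
  define St where "St N = Gamma (S N + 1) / (S N powr S N * exp (- S N) * sqrt (S N))" for N
  \<comment> \<open>A product of factors with known limits, later identified with the quotient. The
    constant 2, the limit 2 of ln N / \<gamma> and the limit 1 / 4 of (1 + \<delta>)^2 / (2 +
    \<delta>)^2 cancel, as does sqrt (2 pi) against the limit of \<open>St\<close>.\<close>
  have 1: "(\<lambda>N. exp (- x) * exp (- ((x\<^sup>2 / 4) / \<gamma> N)) * sqrt (2 * pi) * 2 * (ln (real N) / \<gamma> N) / (1 + x / \<gamma> N + (x\<^sup>2 / 4) / \<gamma> N * (1 / \<gamma> N))
     * exp ((2 * ln (1 + \<delta> N) - 2 * \<delta> N + (\<delta> N)\<^sup>2) / \<delta> N ^ 3 * (S N * \<delta> N ^ 3)) * ((1 + \<delta> N)\<^sup>2 / (2 + \<delta> N)\<^sup>2) / St N)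
     \<longlonglongrightarrow> exp (- x) * exp (- 0) * sqrt (2 * pi) * 2 * 2 / (1 + 0 + 0 * 0) * exp (2/3 * 0) * ((1 + 0)\<^sup>2 / (2 + 0)\<^sup>2) / sqrt (2 * pi)"
  proof -
    define e1 where "e1 N = (x\<^sup>2 / 4) / \<gamma> N" for N
    define e2 where "e2 N = x / \<gamma> N" for N
    define e3 where "e3 N = 1 / \<gamma> N" for N
    define lg where "lg N = ln (real N) / \<gamma> N" for N
    define rr where "rr N = (2 * ln (1 + \<delta> N) - 2 * \<delta> N + (\<delta> N)\<^sup>2) / \<delta> N ^ 3" for N
    define sd where "sd N = S N * \<delta> N ^ 3" for N
    \<comment> \<open>2 / 3 is the cubic coefficient of 2 ln (1 + d), whose lower-order terms are
      subtracted off.\<close>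
    have "((\<lambda>d::real. (2 * ln (1 + d) - 2 * d + d\<^sup>2) / d ^ 3) \<longlongrightarrow> 2/3) (at_right 0)"
      by real_asymp
    from filterlim_compose[OF this delta_at_right] have rr: "rr \<longlonglongrightarrow> 2/3"
      by (simp only: rr_def[abs_def])
    have e: "e1 \<longlonglongrightarrow> 0" "e2 \<longlonglongrightarrow> 0" "e3 \<longlonglongrightarrow> 0" "lg \<longlonglongrightarrow> 2" "sd \<longlonglongrightarrow> 0"
      using inv_gamma ln_over_gamma S_delta_cubed by (simp_all only: e1_def[abs_def] e2_def[abs_def] e3_def[abs_def] lg_def[abs_def] sd_def[abs_def])
    have St: "St \<longlonglongrightarrow> sqrt (2 * pi)" using Stirling_S by (simp only: St_def[abs_def])
    show ?thesis
      unfolding e1_def[symmetric] e2_def[symmetric] e3_def[symmetric] lg_def[symmetric] rr_def[symmetric] sd_def[symmetric]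
      by (intro tendsto_intros e rr St delta_0) auto
  qed
  have "\<forall>\<^sub>F N in sequentially. ln (real N) > 0"
    by real_asymp
  then have "\<forall>\<^sub>F N in sequentially. exp (- x) * exp (- ((x\<^sup>2 / 4) / \<gamma> N)) * sqrt (2 * pi) * 2 * (ln (real N) / \<gamma> N) / (1 + x / \<gamma> N + (x\<^sup>2 / 4) / \<gamma> N * (1 / \<gamma> N))
     * exp ((2 * ln (1 + \<delta> N) - 2 * \<delta> N + (\<delta> N)\<^sup>2) / \<delta> N ^ 3 * (S N * \<delta> N ^ 3)) * ((1 + \<delta> N)\<^sup>2 / (2 + \<delta> N)\<^sup>2) / St N
     = Gamma_pdf (S N) (t N) / (1 - S N / t N)\<^sup>2"
    using delta_eq S_delta_sq delta_pos eventually_gt_at_top[of 0]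
  proof eventually_elim
    case (elim N)
    note ln0 = elim(1) and pos = elim(2) and sq = elim(3) and d = elim(4) and N = elim(5)
    define s where "s = S N"
    define dd where "dd = \<delta> N"
    define g where "g = \<gamma> N"
    have s: "s > 0" and g: "g > 0" and dd: "dd > 0" using pos d by (auto simp: s_def g_def dd_def)
    have sq': "2 * s * dd\<^sup>2 = g + x + x\<^sup>2 / (4 * g)" using sq by (simp add: s_def dd_def g_def)
    have t: "t N = s * (1 + dd)\<^sup>2" by (simp add: t_def s_def dd_def)
    have "s \<notin> \<int>\<^sub>\<le>\<^sub>0" using s by (auto elim!: nonpos_Ints_cases)
    then have Gs: "Gamma (s + 1) = s * Gamma s" by (intro Gamma_plus1)
    have Gpos: "Gamma s > 0" using s by (rule Gamma_real_pos)
    \<comment> \<open>Both terms of \<open>gumbel_gamma\<close> appear here as factors: sqrt (2 pi /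
      S) is matched by Stirling's formula, ln N by the squared gap 1 - S / t.\<close>
    have eg: "exp (- g) = ln (real N) * sqrt (2 * pi) / sqrt s"
    proof -
      have "g = ln (sqrt (s / (2 * pi))) - ln (ln (real N))"
        by (simp add: g_def \<gamma>_def gumbel_gamma_def s_def S_def)
      then have "exp (- g) = ln (real N) / sqrt (s / (2 * pi))"
        using s ln0 by (simp add: exp_diff)
      then show ?thesis using s by (simp add: real_sqrt_divide field_simps)
    qed
    have A: "exp (- (2 * s * dd\<^sup>2)) = exp (- x) * exp (- ((x\<^sup>2 / 4) / g)) * (ln (real N) * sqrt (2 * pi) / sqrt s)"
      unfolding sq' eg[symmetric] by (simp add: exp_add[symmetric])
    have B: "1 + x / g + (x\<^sup>2 / 4) / g * (1 / g) = 2 * s * dd\<^sup>2 / g"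
      unfolding sq' using g by (simp add: field_simps power2_eq_square)
    have lnp: "exp (s * (2 * ln (1 + dd))) = (1 + dd) powr (2 * s)"
      using dd by (simp add: powr_def)
    have tp: "t N powr (s - 1) = s powr s * (1 + dd) powr (2 * s) / (s * (1 + dd)\<^sup>2)"
    proof -
      have "t N powr (s - 1) = t N powr s / t N"
        using s dd by (simp add: t powr_diff)
      also have "t N powr s = s powr s * ((1 + dd)\<^sup>2) powr s"
        unfolding t using s by (simp add: powr_mult)
      also have "((1 + dd)\<^sup>2) powr s = (1 + dd) powr (2 * s)"
        using dd by (simp add: powr_powr flip: powr_numeral)
      finally show ?thesis by (simp add: t)
    qed
    have ex: "exp ((2 * ln (1 + dd) - 2 * dd + dd\<^sup>2) / dd ^ 3 * (s * dd ^ 3)) =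
        (1 + dd) powr (2 * s) * exp (- 2 * s * dd - s * dd\<^sup>2) * exp (2 * s * dd\<^sup>2)"
    proof -
      have "(2 * ln (1 + dd) - 2 * dd + dd\<^sup>2) / dd ^ 3 * (s * dd ^ 3) = s * (2 * ln (1 + dd)) + (- 2 * s * dd - s * dd\<^sup>2) + 2 * s * dd\<^sup>2"
        using dd by (simp add: field_simps)
      then show ?thesis by (simp only: exp_add lnp)
    qed
    have et: "exp (- t N) = exp (- s) * exp (- 2 * s * dd - s * dd\<^sup>2)"
      unfolding t by (simp add: exp_add[symmetric] power2_eq_square algebra_simps)
    have q: "1 - s / t N = dd * (2 + dd) / (1 + dd)\<^sup>2"
    proof -
      have "1 - s / t N = ((1 + dd)\<^sup>2 - 1) / (1 + dd)\<^sup>2"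
        using s dd by (simp add: t diff_divide_distrib)
      then show ?thesis by (simp add: power2_eq_square algebra_simps)
    qed
    define P where "P = (1 + dd) powr (2 * s)"
    define Ex where "Ex = exp (- 2 * s * dd - s * dd\<^sup>2)"
    define E2 where "E2 = exp (2 * s * dd\<^sup>2)"
    define ss where "ss = sqrt s"
    define sp where "sp = s powr s"
    define es where "es = exp (- s)"
    have pos': "P > 0" "Ex > 0" "E2 > 0" "ss > 0" "sp > 0" "es > 0" and ss: "s = ss * ss"
      using dd s by (auto simp: P_def Ex_def E2_def ss_def sp_def es_def)
    have A': "exp (- x) * exp (- ((x\<^sup>2 / 4) / g)) * sqrt (2 * pi) * 2 * (ln (real N) / g) = 2 * ss / (g * E2)"
    proof -
      have "exp (- x) * exp (- ((x\<^sup>2 / 4) / g)) * (ln (real N) * sqrt (2 * pi) / ss) = 1 / E2"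
        using A[symmetric] by (simp only: E2_def ss_def exp_minus inverse_eq_divide)
      then have "exp (- x) * exp (- ((x\<^sup>2 / 4) / g)) * (ln (real N) * sqrt (2 * pi)) = ss / E2"
        using pos' by (simp add: field_simps)
      then show ?thesis using g by (simp add: field_simps)
    qed
    have StN: "St N = s * Gamma s / (sp * es * ss)"
      by (simp add: St_def s_def[symmetric] Gs sp_def es_def ss_def)
    have "exp (- x) * exp (- ((x\<^sup>2 / 4) / g)) * sqrt (2 * pi) * 2 * (ln (real N) / g) / (1 + x / g + (x\<^sup>2 / 4) / g * (1 / g))
     * exp ((2 * ln (1 + dd) - 2 * dd + dd\<^sup>2) / dd ^ 3 * (s * dd ^ 3)) * ((1 + dd)\<^sup>2 / (2 + dd)\<^sup>2) / St N
     = (2 * ss / (g * E2)) / (2 * s * dd\<^sup>2 / g) * (P * Ex * E2) * ((1 + dd)\<^sup>2 / (2 + dd)\<^sup>2) / (s * Gamma s / (sp * es * ss))"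
      unfolding A' B ex StN P_def Ex_def E2_def ..
    also have "\<dots> = (sp * P / (s * (1 + dd)\<^sup>2)) * (es * Ex) / Gamma s / (dd * (2 + dd) / (1 + dd)\<^sup>2)\<^sup>2"
    proof -
      have "2 + dd \<noteq> 0" "1 + dd \<noteq> 0" using dd by auto
      then show ?thesis
        using pos' s g dd Gpos by (simp add: ss divide_simps power2_eq_square)
    qed
    also have "\<dots> = Gamma_pdf s (t N) / (1 - s / t N)\<^sup>2"
      unfolding Gamma_pdf_def tp et q P_def Ex_def sp_def es_def by simp
    finally show ?case by (simp only: s_def g_def dd_def)
  qed
  from Lim_transform_eventually[OF 1 this] show ?thesis by simp
qed

lemma S_less_t: "\<forall>\<^sub>F N in sequentially. S N < t N"
  using gamma_S_pos delta_pos
proof eventually_elim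
  case (elim N)
  then have "(1 + \<delta> N)\<^sup>2 > 1" by (simp add: one_less_power)
  then show ?case using elim by (simp add: t_def)
qed

lemma one_minus_S_over_t: "\<forall>\<^sub>F N in sequentially. 1 - S N / t N = \<delta> N * (2 + \<delta> N) / (1 + \<delta> N)\<^sup>2"
  using gamma_S_pos delta_pos
proof eventually_elim
  case (elim N)
  have "1 - S N / t N = ((1 + \<delta> N)\<^sup>2 - 1) / (1 + \<delta> N)\<^sup>2"
    using elim by (simp add: t_def diff_divide_distrib)
  then show ?case by (simp add: power2_eq_square algebra_simps)
qed

lemma one_minus_S_over_t_tendsto: "(\<lambda>N. 1 - S N / t N) \<longlonglongrightarrow> 0"
proof -
  have "(\<lambda>N. \<delta> N * (2 + \<delta> N) / (1 + \<delta> N)\<^sup>2) \<longlonglongrightarrow> 0 * (2 + 0) / (1 + 0)\<^sup>2"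
    by (intro tendsto_intros delta_0) auto
  then have "(\<lambda>N. \<delta> N * (2 + \<delta> N) / (1 + \<delta> N)\<^sup>2) \<longlonglongrightarrow> 0" by simp
  then show ?thesis by (rule Lim_transform_eventually) (use one_minus_S_over_t in \<open>auto elim: eventually_mono\<close>)
qed

lemma sum_tail: "(\<lambda>N. \<Sum>j<N. Gamma_tail (S N - real j) (t N)) \<longlonglongrightarrow> exp (- x)"
proof -
  \<comment> \<open>sqrt N lies between the scales 1 / \<delta> and N \<delta>: far above the first,
    so that \<open>q N ^ J N\<close> vanishes, and far below the second, so that replacing
    \<open>S N\<close> by \<open>S N - 2 * real (J N)\<close> does not change 1 - S / t to leading
    order.\<close>
  define J where "J N = nat \<lfloor>sqrt (real N)\<rfloor>" for N
  define q where "q N = (S N - 2 * real (J N)) / t N" for N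
  show ?thesis
  proof (rule tendsto_sandwich[where f = "\<lambda>N. Gamma_pdf (S N) (t N) / (1 - S N / t N)\<^sup>2 * (((1 - S N / t N) / (1 - q N)) * (1 - q N ^ J N))\<^sup>2"
      and h = "\<lambda>N. Gamma_pdf (S N) (t N) / (1 - S N / t N)\<^sup>2"])
  have SN: "S N \<ge> real N" for N using \<alpha> by (simp add: S_def distrib_right)
  show "\<forall>\<^sub>F N in sequentially. (\<Sum>j<N. Gamma_tail (S N - real j) (t N)) \<le> Gamma_pdf (S N) (t N) / (1 - S N / t N)\<^sup>2"
    using gamma_S_pos S_less_t by eventually_elim (auto intro!: sum_Gamma_tail_le SN)
  show "(\<lambda>N. Gamma_pdf (S N) (t N) / (1 - S N / t N)\<^sup>2) \<longlonglongrightarrow> exp (- x)"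
    by (rule Gamma_pdf_S_t_tendsto)
  have J: "real (J N) \<le> sqrt (real N)" "real (J N) \<ge> sqrt (real N) - 1" for N
    using of_int_floor_le[of "sqrt (real N)"] real_of_int_floor_gt_diff_one[of "sqrt (real N)"] by (auto simp: J_def)
  have JN: "\<forall>\<^sub>F N in sequentially. J N \<le> N \<and> 2 * real (J N) < S N"
  proof -
    have "\<forall>\<^sub>F N in sequentially. 2 * sqrt (real N) < real N" by real_asymp
    then show ?thesis using eventually_gt_at_top[of 0]
    proof eventually_elim
      case (elim N)
      then have "2 * real (J N) < real N" using J(1)[of N] by simp
      then show ?case using SN[of N] by linarith
    qed
  qed
  show "\<forall>\<^sub>F N in sequentially. Gamma_pdf (S N) (t N) / (1 - S N / t N)\<^sup>2 * (((1 - S N / t N) / (1 - q N)) * (1 - q N ^ J N))\<^sup>2 \<le>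
      (\<Sum>j<N. Gamma_tail (S N - real j) (t N))"
    using gamma_S_pos S_less_t JN delta_pos
  proof eventually_elim
    case (elim N)
    have "Gamma_pdf (S N) (t N) / (1 - S N / t N)\<^sup>2 * (((1 - S N / t N) / (1 - q N)) * (1 - q N ^ J N))\<^sup>2 =
       Gamma_pdf (S N) (t N) * ((1 - q N ^ J N) / (1 - q N))\<^sup>2"
      using elim by (simp add: power_mult_distrib power_divide)
    also have "\<dots> \<le> (\<Sum>j<N. Gamma_tail (S N - real j) (t N))"
      using elim SN unfolding q_def by (intro sum_Gamma_tail_ge) auto
    finally show ?case .
  qed
  \<comment> \<open>The ratio is 1 / (1 + 2 J / (t - S)), where t - S is at least 2 N \<delta> while
    J is at most sqrt N.\<close>
  have r1: "(\<lambda>N. (1 - S N / t N) / (1 - q N)) \<longlonglongrightarrow> 1"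
  proof -
    have inv: "(\<lambda>N. 1 / (\<delta> N * sqrt (real N))) \<longlonglongrightarrow> 0"
      by (intro tendsto_divide_0[OF tendsto_const] filterlim_at_top_imp_at_infinity delta_sqrt_N)
    have "(\<lambda>N. 2 * real (J N) / (t N - S N)) \<longlonglongrightarrow> 0"
    proof (rule tendsto_sandwich[of "\<lambda>_. 0"])
      show "\<forall>\<^sub>F N in sequentially. 0 \<le> 2 * real (J N) / (t N - S N)"
        using S_less_t by eventually_elim auto
      show "\<forall>\<^sub>F N in sequentially. 2 * real (J N) / (t N - S N) \<le> 1 / (\<delta> N * sqrt (real N))"
        using delta_pos gamma_S_pos eventually_gt_at_top[of 0]
      proof eventually_elim
        case (elim N)
        have "t N - S N = S N * (2 * \<delta> N) + S N * (\<delta> N)\<^sup>2" by (simp add: t_def power2_eq_square algebra_simps)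
        then have "t N - S N \<ge> S N * (2 * \<delta> N)" using elim by simp
        moreover have "S N * (2 * \<delta> N) \<ge> real N * (2 * \<delta> N)" using SN[of N] elim by (intro mult_right_mono) auto
        ultimately have "t N - S N \<ge> real N * (2 * \<delta> N)" by linarith
        then have "2 * real (J N) / (t N - S N) \<le> 2 * sqrt (real N) / (real N * (2 * \<delta> N))"
          using elim J(1)[of N] by (intro frac_le) auto
        also have "\<dots> = 1 / (\<delta> N * sqrt (real N))"
        proof -
          define r where "r = sqrt (real N)"
          have r: "r > 0" "real N = r * r" using elim by (auto simp: r_def)
          show ?thesis unfolding r_def[symmetric] r(2) using r(1) by simp
        qed
        finally show ?case .
      qed
    qed (use inv in auto)
    from tendsto_divide[OF tendsto_const[of 1] tendsto_add[OF tendsto_const[of 1] this]]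
    have "(\<lambda>N. 1 / (1 + 2 * real (J N) / (t N - S N))) \<longlonglongrightarrow> 1" by simp
    then show ?thesis
    proof (rule Lim_transform_eventually)
      show "\<forall>\<^sub>F N in sequentially. 1 / (1 + 2 * real (J N) / (t N - S N)) = (1 - S N / t N) / (1 - q N)"
        using S_less_t gamma_S_pos
      proof eventually_elim
        case (elim N)
        have p: "t N > 0" "t N - S N > 0" "t N - S N + 2 * real (J N) > 0" using elim by auto
        have "1 - q N = (t N - S N + 2 * real (J N)) / t N" using p by (simp add: q_def field_simps)
        moreover have "1 - S N / t N = (t N - S N) / t N" using p by (simp add: field_simps)
        moreover have "1 + 2 * real (J N) / (t N - S N) = (t N - S N + 2 * real (J N)) / (t N - S N)"
          using p by (simp add: field_simps)
        ultimately show ?case using p by simp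
      qed
    qed
  qed
  have r2: "(\<lambda>N. q N ^ J N) \<longlonglongrightarrow> 0"
  proof (rule tendsto_sandwich[of "\<lambda>_. 0"])
    show "\<forall>\<^sub>F N in sequentially. 0 \<le> q N ^ J N"
      using S_less_t gamma_S_pos JN by eventually_elim (auto simp: q_def)
    \<comment> \<open>From q \<le> 1 / (1 + \<delta>), Bernoulli's inequality and J \<ge> sqrt N -
      1.\<close>
    show "\<forall>\<^sub>F N in sequentially. q N ^ J N \<le> 1 / (1 + (\<delta> N * sqrt (real N) - \<delta> N))"
      using S_less_t gamma_S_pos JN delta_pos filterlim_at_top_dense[THEN iffD1, OF delta_sqrt_N, rule_format, of 1] order_tendstoD(2)[OF delta_0, of 1, simplified]
    proof eventually_elim
      case (elim N)
      have "q N \<le> S N / t N" using elim by (simp add: q_def divide_right_mono)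
      also have "\<dots> = 1 / (1 + \<delta> N)\<^sup>2" using elim by (simp add: t_def)
      also have "\<dots> \<le> 1 / (1 + \<delta> N)" using elim by (auto intro!: divide_left_mono simp: power2_eq_square)
      finally have "q N ^ J N \<le> (1 / (1 + \<delta> N)) ^ J N"
        using elim by (intro power_mono) (auto simp: q_def)
      also have "\<dots> = 1 / (1 + \<delta> N) ^ J N" by (simp add: power_one_over)
      also have "\<dots> \<le> 1 / (1 + real (J N) * \<delta> N)"
      proof (rule divide_left_mono)
        show "1 + real (J N) * \<delta> N \<le> (1 + \<delta> N) ^ J N"
          using Bernoulli_inequality[of "\<delta> N" "J N"] elim by simp
        show "0 < (1 + \<delta> N) ^ J N * (1 + real (J N) * \<delta> N)" using elim by (intro mult_pos_pos add_pos_nonneg zero_less_power) auto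
      qed simp
      also have "\<dots> \<le> 1 / (1 + (\<delta> N * sqrt (real N) - \<delta> N))"
      proof (rule divide_left_mono)
        have "\<delta> N * (sqrt (real N) - 1) \<le> \<delta> N * real (J N)" using J(2)[of N] elim by (intro mult_left_mono) auto
        then show "1 + (\<delta> N * sqrt (real N) - \<delta> N) \<le> 1 + real (J N) * \<delta> N" by (simp add: algebra_simps)
        have "0 \<le> \<delta> N * sqrt (real N) - \<delta> N" using elim by linarith
        then show "0 < (1 + real (J N) * \<delta> N) * (1 + (\<delta> N * sqrt (real N) - \<delta> N))"
          using elim by (intro mult_pos_pos add_pos_nonneg) simp_all
      qed simp
      finally show ?case .
    qed
    have "filterlim (\<lambda>N. (1 - \<delta> N) + \<delta> N * sqrt (real N)) at_top sequentially"
      by (rule filterlim_tendsto_add_at_top[OF tendsto_diff[OF tendsto_const delta_0] delta_sqrt_N])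
    then have "filterlim (\<lambda>N. 1 + (\<delta> N * sqrt (real N) - \<delta> N)) at_top sequentially"
      by (simp add: algebra_simps)
    then show "(\<lambda>N. 1 / (1 + (\<delta> N * sqrt (real N) - \<delta> N))) \<longlonglongrightarrow> 0"
      by (intro tendsto_divide_0[OF tendsto_const] filterlim_at_top_imp_at_infinity)
  qed auto
  have "(\<lambda>N. Gamma_pdf (S N) (t N) / (1 - S N / t N)\<^sup>2 * (((1 - S N / t N) / (1 - q N)) * (1 - q N ^ J N))\<^sup>2) \<longlonglongrightarrow>
     exp (- x) * (1 * (1 - 0))\<^sup>2"
    by (intro tendsto_intros Gamma_pdf_S_t_tendsto r1 r2)
  then show "(\<lambda>N. Gamma_pdf (S N) (t N) / (1 - S N / t N)\<^sup>2 * (((1 - S N / t N) / (1 - q N)) * (1 - q N ^ J N))\<^sup>2) \<longlonglongrightarrow> exp (- x)"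
    by simp
qed
qed

text \<open>Every single tail is bounded by the density at \<open>S N\<close> over 1 - S / t, that
  is, by the limit quotient of the sum times the vanishing factor 1 - S / t. This is the uniform
  smallness that \<open>prod_one_minus_tendsto\<close> asks for.\<close>

lemma Gamma_product_limit: "(\<lambda>N. \<Prod>j<N. 1 - Gamma_tail (S N - real j) (t N)) \<longlonglongrightarrow> exp (- exp (- x))"
proof (rule prod_one_minus_tendsto[OF _ _ sum_tail])
  have "(\<lambda>N. Gamma_pdf (S N) (t N) / (1 - S N / t N)\<^sup>2 * (1 - S N / t N)) \<longlonglongrightarrow> exp (- x) * 0"
    by (intro tendsto_mult Gamma_pdf_S_t_tendsto one_minus_S_over_t_tendsto)
  then show "(\<lambda>N. Gamma_pdf (S N) (t N) / (1 - S N / t N)\<^sup>2 * (1 - S N / t N)) \<longlonglongrightarrow> 0" by simp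
  have SN: "S N \<ge> real N" for N using \<alpha> by (simp add: S_def distrib_right)
  show "\<forall>\<^sub>F N in sequentially. \<forall>k<N. 0 \<le> Gamma_tail (S N - real k) (t N) \<and>
      Gamma_tail (S N - real k) (t N) \<le> Gamma_pdf (S N) (t N) / (1 - S N / t N)\<^sup>2 * (1 - S N / t N)"
    using gamma_S_pos S_less_t
  proof eventually_elim
    case (elim N)
    show ?case
    proof (intro allI impI conjI)
      fix k assume k: "k < N"
      then have s: "S N - real k \<ge> 1" "S N > real k" using SN[of N] by auto
      show "0 \<le> Gamma_tail (S N - real k) (t N)" using s by (intro Gamma_tail_nonneg) simp
      have q: "0 < 1 - S N / t N" "S N / t N \<le> 1" "0 < S N / t N" using elim by auto
      have "Gamma_tail (S N - real k) (t N) \<le> Gamma_pdf (S N - real k) (t N) / (1 - (S N - real k - 1) / t N)"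
        using elim s by (intro Gamma_tail_le) auto
      also have "\<dots> \<le> Gamma_pdf (S N - real k) (t N) / (1 - S N / t N)"
        using Gamma_pdf_nonneg[of "S N - real k" "t N"] s q elim
        by (intro divide_left_mono mult_pos_pos) (auto simp: divide_right_mono field_simps)
      also have "\<dots> \<le> Gamma_pdf (S N) (t N) / (1 - S N / t N)"
      proof (rule divide_right_mono)
        have "Gamma_pdf (S N - real k) (t N) \<le> Gamma_pdf (S N) (t N) * (S N / t N) ^ k"
          using Gamma_pdf_le_power[OF s(2), of "t N"] elim by auto
        also have "\<dots> \<le> Gamma_pdf (S N) (t N) * 1"
          using q elim by (intro mult_left_mono power_le_one Gamma_pdf_nonneg) auto
        finally show "Gamma_pdf (S N - real k) (t N) \<le> Gamma_pdf (S N) (t N)" by simp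
      qed (use q in simp)
      also have "\<dots> = Gamma_pdf (S N) (t N) / (1 - S N / t N)\<^sup>2 * (1 - S N / t N)"
        using q by (simp add: power2_eq_square)
      finally show "Gamma_tail (S N - real k) (t N) \<le> Gamma_pdf (S N) (t N) / (1 - S N / t N)\<^sup>2 * (1 - S N / t N)" .
    qed
  qed
qed

end

section \<open>Deflation of a matrix by an eigenvalue\<close>

type_synonym entry_fun = "nat \<times> nat \<Rightarrow> complex"

abbreviation sq_idx :: "nat \<Rightarrow> (nat \<times> nat) set" where "sq_idx n \<equiv> {..<n} \<times> {..<n}"
abbreviation col_idx :: "nat \<Rightarrow> (nat \<times> nat) set" where "col_idx n \<equiv> {..<n} \<times> {n}"
abbreviation row_idx :: "nat \<Rightarrow> (nat \<times> nat) set" where "row_idx n \<equiv> {n} \<times> {..<n}"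

text \<open>The last column \<open>c\<close> and the last row \<open>w\<close> are indexed by their
  positions in the larger matrix, so that Fubini on the product over index pairs splits off each
  block without reindexing.\<close>

definition bordered :: "nat \<Rightarrow> entry_fun \<Rightarrow> entry_fun \<Rightarrow> entry_fun
    \<Rightarrow> complex \<Rightarrow> nat \<times> nat \<Rightarrow> complex" where
  "bordered n D c w a = (\<lambda>p\<in>sq_idx (Suc n). if fst p < n then (if snd p < n then D p else c p)
     else if snd p < n then w p else a)"

abbreviation chi :: "nat \<Rightarrow> entry_fun \<Rightarrow> complex poly" where
  "chi n D \<equiv> char_poly (mat n n D)"

definition adj_poly :: "nat \<Rightarrow> entry_fun \<Rightarrow> nat \<Rightarrow> nat \<Rightarrow> complex poly" where
  "adj_poly n D i j = adj_mat (char_poly_matrix (mat n n D)) $$ (i, j)"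

text \<open>The scalar w adj (z - D) c: the division-free form of chi(z) times w (z - D)^-1
  c.\<close>

definition border_poly :: "nat \<Rightarrow> entry_fun \<Rightarrow> entry_fun \<Rightarrow> entry_fun \<Rightarrow> complex poly" where
  "border_poly n D c w = (\<Sum>i<n. \<Sum>j<n. [:w (n, i):] * adj_poly n D i j * [:c (j, n):])"

text \<open>Schur complement over an integral domain, to be applied to matrices of polynomials:
  right multiplication by a block matrix built from the adjugate clears the upper right block
  without division and multiplies the determinant by that of \<open>M\<close>, which is then
  cancelled.\<close>

lemma det_bordered:
  fixes M :: "'a :: idom mat"
  assumes M: "M \<in> carrier_mat n n" and b: "b \<in> carrier_mat n 1" and r: "r \<in> carrier_mat 1 n"
    and det: "Determinant.det M \<noteq> 0"
  shows "Determinant.det (four_block_mat M b r (mat 1 1 (\<lambda>_. e))) =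
    e * Determinant.det M - (r * adj_mat M * b) $$ (0, 0)"
proof -
  define A where "A = adj_mat M"
  have A: "A \<in> carrier_mat n n" "M * A = Determinant.det M \<cdot>\<^sub>m 1\<^sub>m n"
    using adj_mat[OF M] by (auto simp: A_def)
  define d where "d = Determinant.det M"
  define E where "E = mat 1 1 (\<lambda>_. e)"
  have E: "E \<in> carrier_mat 1 1" by (simp add: E_def)
  define X where "X = four_block_mat M b r E"
  define Y where "Y = four_block_mat (1\<^sub>m n) (- (A * b)) (0\<^sub>m 1 n) (d \<cdot>\<^sub>m 1\<^sub>m 1)"
  have Ab: "A * b \<in> carrier_mat n 1" using A(1) b by simp
  have X: "X \<in> carrier_mat (n + 1) (n + 1)" unfolding X_def using M E by (rule four_block_carrier_mat)
  have Y: "Y \<in> carrier_mat (n + 1) (n + 1)" unfolding Y_def by (rule four_block_carrier_mat) auto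
  have e1: "M * - (A * b) + b * (d \<cdot>\<^sub>m 1\<^sub>m 1) = 0\<^sub>m n 1"
  proof -
    have "M * - (A * b) = - (M * (A * b))"
      using M Ab by (intro eq_matI) (auto simp: scalar_prod_def sum_negf)
    also have "M * (A * b) = (M * A) * b" using M A(1) b by (simp add: assoc_mult_mat[of M n n A n b 1])
    also have "\<dots> = d \<cdot>\<^sub>m b" unfolding A(2) d_def[symmetric] using b by (simp add: mult_smult_assoc_mat[of _ n n b 1])
    finally have 1: "M * - (A * b) = - (d \<cdot>\<^sub>m b)" .
    have "b * (d \<cdot>\<^sub>m 1\<^sub>m 1) = d \<cdot>\<^sub>m b" using b by (simp add: mult_smult_distrib[of b n 1 _ 1])
    then show ?thesis unfolding 1 using b by (intro eq_matI) auto
  qed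
  have XY: "X * Y = four_block_mat M (0\<^sub>m n 1) r (r * - (A * b) + E * (d \<cdot>\<^sub>m 1\<^sub>m 1))"
    unfolding X_def Y_def
    by (subst mult_four_block_mat[OF M b r E]) (use M r b E Ab e1 in auto)
  have "Determinant.det X * d = Determinant.det (X * Y)"
  proof -
    have "Determinant.det Y = prod_list (diag_mat Y)"
      by (rule det_upper_triangular[OF _ Y]) (use Ab in \<open>auto simp: Y_def upper_triangular_def four_block_mat_def\<close>)
    also have "diag_mat Y = replicate n 1 @ [d]"
      using Y Ab by (auto simp: diag_mat_def Y_def four_block_mat_def nth_append intro!: nth_equalityI simp del: upt_Suc)
    finally show ?thesis using det_mult[OF X Y] by simp
  qed
  also have "\<dots> = d * Determinant.det (r * - (A * b) + E * (d \<cdot>\<^sub>m 1\<^sub>m 1))"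
    unfolding XY d_def by (rule det_four_block_mat_upper_right_zero[OF M refl r]) (use r Ab E in auto)
  also have "Determinant.det (r * - (A * b) + E * (d \<cdot>\<^sub>m 1\<^sub>m 1)) = e * d - (r * A * b) $$ (0, 0)"
  proof -
    have e2: "r * - (A * b) = - (r * A * b)"
      unfolding assoc_mult_mat[OF r A(1) b]
      using r Ab by (intro eq_matI) (auto simp: scalar_prod_def sum_negf)
    have e3: "E * (d \<cdot>\<^sub>m 1\<^sub>m 1) = d \<cdot>\<^sub>m E" using E by (simp add: mult_smult_distrib[of E 1 1 _ 1])
    have "- (r * A * b) + d \<cdot>\<^sub>m E \<in> carrier_mat 1 1" using r A(1) b E by auto
    then have "Determinant.det (- (r * A * b) + d \<cdot>\<^sub>m E) = (- (r * A * b) + d \<cdot>\<^sub>m E) $$ (0, 0)"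
      by (rule det_single)
    also have "\<dots> = e * d - (r * A * b) $$ (0, 0)" using r A(1) b E by (simp add: E_def mult.commute)
    finally show ?thesis unfolding e2 e3 .
  qed
  finally have "Determinant.det X = e * d - (r * A * b) $$ (0, 0)"
    using det by (simp add: d_def)
  then show ?thesis by (simp add: X_def E_def A_def d_def)
qed

lemma chi_monic: "degree (chi n D) = n" "coeff (chi n D) n = 1" "chi n D \<noteq> 0"
  using degree_monic_char_poly[of "mat n n D" n] by auto

text \<open>Affine in the corner entry \<open>a\<close>, which is what allows the eigenvalue
  equation to be solved for \<open>a\<close>.\<close>

lemma chi_bordered: "chi (Suc n) (bordered n D c w a) = [:- a, 1:] * chi n D - border_poly n D c w"
proof -
  define M where "M = char_poly_matrix (mat n n D)"
  have M: "M \<in> carrier_mat n n" by (simp add: M_def)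
  have det: "Determinant.det M = chi n D" by (simp add: M_def char_poly_def)
  define b where "b = mat n 1 (\<lambda>(i, j). [:- c (i, n):])"
  define r where "r = mat 1 n (\<lambda>(i, j). [:- w (n, j):])"
  have "char_poly_matrix (mat (Suc n) (Suc n) (bordered n D c w a)) = four_block_mat M b r (mat 1 1 (\<lambda>_. [:- a, 1:]))"
    by (intro eq_matI) (auto simp: char_poly_matrix_def M_def b_def r_def bordered_def four_block_mat_def less_Suc_eq)
  then have "chi (Suc n) (bordered n D c w a) = Determinant.det (four_block_mat M b r (mat 1 1 (\<lambda>_. [:- a, 1:])))"
    by (simp add: char_poly_def)
  also have "\<dots> = [:- a, 1:] * chi n D - (r * adj_mat M * b) $$ (0, 0)"
    unfolding det[symmetric]
    by (rule det_bordered[OF M]) (auto simp: b_def r_def det chi_monic)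
  also have "(r * adj_mat M * b) $$ (0, 0) = border_poly n D c w"
  proof -
    have A: "adj_mat M \<in> carrier_mat n n" using adj_mat[OF M] by simp
    have "r * adj_mat M * b = r * (adj_mat M * b)"
      using A by (intro assoc_mult_mat[of r 1 n _ n b 1]) (auto simp: r_def b_def)
    also have "\<dots> $$ (0, 0) = (\<Sum>i<n. [:- w (n, i):] * (\<Sum>j<n. adj_mat M $$ (i, j) * [:- c (j, n):]))"
      using A by (auto simp: r_def b_def scalar_prod_def lessThan_atLeast0 intro!: sum.cong)
    also have "\<dots> = border_poly n D c w"
      unfolding border_poly_def adj_poly_def M_def[symmetric] sum_distrib_left
      by (intro sum.cong refl) simp
    finally show ?thesis .
  qed
  finally show ?thesis .
qed

text \<open>By \<open>chi_bordered\<close> with corner entry 0 it is a difference of two monic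
  polynomials of degree n + 1.\<close>

lemma degree_border_poly: "degree (border_poly n D c w) \<le> n"
proof -
  have "border_poly n D c w = [:0, 1:] * chi n D - chi (Suc n) (bordered n D c w 0)"
    by (simp add: chi_bordered)
  moreover have "coeff ([:0, 1:] * chi n D - chi (Suc n) (bordered n D c w 0)) k = 0" if "k > n" for k
  proof (cases "k = Suc n")
    case True
    then show ?thesis using chi_monic[of n D] chi_monic[of "Suc n" "bordered n D c w 0"] by simp
  next
    case False
    then have k: "k > Suc n" using that by simp
    then obtain l where "k = Suc l" "l > n" by (cases k) auto
    then show ?thesis using k chi_monic(1)[of n D] chi_monic(1)[of "Suc n" "bordered n D c w 0"] by (simp add: coeff_eq_0)
  qed
  ultimately show ?thesis by (intro degree_le) auto
qed

text \<open>The derivative of a characteristic polynomial is the sum of those of the principal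
  submatrices, and these are the diagonal entries of the adjugate. At a simple eigenvalue the
  adjugate is therefore nonzero.\<close>

lemma sum_adj_poly: "(\<Sum>i<n. adj_poly n D i i) = pderiv (chi n D)"
proof -
  have "adj_poly n D i i = char_poly (mat_delete (mat n n D) i i)" if i: "i < n" for i
  proof -
    have "mat_delete (char_poly_matrix (mat n n D)) i i = char_poly_matrix (mat_delete (mat n n D) i i)"
      using i by (intro eq_matI) (auto simp: mat_delete_def char_poly_matrix_def)
    moreover have "(- 1 :: complex poly) ^ (i + i) = 1" by (simp add: mult_2[symmetric] power_mult)
    moreover have "dim_row (char_poly_matrix (mat n n D)) = n" "dim_col (char_poly_matrix (mat n n D)) = n"
      by (auto simp: char_poly_matrix_def)
    ultimately show ?thesis using i
      by (simp add: adj_poly_def adj_mat_def cofactor_def char_poly_def)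
  qed
  then show ?thesis using pderiv_char_poly[of "mat n n D" n] by simp
qed

lemma simple_root_adj_nonzero:
  assumes "poly (pderiv (chi n D)) d \<noteq> 0"
  shows "\<exists>i<n. poly (adj_poly n D i i) d \<noteq> 0"
proof (rule ccontr)
  assume "\<not> ?thesis"
  then have "poly (\<Sum>i<n. adj_poly n D i i) d = 0" by (simp add: poly_sum)
  with assms show False by (simp add: sum_adj_poly)
qed

lemma card_simple_roots:
  fixes p :: "complex poly"
  assumes p: "p \<noteq> 0" and simple: "\<And>z. poly p z = 0 \<Longrightarrow> poly (pderiv p) z \<noteq> 0"
  shows "card {z. poly p z = 0} = degree p"
proof -
  have "rsquarefree p" using simple by (auto simp: rsquarefree_roots)
  then show ?thesis using rsquarefree_card_degree[OF p] by simp
qed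

section \<open>Measurability and Fubini for bordered matrices\<close>

lemma borel_measurable_cleb_component:
  assumes "D \<in> measurable M (cleb I)" "p \<in> I"
  shows "(\<lambda>x. D x p) \<in> borel_measurable M"
  using measurable_compose[OF assms(1) measurable_component_singleton[OF assms(2)]] by simp

lemma measurable_bordered:
  assumes "D \<in> measurable M (cleb (sq_idx n))" "c \<in> measurable M (cleb (col_idx n))"
    "w \<in> measurable M (cleb (row_idx n))" "a \<in> borel_measurable M"
  shows "(\<lambda>x. bordered n (D x) (c x) (w x) (a x)) \<in> measurable M (cleb (sq_idx (Suc n)))"
  unfolding bordered_def
proof (rule measurable_restrict, unfold measurable_lborel1)
  fix p assume p: "p \<in> sq_idx (Suc n)"
  consider "p \<in> sq_idx n" | "p \<in> col_idx n" | "p \<in> row_idx n" | "p = (n, n)"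
    using p by (auto simp: less_Suc_eq)
  then show "(\<lambda>x. if fst p < n then if snd p < n then D x p else c x p
             else if snd p < n then w x p else a x) \<in> borel_measurable M"
    using borel_measurable_cleb_component[OF assms(1)] borel_measurable_cleb_component[OF assms(2)]
      borel_measurable_cleb_component[OF assms(3)] assms(4)
    by cases auto
qed

lemma poly_chi: "poly (chi n D) z = Determinant.det (mat n n (\<lambda>(i, j). (if i = j then z else 0) - D (i, j)))"
  unfolding char_poly_def
  by (rule poly_det_cong[of _ n]) (auto simp: char_poly_matrix_def)

lemma borel_measurable_det:
  assumes "\<And>i j. i < n \<Longrightarrow> j < n \<Longrightarrow> (\<lambda>x. A x i j) \<in> borel_measurable M"
  shows "(\<lambda>x. Determinant.det (mat n n (\<lambda>(i, j). A x i j)) :: complex) \<in> borel_measurable M"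
proof -
  have "(\<lambda>x. Determinant.det (mat n n (\<lambda>(i, j). A x i j))) =
    (\<lambda>x. \<Sum>p | p permutes {0..<n}. signof p * (\<Prod>i = 0..<n. A x i (p i)))"
  proof
    fix x
    show "Determinant.det (mat n n (\<lambda>(i, j). A x i j)) = (\<Sum>p | p permutes {0..<n}. signof p * (\<Prod>i = 0..<n. A x i (p i)))"
      by (subst det_def'[of _ n]) (auto intro!: sum.cong prod.cong simp: permutes_in_image)
  qed
  also have "\<dots> \<in> borel_measurable M"
  proof (intro borel_measurable_sum borel_measurable_times borel_measurable_prod borel_measurable_const)
    fix p i assume "p \<in> {p. p permutes {0..<n}}" "i \<in> {0..<n}"
    then have "i < n" "p i < n" using permutes_in_image[of p "{0..<n}" i] by auto
    then show "(\<lambda>x. A x i (p i)) \<in> borel_measurable M" by (rule assms)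
  qed
  finally show ?thesis .
qed

lemma borel_measurable_poly_chi:
  assumes "D \<in> measurable M (cleb (sq_idx n))" "l \<in> borel_measurable M"
  shows "(\<lambda>x. poly (chi n (D x)) (l x)) \<in> borel_measurable M"
  unfolding poly_chi
  using borel_measurable_cleb_component[OF assms(1)] assms(2)
  by (intro borel_measurable_det) auto

lemma borel_measurable_poly [measurable]: "poly (p :: complex poly) \<in> borel_measurable borel"
  by (intro borel_measurable_continuous_onI continuous_intros)

text \<open>The corner entry is innermost because it is substituted first; the row stands outside
  the column because genericity of the column is relative to the row.\<close>

lemma nn_integral_bordered:
  assumes f: "f \<in> borel_measurable (cleb (sq_idx (Suc n)))"
  shows "(\<integral>\<^sup>+A. f A \<partial>cleb (sq_idx (Suc n))) =
    (\<integral>\<^sup>+D. \<integral>\<^sup>+w. \<integral>\<^sup>+c. \<integral>\<^sup>+a. f (bordered n D c w a) \<partial>lborel \<partial>cleb (col_idx n) \<partial>cleb (row_idx n) \<partial>cleb (sq_idx n))"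
proof -
  define C where "C = insert (n, n) (col_idx n)"
  define R where "R = row_idx n \<union> C"
  have un: "sq_idx (Suc n) = sq_idx n \<union> R" by (auto simp: R_def C_def less_Suc_eq)
  have dis: "sq_idx n \<inter> R = {}" "row_idx n \<inter> C = {}" by (auto simp: R_def C_def)
  have fin: "finite R" "finite C" "finite (sq_idx n)" "finite (row_idx n)" by (auto simp: R_def C_def)
  have f' [measurable]: "f \<in> borel_measurable (cleb (sq_idx n \<union> R))" using f by (simp only: un)
  have "(\<integral>\<^sup>+A. f A \<partial>cleb (sq_idx (Suc n))) = (\<integral>\<^sup>+D. \<integral>\<^sup>+z. f (merge (sq_idx n) R (D, z)) \<partial>cleb R \<partial>cleb (sq_idx n))"
    unfolding un by (rule nn_integral_cleb_fold(1)[OF fin(3,1) dis(1) f'])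
  also have "\<dots> = (\<integral>\<^sup>+D. \<integral>\<^sup>+w. \<integral>\<^sup>+c. \<integral>\<^sup>+a. f (bordered n D c w a) \<partial>lborel \<partial>cleb (col_idx n) \<partial>cleb (row_idx n) \<partial>cleb (sq_idx n))"
  proof (intro nn_integral_cong)
    fix D assume D: "D \<in> space (cleb (sq_idx n))"
    define h where "h z = f (merge (sq_idx n) R (D, z))" for z
    have "(\<lambda>p. f (merge (sq_idx n) R p)) \<in> borel_measurable (cleb (sq_idx n) \<Otimes>\<^sub>M cleb R)"
      by measurable
    from measurable_compose[OF measurable_Pair1'[OF D] this]
    have h: "h \<in> borel_measurable (cleb R)" by (simp add: h_def[abs_def])
    then have h': "h \<in> borel_measurable (cleb (row_idx n \<union> C))" by (simp only: R_def)
    have "(\<integral>\<^sup>+z. h z \<partial>cleb R) = (\<integral>\<^sup>+w. \<integral>\<^sup>+z. h (merge (row_idx n) C (w, z)) \<partial>cleb C \<partial>cleb (row_idx n))"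
      unfolding R_def by (rule nn_integral_cleb_fold(1)[OF fin(4,2) dis(2) h'])
    also have "\<dots> = (\<integral>\<^sup>+w. \<integral>\<^sup>+c. \<integral>\<^sup>+a. f (bordered n D c w a) \<partial>lborel \<partial>cleb (col_idx n) \<partial>cleb (row_idx n))"
    proof (intro nn_integral_cong)
      fix w assume w: "w \<in> space (cleb (row_idx n))"
      have "(\<lambda>p. h (merge (row_idx n) C p)) \<in> borel_measurable (cleb (row_idx n) \<Otimes>\<^sub>M cleb C)"
        using h' by measurable
      from measurable_compose[OF measurable_Pair1'[OF w] this]
      have "(\<lambda>z. h (merge (row_idx n) C (w, z))) \<in> borel_measurable (cleb (insert (n, n) (col_idx n)))"
        by (simp add: C_def)
      then have "(\<integral>\<^sup>+z. h (merge (row_idx n) C (w, z)) \<partial>cleb C) =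
         (\<integral>\<^sup>+c. \<integral>\<^sup>+a. h (merge (row_idx n) C (w, c((n, n) := a))) \<partial>lborel \<partial>cleb (col_idx n))"
        unfolding C_def by (intro cprod.product_nn_integral_insert) auto
      also have "\<dots> = (\<integral>\<^sup>+c. \<integral>\<^sup>+a. f (bordered n D c w a) \<partial>lborel \<partial>cleb (col_idx n))"
        unfolding h_def
        by (intro nn_integral_cong arg_cong[of _ _ f]) (auto simp: fun_eq_iff merge_def bordered_def R_def C_def less_Suc_eq)
      finally show "(\<integral>\<^sup>+z. h (merge (row_idx n) C (w, z)) \<partial>cleb C) =
         (\<integral>\<^sup>+c. \<integral>\<^sup>+a. f (bordered n D c w a) \<partial>lborel \<partial>cleb (col_idx n))" .
    qed
    finally show "(\<integral>\<^sup>+z. f (merge (sq_idx n) R (D, z)) \<partial>cleb R) =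
       (\<integral>\<^sup>+w. \<integral>\<^sup>+c. \<integral>\<^sup>+a. f (bordered n D c w a) \<partial>lborel \<partial>cleb (col_idx n) \<partial>cleb (row_idx n))"
      by (simp only: h_def)
  qed
  finally show ?thesis .
qed

text \<open>With all other coordinates fixed, the form vanishes for a single value of coordinate
  \<open>i\<close>.\<close>

lemma AE_linear_form_nonzero:
  fixes v :: "'i \<Rightarrow> complex"
  assumes "finite I" "i \<in> I" "v i \<noteq> 0"
  shows "AE x in cleb I. (\<Sum>k\<in>I. v k * x k) \<noteq> 0"
proof -
  define J where "J = I - {i}"
  have I: "I = insert i J" "i \<notin> J" "finite J" using assms by (auto simp: J_def)
  have m: "(\<lambda>x. indicator {0} (\<Sum>k\<in>I. v k * x k) :: ennreal) \<in> borel_measurable (cleb I)"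
  proof -
    have "(\<lambda>x. \<Sum>k\<in>I. v k * x k) \<in> borel_measurable (cleb I)"
      by (intro borel_measurable_sum borel_measurable_times borel_measurable_const
            borel_measurable_cleb_component[of "\<lambda>x. x"]) auto
    then show ?thesis by measurable
  qed
  have "(\<integral>\<^sup>+x. indicator {0} (\<Sum>k\<in>I. v k * x k) \<partial>cleb I) =
    (\<integral>\<^sup>+x. \<integral>\<^sup>+y. indicator {0} (\<Sum>k\<in>insert i J. v k * (x(i := y)) k) \<partial>lborel \<partial>cleb J)"
    unfolding I(1) by (rule cprod.product_nn_integral_insert) (use I m in auto)
  also have "\<dots> = (\<integral>\<^sup>+x. 0 \<partial>cleb J)"
  proof (intro nn_integral_cong)
    fix x :: "'i \<Rightarrow> complex"
    define s where "s = (\<Sum>k\<in>J. v k * x k)"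
    have "(\<Sum>k\<in>insert i J. v k * (x(i := y)) k) = v i * y + s" for y
    proof -
      have "(\<Sum>k\<in>J. v k * (x(i := y)) k) = s" unfolding s_def using I(2) by (intro sum.cong) auto
      then show ?thesis using I by simp
    qed
    then have "(\<integral>\<^sup>+y. indicator {0} (\<Sum>k\<in>insert i J. v k * (x(i := y)) k) \<partial>lborel) = (\<integral>\<^sup>+y. indicator {- s / v i} y \<partial>lborel)"
      using assms(3) by (intro nn_integral_cong) (auto simp: indicator_def field_simps eq_neg_iff_add_eq_0)
    also have "\<dots> = 0" by simp
    finally show "(\<integral>\<^sup>+y. indicator {0} (\<Sum>k\<in>insert i J. v k * (x(i := y)) k) \<partial>lborel) = 0" .
  qed
  finally have "(\<integral>\<^sup>+x. indicator {0} (\<Sum>k\<in>I. v k * x k) \<partial>cleb I) = 0" by simp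
  then have "AE x in cleb I. indicator {0} (\<Sum>k\<in>I. v k * x k) = (0 :: ennreal)"
    using nn_integral_0_iff_AE[OF m] by simp
  then show ?thesis by eventually_elim (auto simp: indicator_def split: if_splits)
qed

text \<open>z - w (z - D)^-1 c: the one corner entry for which \<open>z\<close> is an eigenvalue of
  the bordered matrix.\<close>

definition border_fun :: "nat \<Rightarrow> entry_fun \<Rightarrow> entry_fun \<Rightarrow> entry_fun \<Rightarrow> complex \<Rightarrow> complex" where
  "border_fun n D c w z = z - poly (border_poly n D c w) z / poly (chi n D) z"

lemma border_fun_eq_iff:
  assumes "poly (chi n D) z \<noteq> 0"
  shows "border_fun n D c w z = a \<longleftrightarrow> poly (chi (Suc n) (bordered n D c w a)) z = 0"
  using assms by (auto simp: border_fun_def chi_bordered field_simps)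

lemma pderiv_chi_bordered:
  "pderiv (chi (Suc n) (bordered n D c w a)) =
    [:- a, 1:] * pderiv (chi n D) + chi n D - pderiv (border_poly n D c w)"
  by (simp add: chi_bordered pderiv_diff pderiv_mult pderiv_pCons pderiv_smult)

text \<open>The exceptional corner entries are the critical values of \<open>border_fun\<close>.
  \<open>R\<close> is the numerator of its derivative; its coefficient at degree 2 n comes from the
  square of the monic \<open>chi n D\<close>, so \<open>R\<close> is nonzero and has finitely many
  roots. Coprimality keeps the eigenvalues of the bordered matrix away from those of
  \<open>D\<close>.\<close>

lemma border_exceptional:
  assumes coprime: "\<And>z. poly (chi n D) z = 0 \<Longrightarrow> poly (border_poly n D c w) z \<noteq> 0"
  obtains A where "finite A" "\<And>a z. a \<notin> A \<Longrightarrow> poly (chi (Suc n) (bordered n D c w a)) z = 0 \<Longrightarrow>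
      poly (pderiv (chi (Suc n) (bordered n D c w a))) z \<noteq> 0 \<and> poly (chi n D) z \<noteq> 0"
proof
  define x where "x = chi n D"
  define q where "q = border_poly n D c w"
  define R where "R = x * x + (q * pderiv x - pderiv q * x)"
  have dx: "degree x = n" "coeff x n = 1" and dq: "degree q \<le> n"
    unfolding x_def q_def by (simp_all add: chi_monic degree_border_poly)
  have "R \<noteq> 0"
  \<comment> \<open>For n = 0 the strict degree bounds fail, but then \<open>q = 0\<close> and
    \<open>x = 1\<close>.\<close>
  proof (cases "n = 0")
    case True
    then show ?thesis using dx by (auto simp: R_def q_def border_poly_def dest!: degree_0_id)
  next
    case False
    have "degree (q * pderiv x) < 2 * n" "degree (pderiv q * x) < 2 * n"
      using degree_mult_le[of q "pderiv x"] degree_mult_le[of "pderiv q" x] dx dq False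
      by (auto simp: degree_pderiv)
    then have "coeff (q * pderiv x - pderiv q * x) (2 * n) = 0"
      by (simp add: coeff_eq_0)
    moreover have "coeff (x * x) (n + n) = 1"
      using coeff_mult_degree_sum[of x x] dx by simp
    ultimately have "coeff R (2 * n) = 1" by (simp add: R_def mult_2)
    then show ?thesis by auto
  qed
  then show "finite ((\<lambda>z. border_fun n D c w z) ` {z. poly R z = 0})"
    by (intro finite_imageI poly_roots_finite)
  fix a z
  assume a: "a \<notin> (\<lambda>z. border_fun n D c w z) ` {z. poly R z = 0}"
    and z: "poly (chi (Suc n) (bordered n D c w a)) z = 0"
  have xz: "poly x z \<noteq> 0"
    using z coprime[of z] by (auto simp: chi_bordered x_def)
  moreover have "poly (pderiv (chi (Suc n) (bordered n D c w a))) z \<noteq> 0"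
  proof
    assume d: "poly (pderiv (chi (Suc n) (bordered n D c w a))) z = 0"
    \<comment> \<open>Eliminating z - a between the equations for a root and for a double root
      yields R(z) = 0.\<close>
    have q: "poly q z = (z - a) * poly x z" using z by (simp add: chi_bordered x_def q_def left_diff_distrib)
    have "(z - a) * poly (pderiv x) z + poly x z = poly (pderiv q) z"
      using d by (simp add: pderiv_chi_bordered x_def q_def left_diff_distrib)
    then have "poly R z = 0"
      unfolding R_def by (simp add: q algebra_simps flip: \<open>(z - a) * poly (pderiv x) z + poly x z = poly (pderiv q) z\<close>)
    moreover have "a = border_fun n D c w z"
      using border_fun_eq_iff[of n D z c w a] xz z by (simp add: x_def)
    ultimately show False using a by blast
  qed
  ultimately show "poly (pderiv (chi (Suc n) (bordered n D c w a))) z \<noteq> 0 \<and> poly (chi n D) z \<noteq> 0"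
    by (simp add: x_def)
qed

text \<open>Quotient rule; at the corner entry given by \<open>border_fun\<close> the difference z -
  a is q(z) / chi(z), which turns the numerator into the derivative of the characteristic polynomial
  of the bordered matrix.\<close>

lemma deriv_border_fun:
  assumes "poly (chi n D) z \<noteq> 0"
  shows "(border_fun n D c w has_field_derivative
      poly (pderiv (chi (Suc n) (bordered n D c w (border_fun n D c w z)))) z / poly (chi n D) z) (at z)"
proof -
  define x where "x = chi n D"
  define q where "q = border_poly n D c w"
  have xz: "poly x z \<noteq> 0" using assms by (simp add: x_def)
  have "((\<lambda>z. z - poly q z / poly x z) has_field_derivative
      1 - (poly (pderiv q) z * poly x z - poly q z * poly (pderiv x) z) / (poly x z * poly x z)) (at z)"
    using xz by (auto intro!: derivative_eq_intros poly_DERIV)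
  also have "1 - (poly (pderiv q) z * poly x z - poly q z * poly (pderiv x) z) / (poly x z * poly x z) =
     poly (pderiv (chi (Suc n) (bordered n D c w (border_fun n D c w z)))) z / poly (chi n D) z"
    unfolding pderiv_chi_bordered border_fun_def x_def[symmetric] q_def[symmetric] using xz
    by (simp add: field_simps)
  finally show ?thesis by (simp add: border_fun_def[abs_def] x_def q_def)
qed

text \<open>For generic \<open>D\<close>, \<open>c\<close>, \<open>w\<close> the map sending an eigenvalue to the corner entry is a rational function of
  degree \<open>n + 1\<close>; integrating over the eigenvalue therefore counts every corner entry \<open>n + 1\<close> times.\<close>

lemma nn_integral_corner_entry:
  assumes coprime: "\<And>z. poly (chi n D) z = 0 \<Longrightarrow> poly (border_poly n D c w) z \<noteq> 0"
    and f: "f \<in> borel_measurable borel"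
  shows "of_nat (Suc n) * (\<integral>\<^sup>+a. f a \<partial>lborel) =
    (\<integral>\<^sup>+z. f (border_fun n D c w z) * ennreal ((cmod (poly (pderiv (chi (Suc n) (bordered n D c w (border_fun n D c w z)))) z
        / poly (chi n D) z))\<^sup>2) * indicator {z. poly (chi n D) z \<noteq> 0} z \<partial>lborel)"
proof -
  define U where "U = {z. poly (chi n D) z \<noteq> 0}"
  define g where "g = border_fun n D c w"
  have U: "open U"
  proof -
    have "U = poly (chi n D) -` (- {0})" by (auto simp: U_def)
    moreover have "open (poly (chi n D) -` (- {0}))"
      by (intro open_vimage continuous_intros)
    ultimately show ?thesis by simp
  qed
  have dg: "(g has_field_derivative poly (pderiv (chi (Suc n) (bordered n D c w (g z)))) z / poly (chi n D) z) (at z)"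
    if "z \<in> U" for z
    using deriv_border_fun[of n D z c w] that by (simp add: U_def g_def)
  have hol: "g holomorphic_on U"
    using dg U by (auto simp: holomorphic_on_open)
  obtain A where A: "finite A" "\<And>a z. a \<notin> A \<Longrightarrow> poly (chi (Suc n) (bordered n D c w a)) z = 0 \<Longrightarrow>
      poly (pderiv (chi (Suc n) (bordered n D c w a))) z \<noteq> 0 \<and> poly (chi n D) z \<noteq> 0"
    using border_exceptional[of n D c w] coprime by blast
  have "AE a in lborel. a \<notin> A"
    using A(1) by (intro AE_not_in) (auto intro: finite_imp_null_set_lborel)
  then have card: "AE a in lborel. finite {z \<in> U. g z = a \<and> deriv g z \<noteq> 0} \<and> card {z \<in> U. g z = a \<and> deriv g z \<noteq> 0} = Suc n"
  proof eventually_elim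
    case (elim a)
    define P where "P = chi (Suc n) (bordered n D c w a)"
    have P0: "P \<noteq> 0" "degree P = Suc n" unfolding P_def by (simp_all add: chi_monic)
    have eq: "{z \<in> U. g z = a \<and> deriv g z \<noteq> 0} = {z. poly P z = 0}"
    proof (intro equalityI subsetI; clarify)
      fix z assume "z \<in> U" "a = g z"
      then show "poly P z = 0" using border_fun_eq_iff[of n D z c w a] by (simp add: P_def U_def g_def)
    next
      fix z assume z: "poly P z = 0"
      from A(2)[OF elim, of z] z have *: "poly (pderiv P) z \<noteq> 0" "poly (chi n D) z \<noteq> 0" by (auto simp: P_def)
      then have zU: "z \<in> U" by (simp add: U_def)
      have ga: "g z = a" using border_fun_eq_iff[of n D z c w a] z * by (simp add: P_def g_def)
      have "deriv g z = poly (pderiv P) z / poly (chi n D) z"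
        using DERIV_imp_deriv[OF dg[OF zU]] ga by (simp add: P_def)
      then show "z \<in> U \<and> g z = a \<and> deriv g z \<noteq> 0" using zU ga * by simp
    qed
    have "card {z. poly P z = 0} = Suc n"
      using card_simple_roots[OF P0(1)] A(2)[OF elim] P0(2) by (simp add: P_def)
    then show ?case unfolding eq using poly_roots_finite[OF P0(1)] by simp
  qed
  have "of_nat (Suc n) * (\<integral>\<^sup>+a. f a \<partial>lborel) = (\<integral>\<^sup>+z. f (g z) * ennreal ((cmod (deriv g z))\<^sup>2) * indicator U z \<partial>lborel)"
    by (rule nn_integral_holomorphic_multiplicity[OF U hol f card, symmetric])
  also have "\<dots> = (\<integral>\<^sup>+z. f (g z) * ennreal ((cmod (poly (pderiv (chi (Suc n) (bordered n D c w (g z)))) z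
        / poly (chi n D) z))\<^sup>2) * indicator U z \<partial>lborel)"
    using DERIV_imp_deriv[OF dg] by (intro nn_integral_cong) (auto simp: indicator_def)
  finally show ?thesis by (simp only: g_def U_def)
qed

text \<open>(z - D) u: the last column forced by the upper part of the eigenvalue equation for (u,
  1).\<close>

definition char_mult :: "nat \<Rightarrow> entry_fun \<Rightarrow> complex \<Rightarrow> entry_fun \<Rightarrow> nat \<times> nat \<Rightarrow> complex" where
  "char_mult n D z u = left_mult n {n} (\<lambda>i k. (if i = k then z else 0) - D (i, k)) u"

text \<open>\<open>s = 1\<close> rebuilds the leading block D = B + u w from B, and
  \<open>s = - 1\<close> undoes this.\<close>

definition rank_one_shift :: "nat \<Rightarrow> complex \<Rightarrow> entry_fun \<Rightarrow> entry_fun \<Rightarrow> entry_fun \<Rightarrow> nat \<times> nat \<Rightarrow> complex" where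
  "rank_one_shift n s B u w = (\<lambda>p\<in>sq_idx n. B p + s * (u (fst p, n) * w (n, snd p)))"

definition row_col :: "nat \<Rightarrow> entry_fun \<Rightarrow> entry_fun \<Rightarrow> complex" where
  "row_col n w u = (\<Sum>k<n. w (n, k) * u (k, n))"

text \<open>The block matrix conjugating a lower block triangular matrix with blocks \<open>B\<close>, \<open>w\<close>, \<open>z\<close> by the shear along \<open>u\<close>;
  \<open>(u, 1)\<close> is then an eigenvector for the eigenvalue \<open>z\<close>.\<close>

definition deflated :: "nat \<Rightarrow> entry_fun \<Rightarrow> entry_fun \<Rightarrow> entry_fun \<Rightarrow> complex \<Rightarrow> nat \<times> nat \<Rightarrow> complex" where
  "deflated n D u w z = bordered n D (char_mult n D z u) w (z - row_col n w u)"

text \<open>The shear \<open>P 1\<close>, whose last column is (u, 1), satisfies A P = P T for the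
  block lower triangular T with diagonal blocks \<open>B\<close> and \<open>z\<close>; its inverse
  is \<open>P (- 1)\<close>.\<close>

lemma char_poly_deflated:
  assumes D: "D = rank_one_shift n 1 B u w"
  shows "chi (Suc n) (deflated n D u w z) = [:- z, 1:] * chi n B"
proof -
  define A where "A = mat (Suc n) (Suc n) (deflated n D u w z)"
  define T where "T = mat (Suc n) (Suc n) (bordered n B (\<lambda>_. 0) w z)"
  define P where "P s = mat (Suc n) (Suc n) (\<lambda>(i, j). (if i = j then 1 else 0) + (if i < n \<and> j = n then s * u (i, n) else 0))" for s
  have car: "A \<in> carrier_mat (Suc n) (Suc n)" "T \<in> carrier_mat (Suc n) (Suc n)" "P s \<in> carrier_mat (Suc n) (Suc n)" for s
    by (auto simp: A_def T_def P_def)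
  have PX: "(P s * X) $$ (i, j) = X $$ (i, j) + (if i < n then s * u (i, n) * X $$ (n, j) else 0)"
    if "X \<in> carrier_mat (Suc n) (Suc n)" "i < Suc n" "j < Suc n" for s X i j
  proof -
    have "(P s * X) $$ (i, j) = (\<Sum>k<Suc n. P s $$ (i, k) * X $$ (k, j))"
      using that car(3)[of s] by (simp add: scalar_prod_def lessThan_atLeast0)
    also have "\<dots> = (\<Sum>k<Suc n. (if i = k then X $$ (k, j) else 0) + (if k = n then (if i < n then s * u (i, n) * X $$ (n, j) else 0) else 0))"
      using that by (intro sum.cong) (auto simp: P_def)
    also have "\<dots> = X $$ (i, j) + (if i < n then s * u (i, n) * X $$ (n, j) else 0)"
      unfolding sum.distrib using that by (simp del: sum.lessThan_Suc)
    finally show ?thesis .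
  qed
  have XP: "(X * P s) $$ (i, j) = X $$ (i, j) + (if j = n then s * (\<Sum>k<n. X $$ (i, k) * u (k, n)) else 0)"
    if "X \<in> carrier_mat (Suc n) (Suc n)" "i < Suc n" "j < Suc n" for s X i j
  proof -
    have "(X * P s) $$ (i, j) = (\<Sum>k<Suc n. X $$ (i, k) * P s $$ (k, j))"
      using that car(3)[of s] by (simp add: scalar_prod_def lessThan_atLeast0)
    also have "\<dots> = (\<Sum>k<Suc n. (if k = j then X $$ (i, k) else 0) + (if k < n \<and> j = n then s * (X $$ (i, k) * u (k, n)) else 0))"
      using that by (intro sum.cong) (auto simp: P_def algebra_simps)
    also have "\<dots> = X $$ (i, j) + (\<Sum>k<Suc n. if k < n \<and> j = n then s * (X $$ (i, k) * u (k, n)) else 0)"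
      unfolding sum.distrib using that by (simp del: sum.lessThan_Suc)
    also have "(\<Sum>k<Suc n. if k < n \<and> j = n then s * (X $$ (i, k) * u (k, n)) else 0) = (if j = n then s * (\<Sum>k<n. X $$ (i, k) * u (k, n)) else 0)"
      by (simp add: sum_distrib_left)
    finally show ?thesis .
  qed
  have PP: "P s * P t = 1\<^sub>m (Suc n)" if "s + t = 0" for s t
  proof (rule eq_matI)
    fix i j assume "i < dim_row (1\<^sub>m (Suc n))" "j < dim_col (1\<^sub>m (Suc n))"
    then have ij: "i < Suc n" "j < Suc n" by auto
    have "t * u (i, n) + s * u (i, n) = 0" using that by (metis add.commute distrib_right mult_zero_left)
    then show "(P s * P t) $$ (i, j) = 1\<^sub>m (Suc n) $$ (i, j)"
      unfolding PX[OF car(3) ij] using ij by (auto simp: P_def)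
  qed (use car in auto)
  have AP: "A * P 1 = P 1 * T"
  proof (rule eq_matI)
    fix i j assume "i < dim_row (P 1 * T)" "j < dim_col (P 1 * T)"
    then have ij: "i < Suc n" "j < Suc n" using car(2) car(3)[of 1] by auto
    have s: "(\<Sum>k<n. A $$ (i, k) * u (k, n)) = (\<Sum>k<n. D (i, k) * u (k, n))" if "i < n"
      using that by (intro sum.cong) (auto simp: A_def deflated_def bordered_def)
    have s': "(\<Sum>k<n. A $$ (n, k) * u (k, n)) = row_col n w u"
      unfolding row_col_def by (intro sum.cong) (auto simp: A_def deflated_def bordered_def)
    have cm: "char_mult n D z u (i, n) = z * u (i, n) - (\<Sum>k<n. D (i, k) * u (k, n))" if "i < n"
    proof -
      have "char_mult n D z u (i, n) = (\<Sum>k<n. (if i = k then z * u (k, n) else 0) - D (i, k) * u (k, n))"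
        using that unfolding char_mult_def left_mult_def by (auto intro!: sum.cong simp: algebra_simps)
      then show ?thesis using that by (simp add: sum_subtractf)
    qed
    consider "i < n" "j < n" | "i < n" "j = n" | "i = n" "j < n" | "i = n" "j = n" using ij by linarith
    then show "(A * P 1) $$ (i, j) = (P 1 * T) $$ (i, j)"
      unfolding PX[OF car(2) ij] XP[OF car(1) ij]
    proof cases
      case 1
      then show "A $$ (i, j) + (if j = n then 1 * (\<Sum>k<n. A $$ (i, k) * u (k, n)) else 0) =
        T $$ (i, j) + (if i < n then 1 * u (i, n) * T $$ (n, j) else 0)"
        by (simp add: A_def T_def deflated_def bordered_def D rank_one_shift_def)
    next
      case 2
      then show "A $$ (i, j) + (if j = n then 1 * (\<Sum>k<n. A $$ (i, k) * u (k, n)) else 0) =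
        T $$ (i, j) + (if i < n then 1 * u (i, n) * T $$ (n, j) else 0)"
        using s cm by (simp add: A_def T_def deflated_def bordered_def)
    next
      case 3
      then show "A $$ (i, j) + (if j = n then 1 * (\<Sum>k<n. A $$ (i, k) * u (k, n)) else 0) =
        T $$ (i, j) + (if i < n then 1 * u (i, n) * T $$ (n, j) else 0)"
        by (simp add: A_def T_def deflated_def bordered_def)
    next
      case 4
      then show "A $$ (i, j) + (if j = n then 1 * (\<Sum>k<n. A $$ (i, k) * u (k, n)) else 0) =
        T $$ (i, j) + (if i < n then 1 * u (i, n) * T $$ (n, j) else 0)"
        using s' by (simp add: A_def T_def deflated_def bordered_def)
    qed
  qed (use car(1,2) car(3)[of 1] in auto)
  have "similar_mat A T"
  proof (rule similar_matI[of _ _ "P 1" "P (- 1)" "Suc n"])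
    have "A = A * (P 1 * P (- 1))" using car(1) by (simp add: PP)
    also have "\<dots> = A * P 1 * P (- 1)" by (rule assoc_mult_mat[symmetric, OF car(1) car(3) car(3)])
    finally show "A = P 1 * T * P (- 1)" by (simp add: AP)
  qed (use car PP in auto)
  then have "char_poly A = char_poly T" by (rule char_poly_similar)
  also have "char_poly T = [:- z, 1:] * chi n B"
    unfolding T_def chi_bordered by (simp add: border_poly_def)
  finally show ?thesis by (simp add: A_def)
qed

text \<open>Turns an existential over an uncountable compact set into countable operations: by
  continuity and compactness a zero exists iff on a countable dense subset the values get below
  every 1 / (m + 1).\<close>

lemma closedin_ex_zero_measurable:
  fixes F :: "'a \<Rightarrow> complex \<Rightarrow> real"
  assumes F: "\<And>z. (\<lambda>x. F x z) \<in> borel_measurable M" and cont: "\<And>x. continuous_on UNIV (F x)"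
    and nonneg: "\<And>x z. 0 \<le> F x z" and K: "compact K"
  shows "{x \<in> space M. \<exists>z\<in>K. F x z = 0} \<in> sets M"
proof -
  obtain T where T: "countable T" "T \<subseteq> K" "K \<subseteq> closure T"
    using separable[of K] by metis
  have "{x \<in> space M. \<exists>z\<in>K. F x z = 0} = {x \<in> space M. \<forall>m::nat. \<exists>z\<in>T. F x z < 1 / Suc m}"
  proof (intro Collect_cong conj_cong refl iffI allI)
    fix x and m :: nat assume "\<exists>z\<in>K. F x z = 0"
    then obtain z where z: "z \<in> K" "F x z = 0" by blast
    have "open (F x -` {..<1 / Suc m})"
      using cont[of x] by (intro open_vimage) auto
    moreover have "z \<in> F x -` {..<1 / Suc m}" using z by simp
    ultimately have "F x -` {..<1 / Suc m} \<inter> T \<noteq> {}"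
      using T(3) z(1) open_Int_closure_eq_empty[of "F x -` {..<1 / Suc m}" T] by blast
    then show "\<exists>z\<in>T. F x z < 1 / Suc m" by auto
  next
    fix x assume a: "\<forall>m::nat. \<exists>z\<in>T. F x z < 1 / Suc m"
    then have "K \<noteq> {}" using T(2) by fastforce
    then obtain z0 where z0: "z0 \<in> K" "\<And>z. z \<in> K \<Longrightarrow> F x z0 \<le> F x z"
      using continuous_attains_inf[OF K, of "F x"] cont[of x] continuous_on_subset by blast
    have "F x z0 \<le> 0"
    proof (rule ccontr)
      assume "\<not> F x z0 \<le> 0"
      then obtain m where "1 / Suc m < F x z0" using nat_approx_posE[of "F x z0"] by auto
      moreover obtain z where "z \<in> T" "F x z < 1 / Suc m" using a by blast
      ultimately show False using z0(2)[of z] T(2) by auto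
    qed
    then show "\<exists>z\<in>K. F x z = 0" using z0(1) nonneg[of x z0] by (intro bexI[of _ z0]) auto
  qed
  also have "\<dots> \<in> sets M"
    using F T(1) by (intro sets.sets_Collect_countable_All sets.sets_Collect_countable_Bex) (auto intro: borel_measurable_less)
  finally show ?thesis .
qed

lemma borel_measurable_cmod: "f \<in> borel_measurable M \<Longrightarrow> (\<lambda>x. cmod (f x)) \<in> borel_measurable M"
  by measurable

text \<open>The derivative is a pointwise limit of difference quotients, which only involve
  evaluations of the polynomial.\<close>

lemma borel_measurable_pderiv:
  assumes "\<And>c. (\<lambda>x. poly (p x) (l x + c) :: complex) \<in> borel_measurable M"
  shows "(\<lambda>x. poly (pderiv (p x)) (l x)) \<in> borel_measurable M"
proof (rule borel_measurable_LIMSEQ_metric)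
  show "(\<lambda>x. (poly (p x) (l x + complex_of_real (1 / Suc m)) - poly (p x) (l x + 0)) / complex_of_real (1 / Suc m)) \<in> borel_measurable M" for m
    by (intro borel_measurable_divide borel_measurable_diff assms) auto
  fix x
  have "((\<lambda>h. (poly (p x) (l x + h) - poly (p x) (l x)) / h) \<longlongrightarrow> poly (pderiv (p x)) (l x)) (at 0)"
    using poly_DERIV[of "p x" "l x"] by (simp add: DERIV_def)
  moreover have "filterlim (\<lambda>m. complex_of_real (1 / Suc m)) (at 0) sequentially"
  proof -
    have "(\<lambda>m. complex_of_real (1 / Suc m)) \<longlonglongrightarrow> complex_of_real 0"
      by (intro tendsto_of_real lim_inverse_n'[THEN LIMSEQ_Suc])
    moreover have "complex_of_real (1 / real (Suc m)) \<noteq> 0" for m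
      by (simp only: of_real_eq_0_iff) simp
    ultimately show ?thesis unfolding filterlim_at by (simp del: of_nat_Suc of_real_divide)
  qed
  ultimately show "(\<lambda>m. (poly (p x) (l x + complex_of_real (1 / Suc m)) - poly (p x) (l x + 0)) / complex_of_real (1 / Suc m)) \<longlonglongrightarrow> poly (pderiv (p x)) (l x)"
    by (auto dest: filterlim_compose)
qed

section \<open>Genericity of a simple spectrum\<close>

definition simple_spectrum :: "nat \<Rightarrow> entry_fun \<Rightarrow> bool" where
  "simple_spectrum n D \<longleftrightarrow> (\<forall>z. poly (chi n D) z = 0 \<longrightarrow> poly (pderiv (chi n D)) z \<noteq> 0)"

text \<open>A multiple root is a common zero of the polynomial and its derivative; searching in
  balls of integer radius provides the compactness.\<close>

lemma simple_spectrum_measurable: "{D \<in> space (cleb (sq_idx n)). \<not> simple_spectrum n D} \<in> sets (cleb (sq_idx n))"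
proof -
  let ?M = "cleb (sq_idx n)"
  define F where "F D z = cmod (poly (chi n D) z) + cmod (poly (pderiv (chi n D)) z)" for D z
  have [measurable]: "(\<lambda>D. F D z) \<in> borel_measurable ?M" for z
    unfolding F_def
    by (intro borel_measurable_add borel_measurable_cmod borel_measurable_poly_chi borel_measurable_pderiv) auto
  have "{D \<in> space ?M. \<not> simple_spectrum n D} = (\<Union>m::nat. {D \<in> space ?M. \<exists>z\<in>cball 0 (real m). F D z = 0})"
  proof (intro equalityI subsetI)
    fix D assume "D \<in> {D \<in> space ?M. \<not> simple_spectrum n D}"
    then obtain z where D: "D \<in> space ?M" and z: "poly (chi n D) z = 0" "poly (pderiv (chi n D)) z = 0"
      by (auto simp: simple_spectrum_def)
    obtain m :: nat where "cmod z \<le> real m" using real_arch_simple by blast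
    then have "z \<in> cball 0 (real m)" "F D z = 0" using z by (simp_all add: F_def)
    then show "D \<in> (\<Union>m::nat. {D \<in> space ?M. \<exists>z\<in>cball 0 (real m). F D z = 0})" using D by blast
  next
    fix D assume "D \<in> (\<Union>m::nat. {D \<in> space ?M. \<exists>z\<in>cball 0 (real m). F D z = 0})"
    then obtain z where D: "D \<in> space ?M" and z: "F D z = 0" by blast
    have "poly (chi n D) z = 0" "poly (pderiv (chi n D)) z = 0"
      using z norm_ge_zero[of "poly (chi n D) z"] norm_ge_zero[of "poly (pderiv (chi n D)) z"]
      unfolding F_def by (simp_all add: add_nonneg_eq_0_iff)
    then show "D \<in> {D \<in> space ?M. \<not> simple_spectrum n D}" using D by (auto simp: simple_spectrum_def)
  qed
  also have "\<dots> \<in> sets ?M"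
  proof -
    have "{D \<in> space ?M. \<exists>z\<in>cball 0 (real m). F D z = 0} \<in> sets ?M" for m
    proof (rule closedin_ex_zero_measurable)
      show "(\<lambda>D. F D z) \<in> borel_measurable ?M" for z by measurable
      show "continuous_on UNIV (F D)" for D unfolding F_def by (intro continuous_intros)
      show "0 \<le> F D z" for D z by (simp add: F_def)
    qed simp
    then show ?thesis by (intro sets.countable_UN) auto
  qed
  finally show ?thesis .
qed

lemma poly_border_poly:
  "poly (border_poly n D c w) z = (\<Sum>j<n. (\<Sum>i<n. w (n, i) * poly (adj_poly n D i j) z) * c (j, n))"
proof -
  have "poly (border_poly n D c w) z = (\<Sum>i<n. \<Sum>j<n. w (n, i) * poly (adj_poly n D i j) z * c (j, n))"
    by (simp add: border_poly_def poly_sum mult_ac)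
  also have "\<dots> = (\<Sum>j<n. \<Sum>i<n. w (n, i) * poly (adj_poly n D i j) z * c (j, n))"
    by (rule sum.swap)
  finally show ?thesis by (simp add: sum_distrib_right)
qed

lemma sum_row_idx: "(\<Sum>p\<in>row_idx n. g p) = (\<Sum>k<n. g (n, k))"
  by (simp add: sum.cartesian_product')

lemma sum_col_idx: "(\<Sum>p\<in>col_idx n. g p) = (\<Sum>k<n. g (k, n))"
  by (simp add: sum.cartesian_product')

text \<open>At a simple eigenvalue some diagonal entry of the adjugate is nonzero, so for generic
  \<open>w\<close> the linear form in \<open>c\<close> does not vanish identically, and generic
  \<open>c\<close> does not annihilate it. Only finitely many eigenvalues have to be
  treated.\<close>

lemma AE_border_coprime:
  assumes "simple_spectrum n D"
  shows "AE w in cleb (row_idx n). AE c in cleb (col_idx n). \<forall>z. poly (chi n D) z = 0 \<longrightarrow> poly (border_poly n D c w) z \<noteq> 0"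
proof -
  define Z where "Z = {z. poly (chi n D) z = 0}"
  have Z: "finite Z" using poly_roots_finite[OF chi_monic(3)] by (simp add: Z_def)
  define v where "v w z j = (\<Sum>i<n. w (n, i) * poly (adj_poly n D i j) z)" for w z j
  have "AE w in cleb (row_idx n). \<forall>z\<in>Z. \<exists>j<n. v w z j \<noteq> 0"
  proof (rule AE_finite_allI[OF Z])
    fix z assume "z \<in> Z"
    then have "poly (pderiv (chi n D)) z \<noteq> 0" using assms by (auto simp: Z_def simple_spectrum_def)
    then obtain i where i: "i < n" "poly (adj_poly n D i i) z \<noteq> 0" using simple_root_adj_nonzero by blast
    have "AE w in cleb (row_idx n). (\<Sum>p\<in>row_idx n. poly (adj_poly n D (snd p) i) z * w p) \<noteq> 0"
      by (rule AE_linear_form_nonzero[of _ "(n, i)"]) (use i in auto)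
    then show "AE w in cleb (row_idx n). \<exists>j<n. v w z j \<noteq> 0"
    proof eventually_elim
      case (elim w)
      then have "v w z i \<noteq> 0" unfolding sum_row_idx v_def by (simp add: mult.commute)
      then show ?case using i(1) by blast
    qed
  qed
  then show ?thesis
  proof eventually_elim
    case (elim w)
    have "AE c in cleb (col_idx n). \<forall>z\<in>Z. (\<Sum>j<n. v w z j * c (j, n)) \<noteq> 0"
    proof (rule AE_finite_allI[OF Z])
      fix z assume "z \<in> Z"
      then obtain j where j: "j < n" "v w z j \<noteq> 0" using elim by blast
      have "AE c in cleb (col_idx n). (\<Sum>p\<in>col_idx n. v w z (fst p) * c p) \<noteq> 0"
        by (rule AE_linear_form_nonzero[of _ "(j, n)"]) (use j in auto)
      then show "AE c in cleb (col_idx n). (\<Sum>j<n. v w z j * c (j, n)) \<noteq> 0"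
        by eventually_elim (simp only: sum_col_idx fst_conv not_False_eq_True)
    qed
    then show ?case
      by eventually_elim (auto simp: Z_def poly_border_poly v_def)
  qed
qed

text \<open>Induction along bordering: over a block with simple spectrum and for generic row and
  column, all but finitely many corner entries give simple roots.\<close>

lemma AE_simple_spectrum: "AE D in cleb (sq_idx n). simple_spectrum n D"
proof (induction n)
  case 0
  have "chi 0 D = 1" for D by (simp add: char_poly_def char_poly_matrix_def)
  then show ?case by (simp add: simple_spectrum_def)
next
  case (Suc n)
  let ?M = "cleb (sq_idx (Suc n))"
  define f where "f = (indicator {D \<in> space ?M. \<not> simple_spectrum (Suc n) D} :: _ \<Rightarrow> ennreal)"
  have f: "f \<in> borel_measurable ?M"
    unfolding f_def using simple_spectrum_measurable by (intro borel_measurable_indicator)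
  have "(\<integral>\<^sup>+A. f A \<partial>?M) = (\<integral>\<^sup>+D. 0 \<partial>cleb (sq_idx n))"
    unfolding nn_integral_bordered[OF f]
  proof (rule nn_integral_cong_AE, use Suc.IH in eventually_elim)
    case (elim D)
    have "(\<integral>\<^sup>+w. \<integral>\<^sup>+c. \<integral>\<^sup>+a. f (bordered n D c w a) \<partial>lborel \<partial>cleb (col_idx n) \<partial>cleb (row_idx n)) = (\<integral>\<^sup>+w. 0 \<partial>cleb (row_idx n))"
    proof (rule nn_integral_cong_AE, use AE_border_coprime[OF elim] in eventually_elim)
      case (elim w)
      have "(\<integral>\<^sup>+c. \<integral>\<^sup>+a. f (bordered n D c w a) \<partial>lborel \<partial>cleb (col_idx n)) = (\<integral>\<^sup>+c. 0 \<partial>cleb (col_idx n))"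
      proof (rule nn_integral_cong_AE, use elim in eventually_elim)
        case (elim c)
        obtain A where A: "finite A" "\<And>a z. a \<notin> A \<Longrightarrow> poly (chi (Suc n) (bordered n D c w a)) z = 0 \<Longrightarrow>
            poly (pderiv (chi (Suc n) (bordered n D c w a))) z \<noteq> 0 \<and> poly (chi n D) z \<noteq> 0"
          using border_exceptional[of n D c w] elim by blast
        have "AE a in lborel. a \<notin> A"
          using A(1) by (intro AE_not_in) (auto intro: finite_imp_null_set_lborel)
        then have "(\<integral>\<^sup>+a. f (bordered n D c w a) \<partial>lborel) = (\<integral>\<^sup>+a. 0 \<partial>(lborel :: complex measure))"
        proof (intro nn_integral_cong_AE, eventually_elim)
          case (elim a)
          then have "simple_spectrum (Suc n) (bordered n D c w a)" using A(2) by (auto simp: simple_spectrum_def)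
          then show ?case by (simp add: f_def)
        qed
        then show ?case by simp
      qed
      then show ?case by simp
    qed
    then show ?case by simp
  qed
  then have "AE A in ?M. f A = 0"
    using nn_integral_0_iff_AE[OF f] by simp
  then show ?case
    using AE_space by eventually_elim (auto simp: f_def indicator_def split: if_splits)
qed

section \<open>The deflation formula\<close>

lemma borel_measurable_row_col:
  assumes "w \<in> measurable M (cleb (row_idx n))" "u \<in> measurable M (cleb (col_idx n))"
  shows "(\<lambda>x. row_col n (w x) (u x)) \<in> borel_measurable M"
  unfolding row_col_def
  using borel_measurable_cleb_component[OF assms(1)] borel_measurable_cleb_component[OF assms(2)]
  by (intro borel_measurable_sum borel_measurable_times) auto

lemma measurable_char_mult:
  assumes "D \<in> measurable M (cleb (sq_idx n))" "z \<in> borel_measurable M" "u \<in> measurable M (cleb (col_idx n))"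
  shows "(\<lambda>x. char_mult n (D x) (z x) (u x)) \<in> measurable M (cleb (col_idx n))"
  unfolding char_mult_def left_mult_def
proof (rule measurable_restrict, unfold measurable_lborel1)
  fix p assume p: "p \<in> col_idx n"
  have "(\<lambda>x. if fst p = k then z x else 0) \<in> borel_measurable M" for k
    using assms(2) by (cases "fst p = k") auto
  then show "(\<lambda>x. \<Sum>k<n. ((if fst p = k then z x else 0) - D x (fst p, k)) * u x (k, snd p)) \<in> borel_measurable M"
    using p borel_measurable_cleb_component[OF assms(1)] borel_measurable_cleb_component[OF assms(3)]
    by (intro borel_measurable_sum borel_measurable_times borel_measurable_diff) auto
qed

lemma measurable_rank_one_shift:
  assumes "B \<in> measurable M (cleb (sq_idx n))" "u \<in> measurable M (cleb (col_idx n))" "w \<in> measurable M (cleb (row_idx n))"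
  shows "(\<lambda>x. rank_one_shift n s (B x) (u x) (w x)) \<in> measurable M (cleb (sq_idx n))"
  unfolding rank_one_shift_def
proof (rule measurable_restrict, unfold measurable_lborel1)
  fix p assume p: "p \<in> sq_idx n"
  then show "(\<lambda>x. B x p + s * (u x (fst p, n) * w x (n, snd p))) \<in> borel_measurable M"
    using borel_measurable_cleb_component[OF assms(1)] borel_measurable_cleb_component[OF assms(2)]
      borel_measurable_cleb_component[OF assms(3)]
    by (intro borel_measurable_add borel_measurable_times borel_measurable_const) auto
qed

lemma measurable_deflated:
  assumes "D \<in> measurable M (cleb (sq_idx n))" "u \<in> measurable M (cleb (col_idx n))"
    "w \<in> measurable M (cleb (row_idx n))" "z \<in> borel_measurable M"
  shows "(\<lambda>x. deflated n (D x) (u x) (w x) (z x)) \<in> measurable M (cleb (sq_idx (Suc n)))"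
  unfolding deflated_def using assms
  by (intro measurable_bordered measurable_char_mult borel_measurable_diff borel_measurable_row_col)

lemma chi_rank_one_shift: "chi n (rank_one_shift n (- 1) (rank_one_shift n 1 B u w) u w) = chi n B"
  by (rule arg_cong[of _ _ char_poly]) (auto intro!: eq_matI simp: rank_one_shift_def)

lemma rank_one_shift_inverse:
  "D \<in> extensional (sq_idx n) \<Longrightarrow> rank_one_shift n 1 (rank_one_shift n (- 1) D u w) u w = D"
  by (auto simp: rank_one_shift_def fun_eq_iff extensional_def)

text \<open>That \<open>z\<close> is an eigenvalue of the deflated matrix determines the corner
  entry, and differentiating (X - z) chi_B(X) at z leaves chi_B(z).\<close>

lemma border_fun_char_mult:
  assumes D: "D \<in> extensional (sq_idx n)" and z: "poly (chi n D) z \<noteq> 0"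
  shows "border_fun n D (char_mult n D z u) w z = z - row_col n w u"
    and "poly (pderiv (chi (Suc n) (deflated n D u w z))) z = poly (chi n (rank_one_shift n (- 1) D u w)) z"
proof -
  define B where "B = rank_one_shift n (- 1) D u w"
  have "chi (Suc n) (deflated n D u w z) = [:- z, 1:] * chi n B"
    by (rule char_poly_deflated) (simp add: B_def rank_one_shift_inverse[OF D])
  moreover have "poly (pderiv ([:- z, 1:] * chi n B)) z = poly (chi n B) z"
    by (simp only: pderiv_mult poly_add poly_mult) (simp add: pderiv_pCons)
  ultimately show "border_fun n D (char_mult n D z u) w z = z - row_col n w u"
    and "poly (pderiv (chi (Suc n) (deflated n D u w z))) z = poly (chi n B) z"
    using border_fun_eq_iff[OF z, of "char_mult n D z u" w "z - row_col n w u"]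
    by (simp_all add: deflated_def del: mult_pCons_left)
qed

lemma borel_measurable_nn_integral_cleb:
  assumes "finite I" "(\<lambda>(x, y). f x y) \<in> borel_measurable (N \<Otimes>\<^sub>M cleb I)"
  shows "(\<lambda>x. \<integral>\<^sup>+y. f x y \<partial>cleb I) \<in> borel_measurable N"
  using assms by (intro sigma_finite_measure.borel_measurable_nn_integral) auto

lemma nn_integral_swap_cleb_lborel:
  assumes "finite I" "(\<lambda>(x, y). f x y) \<in> borel_measurable (cleb I \<Otimes>\<^sub>M (lborel :: complex measure))"
  shows "(\<integral>\<^sup>+x. \<integral>\<^sup>+y. f x y \<partial>lborel \<partial>cleb I) = (\<integral>\<^sup>+y. \<integral>\<^sup>+x. f x y \<partial>cleb I \<partial>lborel)"
proof -
  interpret pair_sigma_finite "cleb I" "lborel :: complex measure"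
    using assms(1) by (simp add: pair_sigma_finite_def lborel.sigma_finite_measure_axioms)
  show ?thesis using assms(2) by (rule Fubini'[symmetric])
qed

lemma nn_integral_swap_cleb:
  assumes "finite I" "finite K" "(\<lambda>(x, y). f x y) \<in> borel_measurable (cleb I \<Otimes>\<^sub>M cleb K)"
  shows "(\<integral>\<^sup>+x. \<integral>\<^sup>+y. f x y \<partial>cleb K \<partial>cleb I) = (\<integral>\<^sup>+y. \<integral>\<^sup>+x. f x y \<partial>cleb I \<partial>cleb K)"
  by (rule pair_sigma_finite.Fubini'[symmetric, OF pair_sigma_finite_cleb]) (use assms in auto)

lemma space_cleb_extensional: "D \<in> space (cleb I) \<Longrightarrow> D \<in> extensional I"
  by (auto simp: space_PiM PiE_def)

text \<open>Three substitutions, each in one group of variables with the others fixed: the corner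
  entry by the eigenvalue z, with Jacobian |chi_A'(z) / chi_D(z)|^2 and multiplicity n + 1; the
  column by (z - D) u, with Jacobian |chi_D(z)|^2; the block D by B + u w, with Jacobian 1. As
  chi_A'(z) = chi_B(z), only |chi_B(z)|^2 survives.\<close>

theorem nn_integral_deflation:
  assumes f: "f \<in> borel_measurable (cleb (sq_idx (Suc n)))"
  shows "of_nat (Suc n) * (\<integral>\<^sup>+A. f A \<partial>cleb (sq_idx (Suc n))) =
    (\<integral>\<^sup>+w. \<integral>\<^sup>+z. \<integral>\<^sup>+u. \<integral>\<^sup>+B. f (deflated n (rank_one_shift n 1 B u w) u w z) * ennreal ((cmod (poly (chi n B) z))\<^sup>2)
       \<partial>cleb (sq_idx n) \<partial>cleb (col_idx n) \<partial>lborel \<partial>cleb (row_idx n))"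
proof -
  let ?S = "cleb (sq_idx n)" and ?W = "cleb (row_idx n)" and ?C = "cleb (col_idx n)"
  \<comment> \<open>The integrand after the first two substitutions, still in terms of
    \<open>D\<close>; the negative shift recovers B from it.\<close>
  define H where "H D w z u = f (deflated n D u w z) * ennreal ((cmod (poly (chi n (rank_one_shift n (- 1) D u w)) z))\<^sup>2)" for D w z u
  have H: "(\<lambda>x. H (D x) (w x) (z x) (u x)) \<in> borel_measurable N"
    if "D \<in> measurable N ?S" "w \<in> measurable N ?W" "z \<in> borel_measurable N" "u \<in> measurable N ?C" for N :: "'b measure" and D w z u
  proof -
    have 1: "(\<lambda>x. f (deflated n (D x) (u x) (w x) (z x))) \<in> borel_measurable N"
      by (rule measurable_compose[OF measurable_deflated[OF that(1,4,2,3)] f])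
    have 2: "(\<lambda>x. poly (chi n (rank_one_shift n (- 1) (D x) (u x) (w x))) (z x)) \<in> borel_measurable N"
      using that by (intro borel_measurable_poly_chi measurable_rank_one_shift)
    show ?thesis unfolding H_def using 1 2 by measurable
  qed
  have "of_nat (Suc n) * (\<integral>\<^sup>+A. f A \<partial>cleb (sq_idx (Suc n))) = (\<integral>\<^sup>+A. of_nat (Suc n) * f A \<partial>cleb (sq_idx (Suc n)))"
    by (rule nn_integral_cmult[symmetric, OF f])
  also have "\<dots> = (\<integral>\<^sup>+D. \<integral>\<^sup>+w. \<integral>\<^sup>+c. \<integral>\<^sup>+a. of_nat (Suc n) * f (bordered n D c w a) \<partial>lborel \<partial>?C \<partial>?W \<partial>?S)"
    by (rule nn_integral_bordered) (use f in measurable)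
  also have "\<dots> = (\<integral>\<^sup>+D. \<integral>\<^sup>+w. \<integral>\<^sup>+z. \<integral>\<^sup>+u. H D w z u \<partial>?C \<partial>lborel \<partial>?W \<partial>?S)"
  proof (rule nn_integral_cong_AE, use AE_simple_spectrum AE_space in eventually_elim)
    case (elim D)
    note D = elim
    have Dext: "D \<in> extensional (sq_idx n)" using D(2) by (rule space_cleb_extensional)
    show "(\<integral>\<^sup>+w. \<integral>\<^sup>+c. \<integral>\<^sup>+a. of_nat (Suc n) * f (bordered n D c w a) \<partial>lborel \<partial>?C \<partial>?W) = (\<integral>\<^sup>+w. \<integral>\<^sup>+z. \<integral>\<^sup>+u. H D w z u \<partial>?C \<partial>lborel \<partial>?W)"
    proof (rule nn_integral_cong_AE, use AE_border_coprime[OF D(1)] AE_space in eventually_elim)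
      case (elim w)
      note w = elim
      define G where "G c z = f (bordered n D c w (border_fun n D c w z)) *
        ennreal ((cmod (poly (pderiv (chi (Suc n) (bordered n D c w (border_fun n D c w z)))) z / poly (chi n D) z))\<^sup>2) *
        indicator {z. poly (chi n D) z \<noteq> 0} z" for c z
      have G: "(\<lambda>(c, z). G c z) \<in> borel_measurable (?C \<Otimes>\<^sub>M (lborel :: complex measure))"
      proof -
        let ?N = "?C \<Otimes>\<^sub>M (lborel :: complex measure)"
        have D': "(\<lambda>_. D) \<in> measurable ?N ?S" and w': "(\<lambda>_. w) \<in> measurable ?N ?W"
          using D(2) w(2) by simp_all
        have c': "fst \<in> measurable ?N ?C" and z': "snd \<in> borel_measurable ?N" by simp_all
        have x: "(\<lambda>p. poly (chi n D) (snd p)) \<in> borel_measurable ?N" by measurable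
        have "(\<lambda>p. poly (border_poly n D (fst p) w) (snd p)) \<in> borel_measurable ?N"
          unfolding poly_border_poly
          using borel_measurable_cleb_component[OF c'] measurable_compose[OF z' borel_measurable_poly]
          by (intro borel_measurable_sum borel_measurable_times borel_measurable_const) auto
        then have b: "(\<lambda>p. border_fun n D (fst p) w (snd p)) \<in> borel_measurable ?N"
          unfolding border_fun_def using x by measurable
        have A: "(\<lambda>p. bordered n D (fst p) w (border_fun n D (fst p) w (snd p))) \<in> measurable ?N (cleb (sq_idx (Suc n)))"
          by (rule measurable_bordered[OF D' c' w' b])
        have P: "(\<lambda>p. poly (pderiv (chi (Suc n) (bordered n D (fst p) w (border_fun n D (fst p) w (snd p))))) (snd p)) \<in> borel_measurable ?N"
          by (intro borel_measurable_pderiv borel_measurable_poly_chi A) simp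
        have Z: "{z. poly (chi n D) z \<noteq> 0} \<in> sets borel" by measurable
        show ?thesis unfolding G_def case_prod_unfold
          using measurable_compose[OF A f] P x Z by measurable
      qed
      have "(\<integral>\<^sup>+c. \<integral>\<^sup>+a. of_nat (Suc n) * f (bordered n D c w a) \<partial>lborel \<partial>?C) = (\<integral>\<^sup>+c. \<integral>\<^sup>+z. G c z \<partial>lborel \<partial>?C)"
      proof (rule nn_integral_cong_AE, use w(1) AE_space in eventually_elim)
        case (elim c)
        have fa: "(\<lambda>a. f (bordered n D c w a)) \<in> borel_measurable borel"
          by (rule measurable_compose[OF measurable_bordered f]) (use D(2) w(2) elim(2) in simp_all)
        have "(\<integral>\<^sup>+a. of_nat (Suc n) * f (bordered n D c w a) \<partial>lborel) = of_nat (Suc n) * (\<integral>\<^sup>+a. f (bordered n D c w a) \<partial>lborel)"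
          by (rule nn_integral_cmult) (use fa in simp)
        also have "\<dots> = (\<integral>\<^sup>+z. G c z \<partial>lborel)"
          unfolding G_def by (rule nn_integral_corner_entry[OF _ fa]) (use elim(1) in blast)
        finally show ?case .
      qed
      also have "\<dots> = (\<integral>\<^sup>+z. \<integral>\<^sup>+c. G c z \<partial>?C \<partial>lborel)"
        by (rule nn_integral_swap_cleb_lborel[OF _ G]) simp
      also have "\<dots> = (\<integral>\<^sup>+z. \<integral>\<^sup>+u. H D w z u \<partial>?C \<partial>lborel)"
      proof (rule nn_integral_cong_AE)
        \<comment> \<open>The eigenvalues of \<open>D\<close>, where c = (z - D) u degenerates, form
          a finite and hence null set.\<close>
        have "AE z in lborel. z \<notin> {z. poly (chi n D) z = 0}"
          by (intro AE_not_in finite_imp_null_set_lborel poly_roots_finite chi_monic)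
        then show "AE z in lborel. (\<integral>\<^sup>+c. G c z \<partial>?C) = (\<integral>\<^sup>+u. H D w z u \<partial>?C)"
        proof eventually_elim
          case (elim z)
          then have z: "poly (chi n D) z \<noteq> 0" by simp
          define R where "R i k = (if i = k then z else 0) - D (i, k)" for i k
          have det: "Determinant.det (mat n n (\<lambda>(i, k). R i k)) = poly (chi n D) z"
            by (simp add: poly_chi R_def)
          have Gz: "(\<lambda>c. G c z) \<in> borel_measurable ?C"
            using measurable_compose[OF measurable_Pair2' G, of z] by simp
          have GR: "(\<lambda>u. G (char_mult n D z u) z) \<in> borel_measurable ?C"
            by (rule measurable_compose[OF measurable_char_mult Gz]) (use D(2) in simp_all)
          have "(\<integral>\<^sup>+c. G c z \<partial>?C) = (\<integral>\<^sup>+u. G (char_mult n D z u) z \<partial>?C) * ennreal (cmod (poly (chi n D) z) ^ 2)"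
            using nn_integral_left_mult[of "{n}" "\<lambda>c. G c z" n R] Gz z unfolding det by (simp add: char_mult_def R_def[abs_def])
          also have "\<dots> = (\<integral>\<^sup>+u. G (char_mult n D z u) z * ennreal (cmod (poly (chi n D) z) ^ 2) \<partial>?C)"
            by (rule nn_integral_multc[symmetric, OF GR])
          also have "\<dots> = (\<integral>\<^sup>+u. H D w z u \<partial>?C)"
          proof (rule nn_integral_cong)
            fix u
            have "G (char_mult n D z u) z * ennreal (cmod (poly (chi n D) z) ^ 2) =
              f (deflated n D u w z) * (ennreal ((cmod (poly (chi n (rank_one_shift n (- 1) D u w)) z / poly (chi n D) z))\<^sup>2) * ennreal ((cmod (poly (chi n D) z))\<^sup>2))"
              unfolding G_def border_fun_char_mult(1)[OF Dext z] deflated_def[symmetric] border_fun_char_mult(2)[OF Dext z]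
              using z by (simp add: mult.assoc)
            also have "ennreal ((cmod (poly (chi n (rank_one_shift n (- 1) D u w)) z / poly (chi n D) z))\<^sup>2) * ennreal ((cmod (poly (chi n D) z))\<^sup>2)
               = ennreal ((cmod (poly (chi n (rank_one_shift n (- 1) D u w)) z))\<^sup>2)"
              using z by (simp add: ennreal_mult[symmetric] norm_divide power_divide)
            finally show "G (char_mult n D z u) z * ennreal (cmod (poly (chi n D) z) ^ 2) = H D w z u"
              by (simp only: H_def)
          qed
          finally show ?case .
        qed
      qed
      finally show ?case .
    qed
  qed
  also have "\<dots> = (\<integral>\<^sup>+w. \<integral>\<^sup>+D. \<integral>\<^sup>+z. \<integral>\<^sup>+u. H D w z u \<partial>?C \<partial>lborel \<partial>?S \<partial>?W)"
    by (rule nn_integral_swap_cleb)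
      (auto simp: case_prod_unfold intro!: lborel.borel_measurable_nn_integral borel_measurable_nn_integral_cleb H)
  also have "\<dots> = (\<integral>\<^sup>+w. \<integral>\<^sup>+z. \<integral>\<^sup>+u. \<integral>\<^sup>+B. f (deflated n (rank_one_shift n 1 B u w) u w z) * ennreal ((cmod (poly (chi n B) z))\<^sup>2)
       \<partial>?S \<partial>?C \<partial>lborel \<partial>?W)"
  proof (rule nn_integral_cong)
    fix w assume w: "w \<in> space ?W"
    have "(\<integral>\<^sup>+D. \<integral>\<^sup>+z. \<integral>\<^sup>+u. H D w z u \<partial>?C \<partial>lborel \<partial>?S) = (\<integral>\<^sup>+z. \<integral>\<^sup>+D. \<integral>\<^sup>+u. H D w z u \<partial>?C \<partial>?S \<partial>lborel)"
      by (rule nn_integral_swap_cleb_lborel)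
        (auto simp: case_prod_unfold w intro!: borel_measurable_nn_integral_cleb H)
    also have "\<dots> = (\<integral>\<^sup>+z. \<integral>\<^sup>+u. \<integral>\<^sup>+B. f (deflated n (rank_one_shift n 1 B u w) u w z) * ennreal ((cmod (poly (chi n B) z))\<^sup>2)
       \<partial>?S \<partial>?C \<partial>lborel)"
    proof (rule nn_integral_cong)
      fix z :: complex
      have "(\<integral>\<^sup>+D. \<integral>\<^sup>+u. H D w z u \<partial>?C \<partial>?S) = (\<integral>\<^sup>+u. \<integral>\<^sup>+D. H D w z u \<partial>?S \<partial>?C)"
        by (rule nn_integral_swap_cleb) (auto simp: case_prod_unfold w intro!: H)
      \<comment> \<open>For fixed \<open>u\<close> and \<open>w\<close> the passage from D to B is a
        translation.\<close>
      also have "\<dots> = (\<integral>\<^sup>+u. \<integral>\<^sup>+B. H (rank_one_shift n 1 B u w) w z u \<partial>?S \<partial>?C)"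
      proof (rule nn_integral_cong)
        fix u assume u: "u \<in> space ?C"
        have "(\<lambda>D. H D w z u) \<in> borel_measurable ?S" by (intro H) (auto simp: u w)
        from nn_integral_cleb_affine[OF _ _ this, of 1 "\<lambda>p. u (fst p, n) * w (n, snd p)"]
        show "(\<integral>\<^sup>+D. H D w z u \<partial>?S) = (\<integral>\<^sup>+B. H (rank_one_shift n 1 B u w) w z u \<partial>?S)"
          by (simp add: rank_one_shift_def)
      qed
      also have "\<dots> = (\<integral>\<^sup>+u. \<integral>\<^sup>+B. f (deflated n (rank_one_shift n 1 B u w) u w z) * ennreal ((cmod (poly (chi n B) z))\<^sup>2) \<partial>?S \<partial>?C)"
        unfolding H_def chi_rank_one_shift ..
      finally show "(\<integral>\<^sup>+D. \<integral>\<^sup>+u. H D w z u \<partial>?C \<partial>?S) =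
        (\<integral>\<^sup>+u. \<integral>\<^sup>+B. f (deflated n (rank_one_shift n 1 B u w) u w z) * ennreal ((cmod (poly (chi n B) z))\<^sup>2) \<partial>?S \<partial>?C)" .
    qed
    finally show "(\<integral>\<^sup>+D. \<integral>\<^sup>+z. \<integral>\<^sup>+u. H D w z u \<partial>?C \<partial>lborel \<partial>?S) = (\<integral>\<^sup>+z. \<integral>\<^sup>+u. \<integral>\<^sup>+B. f (deflated n (rank_one_shift n 1 B u w) u w z) * ennreal ((cmod (poly (chi n B) z))\<^sup>2)
       \<partial>?S \<partial>?C \<partial>lborel)" .
  qed
  finally show ?thesis .
qed

section \<open>Gaussian integration over the eigenvector\<close>

definition frob :: "nat \<Rightarrow> entry_fun \<Rightarrow> real" where
  "frob n A = (\<Sum>i<n. \<Sum>j<n. (cmod (A (i, j)))\<^sup>2)"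

definition right_mult :: "nat \<Rightarrow> (nat \<Rightarrow> nat \<Rightarrow> complex) \<Rightarrow> entry_fun \<Rightarrow> nat \<times> nat \<Rightarrow> complex" where
  "right_mult n R x = (\<lambda>p\<in>sq_idx n. \<Sum>k<n. x (fst p, k) * R k (snd p))"

text \<open>Right multiplication is left multiplication between two transpositions, and transposing
  only permutes the coordinates of the product measure.\<close>

definition transp :: "nat \<Rightarrow> entry_fun \<Rightarrow> nat \<times> nat \<Rightarrow> complex" where
  "transp n x = (\<lambda>p\<in>sq_idx n. x (snd p, fst p))"

lemma measurable_transp [measurable]: "transp n \<in> measurable (cleb (sq_idx n)) (cleb (sq_idx n))"
  unfolding transp_def
  by (rule measurable_restrict, unfold measurable_lborel1,
      rule borel_measurable_cleb_component[of "\<lambda>x. x" _ "sq_idx n"]) auto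

lemma distr_transp: "distr (cleb (sq_idx n)) (cleb (sq_idx n)) (transp n) = cleb (sq_idx n)"
proof (rule cprod.PiM_eqI)
  fix A :: "nat \<times> nat \<Rightarrow> complex set" assume A: "\<And>i. i \<in> sq_idx n \<Longrightarrow> A i \<in> sets lborel"
  have "transp n -` Pi\<^sub>E (sq_idx n) A \<inter> space (cleb (sq_idx n)) = Pi\<^sub>E (sq_idx n) (\<lambda>p. A (snd p, fst p))"
  proof (intro equalityI subsetI)
    fix x assume x: "x \<in> transp n -` Pi\<^sub>E (sq_idx n) A \<inter> space (cleb (sq_idx n))"
    have "x p \<in> A (snd p, fst p)" if "p \<in> sq_idx n" for p
    proof -
      have "(snd p, fst p) \<in> sq_idx n" using that by auto
      then have "transp n x (snd p, fst p) \<in> A (snd p, fst p)" using x by (blast dest: PiE_mem)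
      then show ?thesis using that by (simp add: transp_def mem_Times_iff)
    qed
    moreover have "x \<in> extensional (sq_idx n)" using x by (simp add: space_PiM PiE_def)
    ultimately show "x \<in> Pi\<^sub>E (sq_idx n) (\<lambda>p. A (snd p, fst p))" by (simp add: PiE_iff)
  next
    fix x assume x: "x \<in> Pi\<^sub>E (sq_idx n) (\<lambda>p. A (snd p, fst p))"
    have "transp n x p \<in> A p" if "p \<in> sq_idx n" for p
    proof -
      have "(snd p, fst p) \<in> sq_idx n" using that by auto
      from PiE_mem[OF x this] show ?thesis using that by (simp add: transp_def)
    qed
    moreover have "transp n x \<in> extensional (sq_idx n)" by (simp add: transp_def)
    ultimately have "transp n x \<in> Pi\<^sub>E (sq_idx n) A" by (simp add: PiE_iff)
    then show "x \<in> transp n -` Pi\<^sub>E (sq_idx n) A \<inter> space (cleb (sq_idx n))" using x by (simp add: space_PiM PiE_def)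
  qed
  then have "emeasure (distr (cleb (sq_idx n)) (cleb (sq_idx n)) (transp n)) (Pi\<^sub>E (sq_idx n) A) =
      emeasure (cleb (sq_idx n)) (Pi\<^sub>E (sq_idx n) (\<lambda>p. A (snd p, fst p)))"
    using A by (subst emeasure_distr[OF measurable_transp]) (simp_all add: sets_PiM_I_finite)
  also have "\<dots> = (\<Prod>p\<in>sq_idx n. emeasure lborel (A (snd p, fst p)))"
    using A by (intro cprod.emeasure_PiM) (simp_all add: mem_Times_iff)
  also have "\<dots> = (\<Prod>p\<in>sq_idx n. emeasure lborel (A p))"
    by (rule prod.reindex_bij_witness[of _ "\<lambda>p. (snd p, fst p)" "\<lambda>p. (snd p, fst p)"]) auto
  finally show "emeasure (distr (cleb (sq_idx n)) (cleb (sq_idx n)) (transp n)) (Pi\<^sub>E (sq_idx n) A) = (\<Prod>p\<in>sq_idx n. emeasure lborel (A p))" .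
qed auto

lemma nn_integral_transp:
  "f \<in> borel_measurable (cleb (sq_idx n)) \<Longrightarrow> (\<integral>\<^sup>+x. f (transp n x) \<partial>cleb (sq_idx n)) = (\<integral>\<^sup>+x. f x \<partial>cleb (sq_idx n))"
  using nn_integral_distr[OF measurable_transp, of f n] by (simp add: distr_transp)

lemma right_mult_eq: "right_mult n R x = transp n (left_mult n {..<n} (\<lambda>i j. R j i) (transp n x))"
  by (auto simp: right_mult_def transp_def left_mult_def fun_eq_iff mult.commute intro!: sum.cong)

lemma measurable_right_mult [measurable]: "right_mult n R \<in> measurable (cleb (sq_idx n)) (cleb (sq_idx n))"
  unfolding right_mult_eq by measurable

lemma nn_integral_right_mult:
  assumes f [measurable]: "f \<in> borel_measurable (cleb (sq_idx n))"
    and det: "Determinant.det (mat n n (\<lambda>(i, j). R i j)) \<noteq> 0"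
  shows "(\<integral>\<^sup>+x. f (right_mult n R x) \<partial>cleb (sq_idx n)) *
      ennreal (cmod (Determinant.det (mat n n (\<lambda>(i, j). R i j))) ^ (2 * n))
    = (\<integral>\<^sup>+x. f x \<partial>cleb (sq_idx n))"
proof -
  have "mat n n (\<lambda>(i, j). R j i) = transpose_mat (mat n n (\<lambda>(i, j). R i j))"
    by (intro eq_matI) auto
  then have dt: "Determinant.det (mat n n (\<lambda>(i, j). R j i)) = Determinant.det (mat n n (\<lambda>(i, j). R i j))"
    using det_transpose[of "mat n n (\<lambda>(i, j). R i j)" n] by simp
  have 1: "(\<lambda>x. f (transp n (left_mult n {..<n} (\<lambda>i j. R j i) x))) \<in> borel_measurable (cleb (sq_idx n))"
    by measurable
  have "(\<integral>\<^sup>+x. f (right_mult n R x) \<partial>cleb (sq_idx n)) = (\<integral>\<^sup>+x. f (transp n (left_mult n {..<n} (\<lambda>i j. R j i) x)) \<partial>cleb (sq_idx n))"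
    unfolding right_mult_eq by (rule nn_integral_transp[OF 1])
  also have "\<dots> * ennreal (cmod (Determinant.det (mat n n (\<lambda>(i, j). R i j))) ^ (2 * n)) = (\<integral>\<^sup>+x. f (transp n x) \<partial>cleb (sq_idx n))"
    using nn_integral_left_mult[of "{..<n}" "\<lambda>x. f (transp n x)" n "\<lambda>i j. R j i"] det
    unfolding dt by simp
  also have "\<dots> = (\<integral>\<^sup>+x. f x \<partial>cleb (sq_idx n))"
    by (rule nn_integral_transp[OF f])
  finally show ?thesis .
qed

lemma inverse_mats_det:
  assumes "\<And>i j. i < n \<Longrightarrow> j < n \<Longrightarrow> (\<Sum>k<n. R i k * R' k j) = (if i = j then 1 else 0 :: complex)"
  shows "Determinant.det (mat n n (\<lambda>(i, j). R i j)) * Determinant.det (mat n n (\<lambda>(i, j). R' i j)) = 1"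
    and "mat n n (\<lambda>(i, j). R i j) * mat n n (\<lambda>(i, j). R' i j) = 1\<^sub>m n"
proof -
  show eq: "mat n n (\<lambda>(i, j). R i j) * mat n n (\<lambda>(i, j). R' i j) = 1\<^sub>m n"
    using assms by (intro eq_matI) (auto simp: scalar_prod_def lessThan_atLeast0)
  show "Determinant.det (mat n n (\<lambda>(i, j). R i j)) * Determinant.det (mat n n (\<lambda>(i, j). R' i j)) = 1"
    using det_mult[of "mat n n (\<lambda>(i, j). R i j)" n "mat n n (\<lambda>(i, j). R' i j)"] eq by simp
qed

text \<open>The Jacobians of left multiplication by \<open>R\<close> and right multiplication by its
  inverse \<open>R'\<close> are reciprocal.\<close>

lemma nn_integral_conjugate:
  assumes f [measurable]: "f \<in> borel_measurable (cleb (sq_idx n))"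
    and inv: "\<And>i j. i < n \<Longrightarrow> j < n \<Longrightarrow> (\<Sum>k<n. R i k * R' k j) = (if i = j then 1 else 0 :: complex)"
  shows "(\<integral>\<^sup>+x. f (right_mult n R' (left_mult n {..<n} R x)) \<partial>cleb (sq_idx n)) = (\<integral>\<^sup>+x. f x \<partial>cleb (sq_idx n))"
proof -
  define a where "a = Determinant.det (mat n n (\<lambda>(i, j). R i j))"
  define b where "b = Determinant.det (mat n n (\<lambda>(i, j). R' i j))"
  have ab: "a * b = 1" unfolding a_def b_def by (rule inverse_mats_det(1)[OF inv])
  then have a: "a \<noteq> 0" and b: "b \<noteq> 0" by auto
  have fr: "(\<lambda>x. f (right_mult n R' x)) \<in> borel_measurable (cleb (sq_idx n))" by measurable
  have "(\<integral>\<^sup>+x. f (right_mult n R' (left_mult n {..<n} R x)) \<partial>cleb (sq_idx n)) * (ennreal (cmod a ^ (2 * n)) * ennreal (cmod b ^ (2 * n))) =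
     (\<integral>\<^sup>+x. f (right_mult n R' x) \<partial>cleb (sq_idx n)) * ennreal (cmod b ^ (2 * n))"
    using nn_integral_left_mult[OF _ fr, of R] a by (simp add: a_def mult.assoc[symmetric])
  also have "\<dots> = (\<integral>\<^sup>+x. f x \<partial>cleb (sq_idx n))"
    using nn_integral_right_mult[OF f, of R'] b by (simp add: b_def)
  also have "ennreal (cmod a ^ (2 * n)) * ennreal (cmod b ^ (2 * n)) = 1"
    using ab by (simp add: ennreal_mult[symmetric] power_mult_distrib[symmetric] norm_mult[symmetric])
  finally show ?thesis by simp
qed

lemma chi_conjugate:
  assumes inv: "\<And>i j. i < n \<Longrightarrow> j < n \<Longrightarrow> (\<Sum>k<n. R i k * R' k j) = (if i = j then 1 else 0 :: complex)"
  shows "chi n (right_mult n R' (left_mult n {..<n} R B)) = chi n B"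
proof -
  define P where "P = mat n n (\<lambda>(i, j). R i j)"
  define Q where "Q = mat n n (\<lambda>(i, j). R' i j)"
  have car: "P \<in> carrier_mat n n" "Q \<in> carrier_mat n n" by (auto simp: P_def Q_def)
  have PQ: "P * Q = 1\<^sub>m n" unfolding P_def Q_def by (rule inverse_mats_det(2)[OF inv])
  have QP: "Q * P = 1\<^sub>m n" by (rule mat_mult_left_right_inverse[OF car PQ])
  have "mat n n (right_mult n R' (left_mult n {..<n} R B)) = P * mat n n B * Q"
    by (intro eq_matI) (auto simp: P_def Q_def right_mult_def left_mult_def scalar_prod_def lessThan_atLeast0 intro!: sum.cong)
  then have "similar_mat (mat n n (right_mult n R' (left_mult n {..<n} R B))) (mat n n B)"
    by (intro similar_matI[of _ _ P Q n]) (use car PQ QP in auto)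
  then show ?thesis by (rule char_poly_similar)
qed

section \<open>Splitting the Frobenius norm of a deflated matrix\<close>

lemma sum_cmod_add_sq:
  "(\<Sum>k\<in>I. (cmod (x k + c * y k))\<^sup>2) = (\<Sum>k\<in>I. (cmod (x k))\<^sup>2) + (cmod c)\<^sup>2 * (\<Sum>k\<in>I. (cmod (y k))\<^sup>2)
     + 2 * Re (cnj c * (\<Sum>k\<in>I. x k * cnj (y k)))"
proof -
  have "(cmod (x k + c * y k))\<^sup>2 = (cmod (x k))\<^sup>2 + (cmod c)\<^sup>2 * (cmod (y k))\<^sup>2 + 2 * Re (cnj c * (x k * cnj (y k)))" for k
    by (simp only: cmod_power2) (simp add: power2_eq_square algebra_simps)
  then show ?thesis by (simp add: sum.distrib sum_distrib_left)
qed

definition col_sq :: "nat \<Rightarrow> entry_fun \<Rightarrow> real" where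
  "col_sq n u = (\<Sum>k<n. (cmod (u (k, n)))\<^sup>2)"

text \<open>The quadratic form (1 + |u|^2) w (1 + u u^H) w^H in the bottom row
  \<open>w\<close>.\<close>

definition row_energy :: "nat \<Rightarrow> entry_fun \<Rightarrow> entry_fun \<Rightarrow> real" where
  "row_energy n u w = (1 + col_sq n u) * ((\<Sum>k<n. (cmod (w (n, k)))\<^sup>2) + (cmod (row_col n w u))\<^sup>2)"

text \<open>(u^H B - z u^H) / (1 + |u|^2), the translation of the bottom row that completes the
  square.\<close>

definition row_shift :: "nat \<Rightarrow> entry_fun \<Rightarrow> entry_fun \<Rightarrow> complex \<Rightarrow> nat \<times> nat \<Rightarrow> complex" where
  "row_shift n B u z p = ((\<Sum>i<n. B (i, snd p) * cnj (u (i, n))) - z * cnj (u (snd p, n))) / of_real (1 + col_sq n u)"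

definition half_rot :: "nat \<Rightarrow> entry_fun \<Rightarrow> real \<Rightarrow> nat \<Rightarrow> nat \<Rightarrow> complex" where
  "half_rot n u c i j = (if i = j then 1 else 0) + of_real c * u (i, n) * cnj (u (j, n))"

text \<open>Up to a unitary factor, the block matrix used for the deflation has diagonal blocks \<open>(1 - u u\<^sup>*/(1 + |u|\<^sup>2))\<^sup>1\<^sup>/\<^sup>2\<close>
  and \<open>(1 + |u|\<^sup>2)\<^sup>1\<^sup>/\<^sup>2\<close>; the first is \<open>half_rot n u c\<close> for the constant \<open>c\<close> below, the second argument gives its inverse.\<close>

definition unit_conj :: "nat \<Rightarrow> entry_fun \<Rightarrow> entry_fun \<Rightarrow> nat \<times> nat \<Rightarrow> complex" where
  "unit_conj n u B = (let q = sqrt (1 + col_sq n u) in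
     right_mult n (half_rot n u (1 / (q + 1))) (left_mult n {..<n} (half_rot n u (- 1 / (q * (q + 1)))) B))"

lemma col_sq_nonneg: "0 \<le> col_sq n u"
  by (simp add: col_sq_def sum_nonneg)

text \<open>(1 + a u u^H) (1 + b u u^H) = 1 + (a + b + a b |u|^2) u u^H, and since |u|^2 = (q - 1)
  (q + 1) the bracket vanishes.\<close>

lemma half_rot_inverse:
  fixes u :: "nat \<times> nat \<Rightarrow> complex" and n :: nat
  defines "q \<equiv> sqrt (1 + col_sq n u)"
  assumes "i < n" "j < n"
  shows "(\<Sum>k<n. half_rot n u (- 1 / (q * (q + 1))) i k * half_rot n u (1 / (q + 1)) k j) = (if i = j then 1 else 0)"
proof -
  define a where "a = - 1 / (q * (q + 1))"
  define b where "b = 1 / (q + 1)"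
  have q: "q \<ge> 1" "q * q = 1 + col_sq n u"
    using col_sq_nonneg[of n u] by (auto simp: q_def)
  have "(\<Sum>k<n. half_rot n u a i k * half_rot n u b k j) =
     (\<Sum>k<n. (if i = k then half_rot n u b k j else 0) + (if k = j then of_real a * u (i, n) * cnj (u (k, n)) else 0)
        + of_real (a * b) * u (i, n) * cnj (u (j, n)) * (u (k, n) * cnj (u (k, n))))"
    by (intro sum.cong) (auto simp: half_rot_def algebra_simps)
  also have "\<dots> = half_rot n u b i j + of_real a * u (i, n) * cnj (u (j, n)) + of_real (a * b) * u (i, n) * cnj (u (j, n)) * of_real (col_sq n u)"
  proof -
    have "(\<Sum>k<n. u (k, n) * cnj (u (k, n))) = of_real (col_sq n u)"
      unfolding col_sq_def of_real_sum complex_norm_square ..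
    then show ?thesis unfolding sum.distrib sum_distrib_left[symmetric] using assms by simp
  qed
  also have "\<dots> = (if i = j then 1 else 0) + of_real (a + b + a * b * col_sq n u) * (u (i, n) * cnj (u (j, n)))"
    by (simp add: half_rot_def algebra_simps)
  also have "a + b + a * b * col_sq n u = 0"
  proof -
    have c: "col_sq n u = (q - 1) * (q + 1)" using q(2) by (simp add: algebra_simps)
    have bc: "b * col_sq n u = q - 1" unfolding b_def c using q(1) by simp
    have "q \<noteq> 0" "q + 1 \<noteq> 0" using q(1) by auto
    then have aq: "a * q = - b" unfolding a_def b_def by (simp add: divide_simps)
    have "a + b + a * b * col_sq n u = a + b + a * (q - 1)" by (simp only: mult.assoc bc)
    also have "\<dots> = a * q + b" by (simp add: algebra_simps)
    finally show ?thesis using aq by simp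
  qed
  finally show ?thesis by (simp add: a_def b_def)
qed

lemma nn_integral_unit_conj:
  assumes f: "f \<in> borel_measurable (cleb (sq_idx n))"
  shows "(\<integral>\<^sup>+B. f (unit_conj n u B) \<partial>cleb (sq_idx n)) = (\<integral>\<^sup>+B. f B \<partial>cleb (sq_idx n))"
  unfolding unit_conj_def Let_def by (rule nn_integral_conjugate[OF f half_rot_inverse])

lemma chi_unit_conj: "chi n (unit_conj n u B) = chi n B"
  unfolding unit_conj_def Let_def by (rule chi_conjugate[OF half_rot_inverse])

lemma measurable_unit_conj [measurable]: "unit_conj n u \<in> measurable (cleb (sq_idx n)) (cleb (sq_idx n))"
  unfolding unit_conj_def Let_def by measurable

text \<open>The trace of B (1 + u u^H) B^H (1 + u u^H)^-1, with the inverse written as 1 - u u^H /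
  (1 + |u|^2).\<close>

definition conj_energy :: "nat \<Rightarrow> entry_fun \<Rightarrow> entry_fun \<Rightarrow> real" where
  "conj_energy n u B = frob n B + (\<Sum>i<n. (cmod (\<Sum>k<n. B (i, k) * u (k, n)))\<^sup>2)
     - ((\<Sum>j<n. (cmod (\<Sum>i<n. B (i, j) * cnj (u (i, n))))\<^sup>2) + (cmod (\<Sum>i<n. \<Sum>k<n. B (i, k) * u (k, n) * cnj (u (i, n))))\<^sup>2) / (1 + col_sq n u)"

text \<open>Multiplying by \<open>half_rot\<close> on either side is a rank-one update, so each
  squared norm follows from \<open>sum_cmod_add_sq\<close>. Here \<open>v\<close>, \<open>t\<close>
  and \<open>\<beta>\<close> are B u, u^H B and u^H B u.\<close>

lemma frob_unit_conj: "frob n (unit_conj n u B) = conj_energy n u B"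
proof -
  define s where "s = col_sq n u"
  define q where "q = sqrt (1 + s)"
  have s0: "s \<ge> 0" by (simp add: s_def col_sq_nonneg)
  have q: "q \<ge> 1" "q * q = 1 + s" using s0 by (auto simp: q_def)
  define a where "a = - 1 / (q * (q + 1))"
  define b where "b = 1 / (q + 1)"
  define U where "U k = u (k, n)" for k
  define v where "v i = (\<Sum>k<n. B (i, k) * U k)" for i
  define t where "t j = (\<Sum>i<n. B (i, j) * cnj (U i))" for j
  define \<beta> where "\<beta> = (\<Sum>i<n. v i * cnj (U i))"
  define F where "F = frob n B"
  define V where "V = (\<Sum>i<n. (cmod (v i))\<^sup>2)"
  define T where "T = (\<Sum>j<n. (cmod (t j))\<^sup>2)"
  have sU: "(\<Sum>k<n. (cmod (U k))\<^sup>2) = s" by (simp add: s_def col_sq_def U_def)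
  define X where "X i j = B (i, j) + of_real a * U i * t j" for i j
  define xu where "xu i = (\<Sum>k<n. X i k * U k)" for i
  have X: "left_mult n {..<n} (half_rot n u a) B (i, j) = X i j" if "i < n" "j < n" for i j
  proof -
    have "left_mult n {..<n} (half_rot n u a) B (i, j) = (\<Sum>k<n. half_rot n u a i k * B (k, j))"
      using that by (simp add: left_mult_def)
    also have "\<dots> = (\<Sum>k<n. (if i = k then B (k, j) else 0) + of_real a * U i * (B (k, j) * cnj (U k)))"
      by (intro sum.cong) (auto simp: half_rot_def U_def algebra_simps)
    also have "\<dots> = X i j"
      unfolding sum.distrib sum_distrib_left[symmetric] using that by (simp add: X_def t_def)
    finally show ?thesis .
  qed
  have Y: "unit_conj n u B (i, j) = X i j + (of_real b * xu i) * cnj (U j)" if "i < n" "j < n" for i j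
  proof -
    have "unit_conj n u B (i, j) = (\<Sum>k<n. X i k * half_rot n u b k j)"
      using that X unfolding unit_conj_def Let_def right_mult_def a_def[unfolded q_def s_def, symmetric] b_def[unfolded q_def s_def, symmetric]
      by (auto intro!: sum.cong)
    also have "\<dots> = (\<Sum>k<n. (if k = j then X i k else 0) + (of_real b * (X i k * U k)) * cnj (U j))"
      by (intro sum.cong) (auto simp: half_rot_def U_def algebra_simps)
    also have "\<dots> = X i j + (of_real b * xu i) * cnj (U j)"
      unfolding sum.distrib sum_distrib_left[symmetric] sum_distrib_right[symmetric] using that by (simp add: xu_def)
    finally show ?thesis .
  qed
  \<comment> \<open>This identity and \<open>c2\<close> say that the two factors are square roots:
    (1 + a u u^H)^2 = 1 - u u^H / (1 + s) and (1 + b u u^H)^2 = 1 + u u^H.\<close>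
  have c1: "2 * a + a\<^sup>2 * s = - 1 / (1 + s)"
  proof -
    have c: "s = (q - 1) * (q + 1)" using q(2) by (simp add: algebra_simps)
    have qn: "q \<noteq> 0" "q + 1 \<noteq> 0" using q(1) by auto
    have as: "a * s = - (q - 1) / q" unfolding a_def c using qn by (simp add: divide_simps)
    have "2 * a + a\<^sup>2 * s = a * (2 + a * s)" by (simp add: power2_eq_square algebra_simps)
    also have "2 + a * s = (q + 1) / q" unfolding as using q(1) by (simp add: field_simps)
    also have "a * ((q + 1) / q) = - 1 / (q * q)" unfolding a_def using qn by (simp add: divide_simps)
    finally show ?thesis using q(2) by simp
  qed
  have c2: "2 * b + b\<^sup>2 * s = 1"
  proof -
    have c: "s = (q - 1) * (q + 1)" using q(2) by (simp add: algebra_simps)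
    have bs: "b * s = q - 1" unfolding b_def c using q(1) by simp
    have "2 * b + b\<^sup>2 * s = b * (2 + b * s)" by (simp add: power2_eq_square algebra_simps)
    also have "\<dots> = b * (q + 1)" by (simp add: bs)
    finally show ?thesis using q(1) by (simp add: b_def)
  qed
  have rowY: "(\<Sum>j<n. (cmod (unit_conj n u B (i, j)))\<^sup>2) = (\<Sum>j<n. (cmod (X i j))\<^sup>2) + (cmod (xu i))\<^sup>2" if "i < n" for i
  proof -
    have "(\<Sum>j<n. (cmod (unit_conj n u B (i, j)))\<^sup>2) = (\<Sum>j<n. (cmod (X i j + (of_real b * xu i) * cnj (U j)))\<^sup>2)"
      using Y that by simp
    also have "\<dots> = (\<Sum>j<n. (cmod (X i j))\<^sup>2) + (cmod (of_real b * xu i))\<^sup>2 * s + 2 * Re (cnj (of_real b * xu i) * xu i)"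
      unfolding sum_cmod_add_sq by (simp add: sU xu_def)
    also have "\<dots> = (\<Sum>j<n. (cmod (X i j))\<^sup>2) + (2 * b + b\<^sup>2 * s) * (cmod (xu i))\<^sup>2"
      by (simp only: norm_mult norm_of_real power_mult_distrib power2_abs cmod_power2) (simp add: power2_eq_square algebra_simps)
    finally show ?thesis by (simp add: c2)
  qed
  have "(\<Sum>i<n. \<Sum>j<n. (cmod (X i j))\<^sup>2) = (\<Sum>j<n. \<Sum>i<n. (cmod (B (i, j) + (of_real a * t j) * U i))\<^sup>2)"
    by (subst sum.swap) (simp add: X_def algebra_simps)
  also have "\<dots> = (\<Sum>j<n. (\<Sum>i<n. (cmod (B (i, j)))\<^sup>2) + (2 * a + a\<^sup>2 * s) * (cmod (t j))\<^sup>2)"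
  proof (intro sum.cong refl)
    fix j
    have "(\<Sum>i<n. (cmod (B (i, j) + (of_real a * t j) * U i))\<^sup>2) = (\<Sum>i<n. (cmod (B (i, j)))\<^sup>2) + (cmod (of_real a * t j))\<^sup>2 * s + 2 * Re (cnj (of_real a * t j) * t j)"
      unfolding sum_cmod_add_sq by (simp add: sU t_def)
    also have "\<dots> = (\<Sum>i<n. (cmod (B (i, j)))\<^sup>2) + (2 * a + a\<^sup>2 * s) * (cmod (t j))\<^sup>2"
      by (simp only: norm_mult norm_of_real power_mult_distrib power2_abs cmod_power2) (simp add: power2_eq_square algebra_simps)
    finally show "(\<Sum>i<n. (cmod (B (i, j) + (of_real a * t j) * U i))\<^sup>2) = (\<Sum>i<n. (cmod (B (i, j)))\<^sup>2) + (2 * a + a\<^sup>2 * s) * (cmod (t j))\<^sup>2" .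
  qed
  also have "\<dots> = F - T / (1 + s)"
  proof -
    have "F = (\<Sum>j<n. \<Sum>i<n. (cmod (B (i, j)))\<^sup>2)" unfolding F_def frob_def by (rule sum.swap)
    then show ?thesis unfolding c1 sum.distrib sum_distrib_left[symmetric] T_def by simp
  qed
  finally have sX: "(\<Sum>i<n. \<Sum>j<n. (cmod (X i j))\<^sup>2) = F - T / (1 + s)" .
  have tU: "(\<Sum>k<n. t k * U k) = \<beta>"
  proof -
    have "(\<Sum>k<n. t k * U k) = (\<Sum>k<n. \<Sum>i<n. B (i, k) * cnj (U i) * U k)" by (simp add: t_def sum_distrib_right)
    also have "\<dots> = (\<Sum>i<n. \<Sum>k<n. B (i, k) * cnj (U i) * U k)" by (rule sum.swap)
    also have "\<dots> = \<beta>" unfolding \<beta>_def v_def sum_distrib_right by (intro sum.cong) (auto simp: mult_ac)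
    finally show ?thesis .
  qed
  have xu: "xu i = v i + (of_real a * \<beta>) * U i" for i
  proof -
    have "xu i = (\<Sum>k<n. B (i, k) * U k + of_real a * U i * (t k * U k))"
      unfolding xu_def X_def by (intro sum.cong) (auto simp: algebra_simps)
    also have "\<dots> = v i + of_real a * U i * \<beta>"
      unfolding sum.distrib sum_distrib_left[symmetric] tU v_def ..
    finally show ?thesis by (simp only: mult_ac)
  qed
  have "(\<Sum>i<n. (cmod (xu i))\<^sup>2) = V + (cmod (of_real a * \<beta>))\<^sup>2 * s + 2 * Re (cnj (of_real a * \<beta>) * \<beta>)"
    unfolding xu sum_cmod_add_sq by (simp add: sU V_def \<beta>_def)
  also have "\<dots> = V + (2 * a + a\<^sup>2 * s) * (cmod \<beta>)\<^sup>2"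
    by (simp only: norm_mult norm_of_real power_mult_distrib power2_abs cmod_power2) (simp add: power2_eq_square algebra_simps)
  finally have sxu: "(\<Sum>i<n. (cmod (xu i))\<^sup>2) = V - (cmod \<beta>)\<^sup>2 / (1 + s)"
    by (simp add: c1)
  have "frob n (unit_conj n u B) = (\<Sum>i<n. (\<Sum>j<n. (cmod (X i j))\<^sup>2) + (cmod (xu i))\<^sup>2)"
    unfolding frob_def using rowY by simp
  also have "\<dots> = F + V - (T + (cmod \<beta>)\<^sup>2) / (1 + s)"
    by (simp add: sum.distrib sX sxu add_divide_distrib)
  also have "\<dots> = conj_energy n u B"
    unfolding conj_energy_def F_def V_def T_def s_def v_def t_def \<beta>_def U_def by (simp add: sum_distrib_right)
  finally show ?thesis .
qed

text \<open>Completing the square after all inner products have been named: s = |u|^2, W = |w|^2, F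
  = |B|^2, V = |B u|^2, T = |u^H B|^2, \<tau> = w u, \<beta> = u^H B u and \<omega> = w (u^H
  B)^H.\<close>

lemma deflation_energy_scalar:
  fixes F V W T s :: real and \<omega> \<tau> \<beta> z :: complex
  assumes s: "s \<ge> 0"
  shows "F + s * W + 2 * Re \<omega> + (V + (cmod (z - \<tau>))\<^sup>2 * s - 2 * Re (cnj (z - \<tau>) * \<beta>)) + W + (cmod (z - \<tau>))\<^sup>2
    = (cmod z)\<^sup>2 + (F + V - (T + (cmod \<beta>)\<^sup>2) / (1 + s))
      + (1 + s) * (W + (T + (cmod z)\<^sup>2 * s - 2 * Re (cnj z * \<beta>)) / (1 + s)\<^sup>2 + 2 * Re (\<omega> - cnj z * \<tau>) / (1 + s)
        + (cmod (\<tau> + (\<beta> - z * of_real s) / of_real (1 + s)))\<^sup>2)"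
proof -
  define k where "k = 1 + s"
  have k: "k > 0" "s = k - 1" using s by (auto simp: k_def)
  have "\<tau> + (\<beta> - z * of_real s) / of_real k = (of_real k * \<tau> + \<beta> - z * of_real s) / of_real k"
    using k by (simp add: field_simps)
  then have "(cmod (\<tau> + (\<beta> - z * of_real s) / of_real k))\<^sup>2 = (cmod (of_real k * \<tau> + \<beta> - z * of_real s))\<^sup>2 / k\<^sup>2"
    using k(1) by (simp add: norm_divide power_divide)
  moreover have "(cmod (of_real k * \<tau> + \<beta> - z * of_real s))\<^sup>2 =
      (k * Re \<tau> + Re \<beta> - Re z * s)\<^sup>2 + (k * Im \<tau> + Im \<beta> - Im z * s)\<^sup>2"
    by (simp add: cmod_power2)
  ultimately have e: "(cmod (\<tau> + (\<beta> - z * of_real s) / of_real k))\<^sup>2 =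
     ((k * Re \<tau> + Re \<beta> - Re z * s)\<^sup>2 + (k * Im \<tau> + Im \<beta> - Im z * s)\<^sup>2) / k\<^sup>2" by simp
  have e1: "(cmod (z - \<tau>))\<^sup>2 = (Re z - Re \<tau>)\<^sup>2 + (Im z - Im \<tau>)\<^sup>2" "(cmod z)\<^sup>2 = (Re z)\<^sup>2 + (Im z)\<^sup>2"
    "(cmod \<beta>)\<^sup>2 = (Re \<beta>)\<^sup>2 + (Im \<beta>)\<^sup>2"
    by (simp_all add: cmod_power2)
  have e2: "Re (cnj (z - \<tau>) * \<beta>) = (Re z - Re \<tau>) * Re \<beta> + (Im z - Im \<tau>) * Im \<beta>"
    "Re (cnj z * \<beta>) = Re z * Re \<beta> + Im z * Im \<beta>"
    "Re (\<omega> - cnj z * \<tau>) = Re \<omega> - (Re z * Re \<tau> + Im z * Im \<tau>)"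
    by (simp_all add: algebra_simps)
  show ?thesis
    unfolding k_def[symmetric] unfolding e unfolding e1 e2 unfolding k(2) using k(1)
    by (simp add: field_simps power2_eq_square)
qed

lemma frob_bordered:
  "frob (Suc n) (bordered n D c w a) = frob n D + (\<Sum>i<n. (cmod (c (i, n)))\<^sup>2) + (\<Sum>k<n. (cmod (w (n, k)))\<^sup>2) + (cmod a)\<^sup>2"
  by (simp add: frob_def bordered_def sum.distrib)

text \<open>Now \<open>w\<close> occurs only in a translated \<open>row_energy\<close>. Translating
  \<open>w\<close> and conjugating \<open>B\<close>, both measure preserving, will separate the
  variables.\<close>

lemma deflation_energy:
  "frob (Suc n) (deflated n (rank_one_shift n 1 B u w) u w z) =
    (cmod z)\<^sup>2 + conj_energy n u B + row_energy n u (\<lambda>p\<in>row_idx n. w p + row_shift n B u z p)"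
proof -
  define s where "s = col_sq n u"
  have s: "s \<ge> 0" by (simp add: s_def col_sq_nonneg)
  define U where "U k = u (k, n)" for k
  define x where "x k = w (n, k)" for k
  define v where "v i = (\<Sum>k<n. B (i, k) * U k)" for i
  define t where "t j = (\<Sum>i<n. B (i, j) * cnj (U i))" for j
  define \<beta> where "\<beta> = (\<Sum>i<n. v i * cnj (U i))"
  define \<tau> where "\<tau> = (\<Sum>k<n. x k * U k)"
  define \<omega> where "\<omega> = (\<Sum>k<n. x k * cnj (t k))"
  define F where "F = frob n B"
  define V where "V = (\<Sum>i<n. (cmod (v i))\<^sup>2)"
  define T where "T = (\<Sum>j<n. (cmod (t j))\<^sup>2)"
  define W where "W = (\<Sum>k<n. (cmod (x k))\<^sup>2)"
  have sU: "(\<Sum>k<n. (cmod (U k))\<^sup>2) = s" by (simp add: s_def col_sq_def U_def)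
  have UU: "(\<Sum>k<n. U k * cnj (U k)) = of_real s" unfolding sU[symmetric] of_real_sum complex_norm_square ..
  have tU: "(\<Sum>k<n. t k * U k) = \<beta>"
  proof -
    have "(\<Sum>k<n. t k * U k) = (\<Sum>k<n. \<Sum>i<n. B (i, k) * cnj (U i) * U k)" by (simp add: t_def sum_distrib_right)
    also have "\<dots> = (\<Sum>i<n. \<Sum>k<n. B (i, k) * cnj (U i) * U k)" by (rule sum.swap)
    also have "\<dots> = \<beta>" unfolding \<beta>_def v_def sum_distrib_right by (intro sum.cong) (auto simp: mult_ac)
    finally show ?thesis .
  qed
  have rc: "row_col n w u = \<tau>" by (simp add: row_col_def \<tau>_def x_def U_def)
  have fD: "frob n (rank_one_shift n 1 B u w) = F + s * W + 2 * Re \<omega>"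
  proof -
    have "frob n (rank_one_shift n 1 B u w) = (\<Sum>i<n. \<Sum>j<n. (cmod (B (i, j) + U i * x j))\<^sup>2)"
      unfolding frob_def by (intro sum.cong) (auto simp: rank_one_shift_def U_def x_def)
    also have "\<dots> = (\<Sum>i<n. (\<Sum>j<n. (cmod (B (i, j)))\<^sup>2) + (cmod (U i))\<^sup>2 * W + 2 * Re (cnj (U i) * (\<Sum>j<n. B (i, j) * cnj (x j))))"
      unfolding sum_cmod_add_sq W_def ..
    also have "\<dots> = F + s * W + 2 * Re (\<Sum>i<n. cnj (U i) * (\<Sum>j<n. B (i, j) * cnj (x j)))"
      by (simp add: sum.distrib F_def frob_def sU[symmetric] sum_distrib_right[symmetric] sum_distrib_left[symmetric])
    also have "(\<Sum>i<n. cnj (U i) * (\<Sum>j<n. B (i, j) * cnj (x j))) = (\<Sum>i<n. \<Sum>j<n. B (i, j) * cnj (U i) * cnj (x j))"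
      by (simp add: sum_distrib_left mult_ac)
    also have "\<dots> = (\<Sum>j<n. \<Sum>i<n. B (i, j) * cnj (U i) * cnj (x j))" by (rule sum.swap)
    also have "\<dots> = cnj \<omega>" by (simp add: \<omega>_def t_def sum_distrib_left mult_ac)
    finally show ?thesis by simp
  qed
  have fc: "(\<Sum>i<n. (cmod (char_mult n (rank_one_shift n 1 B u w) z u (i, n)))\<^sup>2) = V + (cmod (z - \<tau>))\<^sup>2 * s - 2 * Re (cnj (z - \<tau>) * \<beta>)"
  proof -
    have c: "char_mult n (rank_one_shift n 1 B u w) z u (i, n) = - v i + (z - \<tau>) * U i" if "i < n" for i
    proof -
      have "char_mult n (rank_one_shift n 1 B u w) z u (i, n) = (\<Sum>k<n. ((if i = k then z else 0) - (B (i, k) + U i * x k)) * U k)"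
        using that by (simp add: char_mult_def left_mult_def rank_one_shift_def U_def x_def)
      also have "\<dots> = (\<Sum>k<n. (if i = k then z * U k else 0) - B (i, k) * U k - U i * (x k * U k))"
        by (intro sum.cong) (auto simp: algebra_simps)
      also have "\<dots> = z * U i - v i - U i * \<tau>"
        unfolding sum_subtractf sum_distrib_left[symmetric] using that by (simp add: v_def \<tau>_def)
      finally show ?thesis by (simp add: algebra_simps)
    qed
    have "(\<Sum>i<n. (cmod (char_mult n (rank_one_shift n 1 B u w) z u (i, n)))\<^sup>2) = (\<Sum>i<n. (cmod (- v i + (z - \<tau>) * U i))\<^sup>2)"
      using c by simp
    also have "\<dots> = V + (cmod (z - \<tau>))\<^sup>2 * s + 2 * Re (cnj (z - \<tau>) * (- \<beta>))"
      unfolding sum_cmod_add_sq sU by (simp add: V_def \<beta>_def sum_negf)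
    finally show ?thesis by simp
  qed
  have LHS: "frob (Suc n) (deflated n (rank_one_shift n 1 B u w) u w z) =
     F + s * W + 2 * Re \<omega> + (V + (cmod (z - \<tau>))\<^sup>2 * s - 2 * Re (cnj (z - \<tau>) * \<beta>)) + W + (cmod (z - \<tau>))\<^sup>2"
    unfolding deflated_def frob_bordered fD fc rc by (simp add: W_def x_def)
  define y where "y = (\<lambda>p\<in>row_idx n. w p + row_shift n B u z p)"
  have y: "y (n, k) = x k + of_real (1 / (1 + s)) * (t k - z * cnj (U k))" if "k < n" for k
    using that by (simp add: y_def row_shift_def x_def t_def U_def s_def)
  have sy: "(\<Sum>k<n. (cmod (y (n, k)))\<^sup>2) = W + (T + (cmod z)\<^sup>2 * s - 2 * Re (cnj z * \<beta>)) / (1 + s)\<^sup>2 + 2 * Re (\<omega> - cnj z * \<tau>) / (1 + s)"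
  proof -
    have 1: "(\<Sum>k<n. (cmod (t k - z * cnj (U k)))\<^sup>2) = T + (cmod z)\<^sup>2 * s - 2 * Re (cnj z * \<beta>)"
    proof -
      have "(\<Sum>k<n. (cmod (t k - z * cnj (U k)))\<^sup>2) = (\<Sum>k<n. (cmod (t k + (- z) * cnj (U k)))\<^sup>2)" by simp
      also have "\<dots> = T + (cmod z)\<^sup>2 * s + 2 * Re (cnj (- z) * \<beta>)"
        unfolding sum_cmod_add_sq by (simp add: T_def sU tU)
      finally show ?thesis by simp
    qed
    have 2: "(\<Sum>k<n. x k * cnj (t k - z * cnj (U k))) = \<omega> - cnj z * \<tau>"
      by (simp add: \<omega>_def \<tau>_def right_diff_distrib sum_subtractf sum_distrib_left mult_ac)
    have "(\<Sum>k<n. (cmod (y (n, k)))\<^sup>2) = (\<Sum>k<n. (cmod (x k + of_real (1 / (1 + s)) * (t k - z * cnj (U k))))\<^sup>2)"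
      using y by simp
    also have "\<dots> = W + (cmod (of_real (1 / (1 + s))))\<^sup>2 * (T + (cmod z)\<^sup>2 * s - 2 * Re (cnj z * \<beta>)) + 2 * Re (cnj (of_real (1 / (1 + s))) * (\<omega> - cnj z * \<tau>))"
      unfolding sum_cmod_add_sq 1 2 W_def ..
    also have "(cmod (of_real (1 / (1 + s))))\<^sup>2 = 1 / (1 + s)\<^sup>2"
      by (simp only: norm_of_real power2_abs power_divide power_one)
    also have "Re (cnj (of_real (1 / (1 + s))) * (\<omega> - cnj z * \<tau>)) = Re (\<omega> - cnj z * \<tau>) / (1 + s)"
      by (simp only: complex_cnj_complex_of_real scaleR_conv_of_real[symmetric] scaleR_complex.sel) simp
    finally show ?thesis by simp
  qed
  have yu: "row_col n y u = \<tau> + (\<beta> - z * of_real s) / of_real (1 + s)"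
  proof -
    have "row_col n y u = (\<Sum>k<n. x k * U k + of_real (1 / (1 + s)) * (t k * U k - z * (U k * cnj (U k))))"
      unfolding row_col_def
    proof (intro sum.cong refl)
      fix k assume "k \<in> {..<n}"
      then have k: "k < n" by simp
      show "y (n, k) * u (k, n) = x k * U k + of_real (1 / (1 + s)) * (t k * U k - z * (U k * cnj (U k)))"
        unfolding y[OF k] U_def[symmetric] by (simp only: algebra_simps)
    qed
    also have "\<dots> = \<tau> + of_real (1 / (1 + s)) * (\<beta> - z * of_real s)"
      unfolding sum.distrib sum_distrib_left[symmetric] sum_subtractf tU UU by (simp add: \<tau>_def)
    finally show ?thesis by simp
  qed
  have "conj_energy n u B = F + V - (T + (cmod \<beta>)\<^sup>2) / (1 + s)"
    unfolding conj_energy_def F_def V_def T_def s_def v_def t_def \<beta>_def U_def by (simp add: sum_distrib_right)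
  moreover have "row_energy n u y = (1 + s) * (W + (T + (cmod z)\<^sup>2 * s - 2 * Re (cnj z * \<beta>)) / (1 + s)\<^sup>2 + 2 * Re (\<omega> - cnj z * \<tau>) / (1 + s)
        + (cmod (\<tau> + (\<beta> - z * of_real s) / of_real (1 + s)))\<^sup>2)"
    unfolding row_energy_def sy yu s_def ..
  ultimately show ?thesis
    unfolding LHS y_def[symmetric] using deflation_energy_scalar[OF s] by simp
qed

lemma borel_measurable_frob:
  assumes "A \<in> measurable M (cleb (sq_idx n))"
  shows "(\<lambda>x. frob n (A x)) \<in> borel_measurable M"
  unfolding frob_def
  using borel_measurable_cleb_component[OF assms]
  by (intro borel_measurable_sum borel_measurable_power borel_measurable_cmod) auto

lemma borel_measurable_row_energy:
  assumes "u \<in> measurable M (cleb (col_idx n))" "w \<in> measurable M (cleb (row_idx n))"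
  shows "(\<lambda>x. row_energy n (u x) (w x)) \<in> borel_measurable M"
  unfolding row_energy_def col_sq_def
  using borel_measurable_cleb_component[OF assms(1)] borel_measurable_cleb_component[OF assms(2)] borel_measurable_row_col[OF assms(2,1)]
  by (intro borel_measurable_times borel_measurable_add borel_measurable_const borel_measurable_sum borel_measurable_power borel_measurable_cmod) auto

text \<open>The Gaussian mass of the eigenvector and row variables. Its value is never computed: it
  ends up in a constant that normalisation fixes.\<close>

definition gauss_const :: "nat \<Rightarrow> ennreal" where
  "gauss_const n = (\<integral>\<^sup>+u. \<integral>\<^sup>+w. ennreal (exp (- row_energy n u w)) \<partial>cleb (row_idx n) \<partial>cleb (col_idx n))"

text \<open>After translating \<open>w\<close> the row integral depends on \<open>u\<close> alone.
  Conjugating \<open>B\<close> leaves its characteristic polynomial, hence \<open>g\<close>,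
  unchanged, and afterwards the \<open>B\<close> integral no longer depends on
  \<open>u\<close>.\<close>

theorem nn_integral_Gaussian_deflation:
  fixes g :: "complex poly \<Rightarrow> ennreal"
  assumes g1: "(\<lambda>A. g (chi (Suc n) A)) \<in> borel_measurable (cleb (sq_idx (Suc n)))"
    and g2: "(\<lambda>(z, B). g ([:- z, 1:] * chi n B)) \<in> borel_measurable ((lborel :: complex measure) \<Otimes>\<^sub>M cleb (sq_idx n))"
  shows "of_nat (Suc n) * (\<integral>\<^sup>+A. g (chi (Suc n) A) * ennreal (exp (- frob (Suc n) A)) \<partial>cleb (sq_idx (Suc n))) =
    gauss_const n * (\<integral>\<^sup>+z. ennreal (exp (- (cmod z)\<^sup>2)) *
       (\<integral>\<^sup>+B. g ([:- z, 1:] * chi n B) * ennreal ((cmod (poly (chi n B) z))\<^sup>2) * ennreal (exp (- frob n B)) \<partial>cleb (sq_idx n)) \<partial>lborel)"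
proof -
  let ?S = "cleb (sq_idx n)" and ?W = "cleb (row_idx n)" and ?C = "cleb (col_idx n)"
  define e where "e = (\<lambda>w z u B. ennreal (exp (- row_energy n u (\<lambda>p\<in>row_idx n. w p + row_shift n B u z p))))"
  define k where "k z B = g ([:- z, 1:] * chi n B) * ennreal ((cmod (poly (chi n B) z))\<^sup>2)" for z B
  define b where "b z u B = k z B * ennreal (exp (- (cmod z)\<^sup>2)) * ennreal (exp (- frob n (unit_conj n u B)))" for z u B
  have split: "g (chi (Suc n) (deflated n (rank_one_shift n 1 B u w) u w z)) *
       ennreal (exp (- frob (Suc n) (deflated n (rank_one_shift n 1 B u w) u w z))) * ennreal ((cmod (poly (chi n B) z))\<^sup>2)
     = b z u B * e w z u B" for w z u B
    unfolding char_poly_deflated[OF refl] deflation_energy frob_unit_conj b_def e_def k_def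
    by (simp only: minus_add_distrib exp_add) (simp add: ennreal_mult mult_ac)
  have kM: "(\<lambda>x. k (z x) (B x)) \<in> borel_measurable N"
    if "z \<in> borel_measurable N" "B \<in> measurable N ?S" for N :: "'b measure" and z B
  proof -
    have "(\<lambda>x. (z x, B x)) \<in> measurable N (lborel \<Otimes>\<^sub>M ?S)" using that by simp
    from measurable_compose[OF this g2] have "(\<lambda>x. g ([:- z x, 1:] * chi n (B x))) \<in> borel_measurable N" by simp
    moreover have "(\<lambda>x. poly (chi n (B x)) (z x)) \<in> borel_measurable N"
      using that by (intro borel_measurable_poly_chi)
    ultimately show ?thesis unfolding k_def by measurable
  qed
  have bM: "(\<lambda>x. b (z x) (u x) (B x)) \<in> borel_measurable N"
    if "z \<in> borel_measurable N" "u \<in> measurable N ?C" "B \<in> measurable N ?S" for N :: "'b measure" and z u B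
  proof -
    have 1: "(\<lambda>x. conj_energy n (u x) (B x)) \<in> borel_measurable N"
      unfolding conj_energy_def col_sq_def
      using borel_measurable_cleb_component[OF that(2)] borel_measurable_cleb_component[OF that(3)] borel_measurable_frob[OF that(3)]
      by (intro borel_measurable_diff borel_measurable_divide borel_measurable_add borel_measurable_const borel_measurable_sum
          borel_measurable_power borel_measurable_cmod borel_measurable_times)
        (auto intro!: measurable_compose[OF _ borel_measurable_continuous_onI[of cnj]] continuous_intros)
    show ?thesis unfolding b_def frob_unit_conj using kM[OF that(1,3)] 1 that(1) by measurable
  qed
  have shM: "(\<lambda>x. \<lambda>p\<in>row_idx n. w x p + row_shift n (B x) (u x) (z x) p) \<in> measurable N ?W"
    if "w \<in> measurable N ?W" "z \<in> borel_measurable N" "u \<in> measurable N ?C" "B \<in> measurable N ?S" for N :: "'b measure" and w z u B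
  proof (rule measurable_restrict, unfold measurable_lborel1)
    fix p assume p: "p \<in> row_idx n"
    show "(\<lambda>x. w x p + row_shift n (B x) (u x) (z x) p) \<in> borel_measurable N"
      unfolding row_shift_def col_sq_def
      using p borel_measurable_cleb_component[OF that(1)] borel_measurable_cleb_component[OF that(3)]
        borel_measurable_cleb_component[OF that(4)] that(2)
      by (intro borel_measurable_diff borel_measurable_divide borel_measurable_add borel_measurable_const borel_measurable_sum
          borel_measurable_power borel_measurable_cmod borel_measurable_times borel_measurable_of_real)
        (auto intro!: measurable_compose[OF _ borel_measurable_continuous_onI[of cnj]] continuous_intros)
  qed
  have X: "(\<lambda>x. b (z x) (u x) (B x) * e (w x) (z x) (u x) (B x)) \<in> borel_measurable N"
    if "w \<in> measurable N ?W" "z \<in> borel_measurable N" "u \<in> measurable N ?C" "B \<in> measurable N ?S" for N :: "'b measure" and w z u B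
    using bM[OF that(2,3,4)] borel_measurable_row_energy[OF that(3) shM[OF that]] unfolding e_def by measurable
  define \<kappa> where "\<kappa> u = (\<integral>\<^sup>+w. ennreal (exp (- row_energy n u w)) \<partial>?W)" for u
  have \<kappa>: "\<kappa> \<in> borel_measurable ?C"
    unfolding \<kappa>_def
    by (intro borel_measurable_nn_integral_cleb) (auto simp: case_prod_unfold intro!: measurable_compose[OF borel_measurable_row_energy[of snd]] intro: measurable_compose[OF borel_measurable_row_energy[of fst _ _ snd]])
  have f: "(\<lambda>A. g (chi (Suc n) A) * ennreal (exp (- frob (Suc n) A))) \<in> borel_measurable (cleb (sq_idx (Suc n)))"
    using g1 borel_measurable_frob[of "\<lambda>x. x" "cleb (sq_idx (Suc n))" "Suc n"] by simp
  have inner: "(\<integral>\<^sup>+w. b z u B * e w z u B \<partial>?W) = b z u B * \<kappa> u" if u: "u \<in> space ?C" for z u B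
  proof -
    define h where "h w = ennreal (exp (- row_energy n u w))" for w
    have h: "h \<in> borel_measurable ?W"
      unfolding h_def using borel_measurable_row_energy[of "\<lambda>_. u" ?W n "\<lambda>x. x"] u by simp
    have sh: "(\<lambda>w. \<lambda>p\<in>row_idx n. w p + row_shift n B u z p) \<in> measurable ?W ?W"
      by (intro measurable_restrict) simp
    have "(\<integral>\<^sup>+w. b z u B * e w z u B \<partial>?W) = b z u B * (\<integral>\<^sup>+w. e w z u B \<partial>?W)"
      using measurable_compose[OF sh h] by (intro nn_integral_cmult) (simp add: e_def h_def)
    also have "(\<integral>\<^sup>+w. e w z u B \<partial>?W) = \<kappa> u"
      using nn_integral_cleb_affine[of 1 "row_idx n" h "row_shift n B u z"] h by (simp add: e_def h_def \<kappa>_def)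
    finally show ?thesis .
  qed
  have "of_nat (Suc n) * (\<integral>\<^sup>+A. g (chi (Suc n) A) * ennreal (exp (- frob (Suc n) A)) \<partial>cleb (sq_idx (Suc n)))
     = (\<integral>\<^sup>+w. \<integral>\<^sup>+z. \<integral>\<^sup>+u. \<integral>\<^sup>+B. b z u B * e w z u B \<partial>?S \<partial>?C \<partial>lborel \<partial>?W)"
    unfolding nn_integral_deflation[OF f] split ..
  also have "\<dots> = (\<integral>\<^sup>+z. \<integral>\<^sup>+w. \<integral>\<^sup>+u. \<integral>\<^sup>+B. b z u B * e w z u B \<partial>?S \<partial>?C \<partial>?W \<partial>lborel)"
    by (rule nn_integral_swap_cleb_lborel) (auto simp: case_prod_unfold intro!: borel_measurable_nn_integral_cleb X)
  also have "\<dots> = (\<integral>\<^sup>+z. ennreal (exp (- (cmod z)\<^sup>2)) * (\<integral>\<^sup>+B. k z B * ennreal (exp (- frob n B)) \<partial>?S) * gauss_const n \<partial>lborel)"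
  proof (rule nn_integral_cong)
    fix z :: complex
    define I where "I = ennreal (exp (- (cmod z)\<^sup>2)) * (\<integral>\<^sup>+B. k z B * ennreal (exp (- frob n B)) \<partial>?S)"
    have "(\<integral>\<^sup>+w. \<integral>\<^sup>+u. \<integral>\<^sup>+B. b z u B * e w z u B \<partial>?S \<partial>?C \<partial>?W) = (\<integral>\<^sup>+u. \<integral>\<^sup>+w. \<integral>\<^sup>+B. b z u B * e w z u B \<partial>?S \<partial>?W \<partial>?C)"
      by (rule nn_integral_swap_cleb) (auto simp: case_prod_unfold intro!: borel_measurable_nn_integral_cleb X)
    also have "\<dots> = (\<integral>\<^sup>+u. I * \<kappa> u \<partial>?C)"
    proof (rule nn_integral_cong)
      fix u assume u: "u \<in> space ?C"
      have "(\<integral>\<^sup>+w. \<integral>\<^sup>+B. b z u B * e w z u B \<partial>?S \<partial>?W) = (\<integral>\<^sup>+B. \<integral>\<^sup>+w. b z u B * e w z u B \<partial>?W \<partial>?S)"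
        by (rule nn_integral_swap_cleb) (auto simp: case_prod_unfold u intro!: X)
      also have "\<dots> = (\<integral>\<^sup>+B. b z u B * \<kappa> u \<partial>?S)"
        by (simp add: inner[OF u])
      also have "\<dots> = (\<integral>\<^sup>+B. b z u B \<partial>?S) * \<kappa> u"
        by (rule nn_integral_multc) (intro bM, auto simp: u)
      also have "(\<integral>\<^sup>+B. b z u B \<partial>?S) = (\<integral>\<^sup>+B. ennreal (exp (- (cmod z)\<^sup>2)) * (k z (unit_conj n u B) * ennreal (exp (- frob n (unit_conj n u B)))) \<partial>?S)"
        unfolding b_def k_def chi_unit_conj by (simp add: mult_ac)
      also have "\<dots> = (\<integral>\<^sup>+B. ennreal (exp (- (cmod z)\<^sup>2)) * (k z B * ennreal (exp (- frob n B))) \<partial>?S)"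
      proof (rule nn_integral_unit_conj)
        show "(\<lambda>B. ennreal (exp (- (cmod z)\<^sup>2)) * (k z B * ennreal (exp (- frob n B)))) \<in> borel_measurable ?S"
          using kM[of "\<lambda>_. z" ?S "\<lambda>x. x"] borel_measurable_frob[of "\<lambda>x. x" ?S n] by simp
      qed
      also have "\<dots> = I"
        unfolding I_def using kM[of "\<lambda>_. z" ?S "\<lambda>x. x"] borel_measurable_frob[of "\<lambda>x. x" ?S n]
        by (intro nn_integral_cmult) simp
      finally show "(\<integral>\<^sup>+w. \<integral>\<^sup>+B. b z u B * e w z u B \<partial>?S \<partial>?W) = I * \<kappa> u" .
    qed
    also have "\<dots> = I * gauss_const n"
      unfolding gauss_const_def \<kappa>_def[symmetric] by (rule nn_integral_cmult[OF \<kappa>])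
    finally show "(\<integral>\<^sup>+w. \<integral>\<^sup>+u. \<integral>\<^sup>+B. b z u B * e w z u B \<partial>?S \<partial>?C \<partial>?W) =
      ennreal (exp (- (cmod z)\<^sup>2)) * (\<integral>\<^sup>+B. k z B * ennreal (exp (- frob n B)) \<partial>?S) * gauss_const n"
      by (simp only: I_def)
  qed
  also have "\<dots> = gauss_const n * (\<integral>\<^sup>+z. ennreal (exp (- (cmod z)\<^sup>2)) * (\<integral>\<^sup>+B. k z B * ennreal (exp (- frob n B)) \<partial>?S) \<partial>lborel)"
  proof -
    have "(\<lambda>z. \<integral>\<^sup>+B. k z B * ennreal (exp (- frob n B)) \<partial>?S) \<in> borel_measurable lborel"
    proof (intro borel_measurable_nn_integral_cleb)
      have "(\<lambda>p. k (fst p) (snd p)) \<in> borel_measurable ((lborel :: complex measure) \<Otimes>\<^sub>M ?S)" by (intro kM) auto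
      moreover have "(\<lambda>p. frob n (snd p)) \<in> borel_measurable ((lborel :: complex measure) \<Otimes>\<^sub>M ?S)" by (intro borel_measurable_frob) auto
      ultimately show "(\<lambda>(z, B). k z B * ennreal (exp (- frob n B))) \<in> borel_measurable ((lborel :: complex measure) \<Otimes>\<^sub>M ?S)"
        unfolding case_prod_unfold by measurable
    qed simp
    then have m: "(\<lambda>z. ennreal (exp (- (cmod z)\<^sup>2)) * (\<integral>\<^sup>+B. k z B * ennreal (exp (- frob n B)) \<partial>?S)) \<in> borel_measurable lborel"
      by (intro borel_measurable_times_ennreal) simp_all
    have "(\<integral>\<^sup>+z. ennreal (exp (- (cmod z)\<^sup>2)) * (\<integral>\<^sup>+B. k z B * ennreal (exp (- frob n B)) \<partial>?S) * gauss_const n \<partial>lborel) =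
      (\<integral>\<^sup>+z. ennreal (exp (- (cmod z)\<^sup>2)) * (\<integral>\<^sup>+B. k z B * ennreal (exp (- frob n B)) \<partial>?S) \<partial>lborel) * gauss_const n"
      by (rule nn_integral_multc[OF m])
    then show ?thesis by (simp add: mult.commute)
  qed
  finally show ?thesis by (simp only: k_def)
qed

section \<open>The squared Vandermonde determinant\<close>

definition vandermonde :: "nat \<Rightarrow> (nat \<Rightarrow> complex) \<Rightarrow> complex" where
  "vandermonde n x = (\<Prod>j<n. \<Prod>i<j. x j - x i)"

text \<open>Multiplying the matrix of powers by the unitriangular coefficient matrix of the Newton
  polynomials \<open>p j\<close> evaluates these at the nodes; the result is lower triangular
  because \<open>p j\<close> vanishes at \<open>x i\<close> for i < j.\<close>

lemma vandermonde_det: "vandermonde n x = Determinant.det (mat n n (\<lambda>(i, j). x i ^ j))"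
proof -
  define p where "p j = (\<Prod>i<j. [:- x i, 1:])" for j
  have deg: "degree (p j) = j" "coeff (p j) j = 1" for j
  proof -
    have "degree (p j) = j \<and> coeff (p j) j = 1"
    proof (induction j)
      case (Suc j)
      have "p (Suc j) = [:- x j, 1:] * p j" by (simp add: p_def mult.commute)
      moreover have "p j \<noteq> 0" using Suc by auto
      ultimately show ?case using Suc by (auto simp: coeff_eq_0 degree_mult_eq simp del: mult_pCons_left) (simp add: coeff_eq_0)
    qed (simp add: p_def)
    then show "degree (p j) = j" "coeff (p j) j = 1" by auto
  qed
  define X where "X = mat n n (\<lambda>(i, j). x i ^ j)"
  define T where "T = mat n n (\<lambda>(k, j). coeff (p j) k)"
  define Y where "Y = mat n n (\<lambda>(i, j). poly (p j) (x i))"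
  have car: "X \<in> carrier_mat n n" "T \<in> carrier_mat n n" "Y \<in> carrier_mat n n" by (auto simp: X_def T_def Y_def)
  have "X * T = Y"
  proof (rule eq_matI)
    fix i j assume "i < dim_row Y" "j < dim_col Y"
    then have ij: "i < n" "j < n" by (auto simp: Y_def)
    have "(X * T) $$ (i, j) = (\<Sum>k<n. x i ^ k * coeff (p j) k)"
      using ij by (simp add: X_def T_def scalar_prod_def lessThan_atLeast0)
    also have "\<dots> = (\<Sum>k\<le>j. x i ^ k * coeff (p j) k)"
      using ij by (intro sum.mono_neutral_right) (auto simp: coeff_eq_0 deg)
    also have "\<dots> = poly (p j) (x i)"
      by (simp add: poly_altdef deg mult.commute)
    finally show "(X * T) $$ (i, j) = Y $$ (i, j)" using ij by (simp add: Y_def)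
  qed (auto simp: X_def T_def Y_def)
  then have "Determinant.det Y = Determinant.det X * Determinant.det T"
    using det_mult[OF car(1,2)] by simp
  also have "Determinant.det T = 1"
  proof -
    have "Determinant.det T = prod_list (diag_mat T)"
      by (rule det_upper_triangular[OF _ car(2)]) (auto simp: T_def upper_triangular_def coeff_eq_0 deg)
    also have "\<dots> = (\<Prod>i = 0..<n. T $$ (i, i))" using car(2) by (simp add: prod_list_diag_prod)
    also have "\<dots> = 1" by (intro prod.neutral) (auto simp: T_def deg)
    finally show ?thesis .
  qed
  also have "Determinant.det Y = vandermonde n x"
  proof -
    have "Determinant.det Y = prod_list (diag_mat Y)"
    proof (rule det_lower_triangular[OF _ car(3)])
      fix i j assume "i < j" "j < n"
      then show "Y $$ (i, j) = 0" by (auto simp: Y_def p_def poly_prod)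
    qed
    also have "\<dots> = (\<Prod>i = 0..<n. Y $$ (i, i))" using car(3) by (simp add: prod_list_diag_prod)
    also have "\<dots> = vandermonde n x"
      unfolding vandermonde_def by (simp add: Y_def p_def poly_prod lessThan_atLeast0)
    finally show ?thesis .
  qed
  finally show ?thesis by (simp add: X_def)
qed

lemma vandermonde_insert: "vandermonde (Suc n) (x(n := z)) = vandermonde n x * (\<Prod>i<n. z - x i)"
  unfolding vandermonde_def by (simp add: lessThan_Suc mult.commute cong: prod.cong_simp)

section \<open>Rotation-invariant integrals over the plane\<close>

lemma integral_complex_mult_unit:
  fixes f :: "complex \<Rightarrow> complex"
  assumes "cmod d = 1" and f [measurable]: "f \<in> borel_measurable borel"
  shows "(\<integral>z. f (d * z) \<partial>lborel) = (\<integral>z. f z \<partial>lborel)"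
proof -
  have d: "d \<noteq> 0" using assms by auto
  have "distr lborel borel ((*) d) = (lborel :: complex measure)"
  proof (rule measure_eqI)
    fix A assume "A \<in> sets (distr lborel borel ((*) d))"
    then have A [measurable]: "A \<in> sets borel" by simp
    have "emeasure (distr lborel borel ((*) d)) A = (\<integral>\<^sup>+z. indicator A z \<partial>distr lborel borel ((*) d))"
      by simp
    also have "\<dots> = (\<integral>\<^sup>+z. indicator A (d * z + 0) \<partial>lborel)"
      by (subst nn_integral_distr) auto
    also have "\<dots> = (\<integral>\<^sup>+z. indicator A z \<partial>lborel)"
      using nn_integral_complex_affine[OF d, of "indicator A" 0] assms(1) by simp
    finally show "emeasure (distr lborel borel ((*) d)) A = emeasure lborel A" by simp
  qed simp
  then have "(\<integral>z. f z \<partial>lborel) = (\<integral>z. f z \<partial>distr lborel borel ((*) d))" by simp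
  also have "\<dots> = (\<integral>z. f (d * z) \<partial>lborel)"
    by (rule integral_distr) auto
  finally show ?thesis by simp
qed

lemma integral_radial_monomial_zero:
  fixes w :: "complex \<Rightarrow> real"
  assumes radial: "\<And>d z. cmod d = 1 \<Longrightarrow> w (d * z) = w z" and w [measurable]: "w \<in> borel_measurable borel"
    and ab: "a \<noteq> b"
  shows "(\<integral>z. of_real (w z) * (z ^ a * cnj z ^ b) \<partial>lborel) = 0"
proof -
  \<comment> \<open>Chosen so that \<open>d ^ a * cnj d ^ b = cis pi\<close>: rotation by
    \<open>d\<close> then maps the integral to its negative.\<close>
  define d where "d = cis (pi / (real a - real b))"
  have "real a - real b \<noteq> 0" using ab by simp
  then have "(real a - real b) * (pi / (real a - real b)) = pi" by simp
  then have "real a * (pi / (real a - real b)) - real b * (pi / (real a - real b)) = pi"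
    by (simp only: left_diff_distrib)
  moreover have "d ^ a * cnj d ^ b = cis (real a * (pi / (real a - real b)) - real b * (pi / (real a - real b)))"
    unfolding d_def by (simp add: Complex.DeMoivre cis_cnj cis_mult)
  ultimately have dab: "d ^ a * cnj d ^ b = -1" by simp
  have [measurable]: "cnj \<in> borel_measurable borel"
    by (intro borel_measurable_continuous_onI continuous_intros)
  have d: "cmod d = 1" by (simp add: d_def)
  let ?f = "\<lambda>z. of_real (w z) * (z ^ a * cnj z ^ b) :: complex"
  have "(\<integral>z. ?f z \<partial>lborel) = (\<integral>z. ?f (d * z) \<partial>lborel)"
    by (rule integral_complex_mult_unit[OF d, symmetric]) measurable
  also have "\<dots> = (\<integral>z. (d ^ a * cnj d ^ b) * ?f z \<partial>lborel)"
    by (intro Bochner_Integration.integral_cong refl)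
      (simp only: radial[OF d] power_mult_distrib complex_cnj_mult, simp only: mult_ac)
  also have "\<dots> = - (\<integral>z. ?f z \<partial>lborel)"
    unfolding dab by simp
  finally show ?thesis by simp
qed

text \<open>Leibniz expansion of both determinants; by rotation invariance only the diagonal terms survive.\<close>

lemma nn_integral_vandermonde:
  fixes w :: "complex \<Rightarrow> real"
  assumes radial: "\<And>d z. cmod d = 1 \<Longrightarrow> w (d * z) = w z" and w [measurable]: "w \<in> borel_measurable borel"
    and nonneg: "\<And>z. 0 \<le> w z" and int: "\<And>k. integrable lborel (\<lambda>z. w z * cmod z ^ k)"
  shows "(\<integral>\<^sup>+x. ennreal ((\<Prod>i<n. w (x i)) * (cmod (vandermonde n x))\<^sup>2) \<partial>cleb {..<n})
    = fact n * (\<Prod>k<n. \<integral>\<^sup>+z. ennreal (w z * cmod z ^ (2 * k)) \<partial>lborel)"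
proof -
  define h where "h a b = (\<integral>z. of_real (w z) * (z ^ a * cnj z ^ b) \<partial>lborel)" for a b :: nat
  define H where "H k = (\<integral>z. w z * cmod z ^ (2 * k) \<partial>lborel)" for k :: nat
  have [measurable]: "cnj \<in> borel_measurable borel"
    by (intro borel_measurable_continuous_onI continuous_intros)
  have hint: "integrable lborel (\<lambda>z. of_real (w z) * (z ^ a * cnj z ^ b))" for a b :: nat
  proof (rule Bochner_Integration.integrable_bound[OF int[of "a + b"]])
    show "AE z in lborel. norm (of_real (w z) * (z ^ a * cnj z ^ b)) \<le> norm (w z * cmod z ^ (a + b))"
      using nonneg by (auto simp: norm_mult norm_power power_add)
  qed measurable
  have hk: "h k k = of_real (H k)" for k
  proof -
    have "z ^ k * cnj z ^ k = of_real (cmod z ^ (2 * k))" for z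
      by (simp only: power_mult_distrib[symmetric] complex_norm_square[symmetric] power_mult of_real_power)
    then have "h k k = (\<integral>z. complex_of_real (w z * cmod z ^ (2 * k)) \<partial>lborel)"
      unfolding h_def by (simp only: of_real_mult)
    then show ?thesis unfolding H_def by (simp only: integral_complex_of_real)
  qed
  have h0: "h a b = 0" if "a \<noteq> b" for a b
    unfolding h_def by (rule integral_radial_monomial_zero[OF radial w that])
  define P where "P = {p. p permutes {0..<n}}"
  have finP: "finite P" by (simp add: P_def finite_permutations)
  have cardP: "card P = fact n" by (simp add: P_def card_permutations[OF refl])
  have V: "vandermonde n x = (\<Sum>p\<in>P. signof p * (\<Prod>i<n. x i ^ p i))" for x
    unfolding vandermonde_det P_def
    by (subst det_def'[of _ n]) (auto simp: lessThan_atLeast0 permutes_in_image intro!: sum.cong prod.cong)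
  have exp: "complex_of_real ((\<Prod>i<n. w (x i)) * (cmod (vandermonde n x))\<^sup>2) =
     (\<Sum>p\<in>P. \<Sum>q\<in>P. signof p * signof q * (\<Prod>i<n. of_real (w (x i)) * (x i ^ p i * cnj (x i) ^ q i)))" for x
  proof -
    have cs: "cnj (signof q) = (signof q :: complex)" for q :: "nat \<Rightarrow> nat"
      by (cases q rule: sign_cases) auto
    have "complex_of_real ((\<Prod>i<n. w (x i)) * (cmod (vandermonde n x))\<^sup>2) = (\<Prod>i<n. of_real (w (x i))) * (vandermonde n x * cnj (vandermonde n x))"
      by (simp add: complex_norm_square[symmetric])
    also have "\<dots> = (\<Sum>p\<in>P. \<Sum>q\<in>P. (\<Prod>i<n. of_real (w (x i))) * ((signof p * (\<Prod>i<n. x i ^ p i)) * (signof q * (\<Prod>i<n. cnj (x i) ^ q i))))"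
    proof -
      have cV: "cnj (\<Sum>p\<in>P. signof p * (\<Prod>i<n. x i ^ p i)) = (\<Sum>p\<in>P. signof p * (\<Prod>i<n. cnj (x i) ^ p i))"
        by (simp only: cnj_sum complex_cnj_mult cs cnj_prod complex_cnj_power)
      show ?thesis unfolding V cV by (simp only: sum_product, simp only: sum_distrib_left)
    qed
    finally show ?thesis by (simp add: prod.distrib mult_ac)
  qed
  have pint: "integrable (cleb {..<n}) (\<lambda>x. \<Prod>i<n. of_real (w (x i)) * (x i ^ p i * cnj (x i) ^ q i))" for p q :: "nat \<Rightarrow> nat"
    by (rule cprod.product_integrable_prod) (auto intro: hint)
  have pval: "(\<integral>x. (\<Prod>i<n. of_real (w (x i)) * (x i ^ p i * cnj (x i) ^ q i)) \<partial>cleb {..<n}) = (\<Prod>i<n. h (p i) (q i))" for p q :: "nat \<Rightarrow> nat"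
    unfolding h_def by (rule cprod.product_integral_prod) (auto intro: hint)
  have cint: "integrable (cleb {..<n}) (\<lambda>x. complex_of_real ((\<Prod>i<n. w (x i)) * (cmod (vandermonde n x))\<^sup>2))"
    unfolding exp by (intro Bochner_Integration.integrable_sum integrable_mult_right pint)
  then have rint: "integrable (cleb {..<n}) (\<lambda>x. (\<Prod>i<n. w (x i)) * (cmod (vandermonde n x))\<^sup>2)"
    by (simp only: complex_of_real_integrable_eq)
  have "complex_of_real (\<integral>x. (\<Prod>i<n. w (x i)) * (cmod (vandermonde n x))\<^sup>2 \<partial>cleb {..<n}) =
     (\<integral>x. complex_of_real ((\<Prod>i<n. w (x i)) * (cmod (vandermonde n x))\<^sup>2) \<partial>cleb {..<n})"
    by (rule integral_complex_of_real[symmetric])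
  also have "\<dots> = (\<Sum>p\<in>P. \<Sum>q\<in>P. signof p * signof q * (\<Prod>i<n. h (p i) (q i)))"
  proof -
    let ?T = "\<lambda>p q x. signof p * signof q * (\<Prod>i<n. of_real (w (x i)) * (x i ^ p i * cnj (x i) ^ q i)) :: complex"
    have "(\<integral>x. (\<Sum>p\<in>P. \<Sum>q\<in>P. ?T p q x) \<partial>cleb {..<n}) = (\<Sum>p\<in>P. \<integral>x. (\<Sum>q\<in>P. ?T p q x) \<partial>cleb {..<n})"
      by (intro Bochner_Integration.integral_sum Bochner_Integration.integrable_sum integrable_mult_right pint)
    also have "\<dots> = (\<Sum>p\<in>P. \<Sum>q\<in>P. \<integral>x. ?T p q x \<partial>cleb {..<n})"
      by (intro sum.cong refl Bochner_Integration.integral_sum integrable_mult_right pint)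
    finally show ?thesis unfolding exp pval[symmetric] by (simp only: integral_mult_right_zero)
  qed
  also have "\<dots> = (\<Sum>p\<in>P. \<Sum>q\<in>P. if q = p then (\<Prod>k<n. of_real (H k)) else 0)"
  proof (intro sum.cong refl)
    fix p q assume p: "p \<in> P" and q: "q \<in> P"
    show "signof p * signof q * (\<Prod>i<n. h (p i) (q i)) = (if q = p then (\<Prod>k<n. of_real (H k)) else 0)"
    proof (cases "q = p")
      case True
      have "(\<Prod>i<n. h (p i) (p i)) = (\<Prod>i<n. of_real (H (p i)))" by (simp add: hk)
      also have "\<dots> = (\<Prod>k<n. of_real (H k))"
        using p by (intro prod.reindex_bij_betw[of p]) (auto simp: P_def lessThan_atLeast0 permutes_imp_bij)
      finally show ?thesis using True by (cases p rule: sign_cases) auto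
    next
      case False
      then obtain i where i: "p i \<noteq> q i" by (metis ext)
      have "i < n"
      proof (rule ccontr)
        assume "\<not> i < n"
        then have "p i = i" "q i = i" using p q permutes_not_in[of _ "{0..<n}" i] by (auto simp: P_def)
        with i show False by simp
      qed
      then have "(\<Prod>i<n. h (p i) (q i)) = 0" using h0[OF i] by (intro prod_zero) auto
      then show ?thesis using False by simp
    qed
  qed
  also have "\<dots> = (\<Sum>p\<in>P. (\<Prod>k<n. of_real (H k)))"
    using finP by (intro sum.cong refl) simp
  also have "\<dots> = of_real (fact n * (\<Prod>k<n. H k))"
    by (simp add: cardP)
  finally have val: "(\<integral>x. (\<Prod>i<n. w (x i)) * (cmod (vandermonde n x))\<^sup>2 \<partial>cleb {..<n}) = fact n * (\<Prod>k<n. H k)"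
    by (simp only: of_real_eq_iff)
  have H0: "0 \<le> H k" for k unfolding H_def using nonneg by (intro integral_nonneg_AE) auto
  have HN: "(\<integral>\<^sup>+z. ennreal (w z * cmod z ^ (2 * k)) \<partial>lborel) = ennreal (H k)" for k
    unfolding H_def using nonneg by (intro nn_integral_eq_integral int) auto
  have "(\<integral>\<^sup>+x. ennreal ((\<Prod>i<n. w (x i)) * (cmod (vandermonde n x))\<^sup>2) \<partial>cleb {..<n}) = ennreal (fact n * (\<Prod>k<n. H k))"
    unfolding val[symmetric] using nonneg by (intro nn_integral_eq_integral rint) (auto intro!: prod_nonneg mult_nonneg_nonneg)
  also have "\<dots> = ennreal (fact n) * ennreal (\<Prod>k<n. H k)"
    using H0 by (intro ennreal_mult prod_nonneg) auto
  also have "ennreal (fact n) = fact n"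
    by (metis ennreal_of_nat_eq_real_of_nat of_nat_fact)
  also have "ennreal (\<Prod>k<n. H k) = (\<Prod>k<n. ennreal (H k))"
    using H0 by (intro prod_ennreal[symmetric]) auto
  finally show ?thesis by (simp add: HN)
qed

text \<open>A disc of radius sqrt y has area pi y, so |z|^2 pushes area forward to pi times Lebesgue
  measure on the half-line.\<close>

lemma nn_integral_radial:
  assumes F [measurable]: "F \<in> borel_measurable borel"
  shows "(\<integral>\<^sup>+z. F ((cmod z)\<^sup>2) \<partial>lborel) = ennreal pi * (\<integral>\<^sup>+y. F y * indicator {0..} y \<partial>lborel)"
proof -
  \<comment> \<open>The sign is reversed because \<open>measure_eqI_lessThan\<close> compares upper
    half-lines of finite measure; with the minus sign their preimages are discs.\<close>
  define \<mu> where "\<mu> = distr (lborel :: complex measure) borel (\<lambda>z. - (cmod z)\<^sup>2)"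
  define \<nu> where "\<nu> = density lborel (\<lambda>y::real. ennreal pi * indicator {..0} y)"
  have \<mu>: "emeasure \<mu> {x<..} = ennreal (pi * max 0 (- x))" for x
  proof -
    have "(\<lambda>z. - (cmod z)\<^sup>2) -` {x<..} = (if x < 0 then ball 0 (sqrt (- x)) else {})"
    proof (cases "x < 0")
      case True
      have "- (cmod z)\<^sup>2 > x \<longleftrightarrow> cmod z < sqrt (- x)" for z
        using True real_less_rsqrt[of "cmod z" "- x"] real_sqrt_less_iff[of "(cmod z)\<^sup>2" "- x"] by auto
      then show ?thesis using True by auto
    next
      case False
      have "\<not> - (cmod z)\<^sup>2 > x" for z using False zero_le_power2[of "cmod z"] by linarith
      then show ?thesis using False by auto
    qed
    then have "emeasure \<mu> {x<..} = (if x < 0 then emeasure lborel (ball (0::complex) (sqrt (- x))) else 0)"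
      unfolding \<mu>_def by (subst emeasure_distr) auto
    also have "\<dots> = ennreal (pi * max 0 (- x))"
      by (auto simp: emeasure_ball unit_ball_vol_2 max_def)
    finally show ?thesis .
  qed
  have \<nu>: "emeasure \<nu> {x<..} = ennreal (pi * max 0 (- x))" for x
  proof -
    have "emeasure \<nu> {x<..} = (\<integral>\<^sup>+y. ennreal pi * indicator {x<..0} y \<partial>lborel)"
      unfolding \<nu>_def by (subst emeasure_density) (auto intro!: nn_integral_cong simp: indicator_def)
    also have "\<dots> = ennreal pi * emeasure lborel {x<..0}" by (simp add: nn_integral_cmult)
    also have "\<dots> = ennreal (pi * max 0 (- x))"
      by (cases "x \<le> 0") (auto simp: ennreal_mult[symmetric] max_def)
    finally show ?thesis .
  qed
  have "\<mu> = \<nu>"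
  proof (rule measure_eqI_lessThan)
    show "sets \<mu> = sets borel" "sets \<nu> = sets borel" by (simp_all add: \<mu>_def \<nu>_def)
    show "emeasure \<mu> {x<..} < \<infinity>" "emeasure \<mu> {x<..} = emeasure \<nu> {x<..}" for x
      unfolding \<mu> \<nu> by simp_all
  qed
  then have "(\<integral>\<^sup>+y. F (- y) \<partial>\<mu>) = (\<integral>\<^sup>+y. F (- y) \<partial>\<nu>)" by simp
  also have "(\<integral>\<^sup>+y. F (- y) \<partial>\<mu>) = (\<integral>\<^sup>+z. F ((cmod z)\<^sup>2) \<partial>lborel)"
    unfolding \<mu>_def by (subst nn_integral_distr) auto
  also have "(\<integral>\<^sup>+y. F (- y) \<partial>\<nu>) = (\<integral>\<^sup>+y. ennreal pi * (F (- y) * indicator {0..} (- y)) \<partial>lborel)"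
    unfolding \<nu>_def by (subst nn_integral_density) (auto intro!: nn_integral_cong simp: indicator_def)
  also have "\<dots> = ennreal pi * (\<integral>\<^sup>+y. F (- y) * indicator {0..} (- y) \<partial>lborel)"
    by (rule nn_integral_cmult) measurable
  also have "(\<integral>\<^sup>+y. F (- y) * indicator {0..} (- y) \<partial>lborel) = (\<integral>\<^sup>+y. F y * indicator {0..} y \<partial>lborel)"
    using nn_integral_real_affine[of "\<lambda>y. F y * indicator {0..} y" "-1" 0] by simp
  finally show ?thesis .
qed

section \<open>The eigenvalues of the induced Ginibre ensemble\<close>

definition eig_weight :: "complex set \<Rightarrow> real \<Rightarrow> complex \<Rightarrow> real" where
  "eig_weight C L z = indicator C z * (cmod z powr (2 * L))"

text \<open>For \<open>p\<close> the characteristic polynomial of \<open>A\<close> this is the indicator that the spectrum of \<open>A\<close> lies in \<open>C\<close>, times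
  \<open>|det A| powr (2 L)\<close> and the factors \<open>|det (y - A)|\<^sup>2\<close> left over from the eigenvalues \<open>y\<close> already split off.\<close>

definition poly_weight :: "complex set \<Rightarrow> real \<Rightarrow> complex list \<Rightarrow> complex poly \<Rightarrow> real" where
  "poly_weight C L ys p = (if \<forall>z. poly p z = 0 \<longrightarrow> z \<in> C then 1 else 0) * (cmod (poly p 0) powr (2 * L)) * (\<Prod>y\<leftarrow>ys. (cmod (poly p y))\<^sup>2)"

lemma poly_weight_nonneg: "0 \<le> poly_weight C L ys p"
  unfolding poly_weight_def by (intro mult_nonneg_nonneg prod_list_nonneg) auto

lemma eig_weight_nonneg: "0 \<le> eig_weight C L z"
  by (simp add: eig_weight_def)

lemma poly_weight_linear_factor:
  "poly_weight C L ys ([:- z, 1:] * p) = eig_weight C L z * (\<Prod>y\<leftarrow>ys. (cmod (y - z))\<^sup>2) * poly_weight C L ys p"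
proof -
  have ev: "poly ([:- z, 1:] * p) y = (y - z) * poly p y" for y
    by (simp only: poly_mult) simp
  have "(\<Prod>y\<leftarrow>ys. (cmod (poly ([:- z, 1:] * p) y))\<^sup>2) = (\<Prod>y\<leftarrow>ys. (cmod (y - z))\<^sup>2) * (\<Prod>y\<leftarrow>ys. (cmod (poly p y))\<^sup>2)"
    unfolding ev by (induction ys) (simp_all add: norm_mult power_mult_distrib mult_ac)
  moreover have "cmod (poly ([:- z, 1:] * p) 0) powr (2 * L) = cmod z powr (2 * L) * cmod (poly p 0) powr (2 * L)"
    unfolding ev by (simp add: norm_mult powr_mult)
  moreover have "(\<forall>x. poly ([:- z, 1:] * p) x = 0 \<longrightarrow> x \<in> C) \<longleftrightarrow> z \<in> C \<and> (\<forall>x. poly p x = 0 \<longrightarrow> x \<in> C)"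
    unfolding ev by auto
  ultimately show ?thesis
    unfolding poly_weight_def eig_weight_def by (cases "z \<in> C") (simp_all only: indicator_simps simp_thms if_True if_False mult_ac mult_1 mult_zero_left mult_zero_right)
qed

text \<open>The factor |chi_B(z)|^2 left by deflation is absorbed by adding \<open>z\<close> to the
  list. By \<open>poly_weight_linear_factor\<close> the entry then meets every later eigenvalue,
  which is how the Vandermonde product builds up.\<close>

lemma poly_weight_Cons:
  "poly_weight C L ys p * (cmod (poly p z))\<^sup>2 = poly_weight C L (z # ys) p"
  by (simp add: poly_weight_def)

text \<open>The complement of \<open>C\<close> is a countable union of compact sets, and a root in a
  compact set is a measurable event by \<open>closedin_ex_zero_measurable\<close>.\<close>

lemma roots_outside_measurable:
  assumes A: "A \<in> measurable M (cleb (sq_idx n))" and C: "closed C"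
  shows "{x \<in> space M. \<forall>z. poly (chi n (A x)) z = 0 \<longrightarrow> z \<in> C} \<in> sets M"
proof -
  obtain K :: "nat \<Rightarrow> complex set" where K: "\<And>i. compact (K i)" "(\<Union>i. K i) = - C"
    using open_Union_compact_subsets[of "- C"] C by (metis open_Compl)
  have "{x \<in> space M. \<exists>z\<in>K i. cmod (poly (chi n (A x)) z) = 0} \<in> sets M" for i
  proof (rule closedin_ex_zero_measurable[OF _ _ _ K(1)])
    show "(\<lambda>x. cmod (poly (chi n (A x)) z)) \<in> borel_measurable M" for z
      by (intro borel_measurable_cmod borel_measurable_poly_chi A) simp
    show "continuous_on UNIV (\<lambda>z. cmod (poly (chi n (A x)) z))" for x
      by (intro continuous_intros)
  qed simp
  then have "(\<Union>i. {x \<in> space M. \<exists>z\<in>K i. cmod (poly (chi n (A x)) z) = 0}) \<in> sets M"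
    by (intro sets.countable_UN) auto
  then have "space M - (\<Union>i. {x \<in> space M. \<exists>z\<in>K i. cmod (poly (chi n (A x)) z) = 0}) \<in> sets M" by simp
  also have "space M - (\<Union>i. {x \<in> space M. \<exists>z\<in>K i. cmod (poly (chi n (A x)) z) = 0}) =
    {x \<in> space M. \<forall>z. poly (chi n (A x)) z = 0 \<longrightarrow> z \<in> C}"
    using K(2) by (auto simp: set_eq_iff)
  finally show ?thesis .
qed

lemma borel_measurable_poly_weight:
  assumes A: "A \<in> measurable M (cleb (sq_idx n))" and C: "closed C"
  shows "(\<lambda>x. poly_weight C L ys (chi n (A x))) \<in> borel_measurable M"
proof -
  have 1: "(\<lambda>x. poly (chi n (A x)) y) \<in> borel_measurable M" for y
    by (intro borel_measurable_poly_chi A) simp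
  have 2: "(\<lambda>x. \<Prod>y\<leftarrow>ys. (cmod (poly (chi n (A x)) y))\<^sup>2) \<in> borel_measurable M"
  proof (induction ys)
    case (Cons y ys)
    then show ?case using 1[of y] by simp
  qed simp
  have 3: "Measurable.pred M (\<lambda>x. \<forall>z. poly (chi n (A x)) z = 0 \<longrightarrow> z \<in> C)"
    using roots_outside_measurable[OF A C] by (simp add: pred_def)
  show ?thesis unfolding poly_weight_def using 1[of 0] 2 3 by measurable
qed

lemma borel_measurable_eig_weight: "closed C \<Longrightarrow> eig_weight C L \<in> borel_measurable borel"
  unfolding eig_weight_def by measurable

text \<open>The constant does not depend on \<open>C\<close>: the case \<open>C = UNIV\<close> normalises all others.\<close>

theorem nn_integral_eigenvalues:
  "\<exists>K. \<forall>C ys. closed C \<longrightarrow>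
     (\<integral>\<^sup>+A. ennreal (poly_weight C L ys (chi n A) * exp (- frob n A)) \<partial>cleb (sq_idx n)) =
     K * (\<integral>\<^sup>+x. ennreal ((\<Prod>i<n. eig_weight C L (x i) * exp (- (cmod (x i))\<^sup>2) * (\<Prod>y\<leftarrow>ys. (cmod (y - x i))\<^sup>2)) *
        (cmod (vandermonde n x))\<^sup>2) \<partial>cleb {..<n})"
proof (induction n)
  case 0
  have "chi 0 A = 1" for A by (simp add: char_poly_def char_poly_matrix_def)
  moreover have "(\<Prod>y\<leftarrow>ys. 1) = (1 :: real)" for ys :: "complex list"
    by (induction ys) auto
  ultimately show ?case
    by (intro exI[of _ 1]) (simp add: PiM_empty nn_integral_count_space_finite frob_def vandermonde_def poly_weight_def o_def)
next
  case (Suc n)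
  then obtain K where K: "\<And>C ys. closed C \<Longrightarrow>
     (\<integral>\<^sup>+A. ennreal (poly_weight C L ys (chi n A) * exp (- frob n A)) \<partial>cleb (sq_idx n)) =
     K * (\<integral>\<^sup>+x. ennreal ((\<Prod>i<n. eig_weight C L (x i) * exp (- (cmod (x i))\<^sup>2) * (\<Prod>y\<leftarrow>ys. (cmod (y - x i))\<^sup>2)) *
        (cmod (vandermonde n x))\<^sup>2) \<partial>cleb {..<n})" by blast
  define c where "c = (of_nat (Suc n) :: ennreal)"
  have c: "c \<noteq> 0" "c \<noteq> \<infinity>" by (auto simp: c_def simp del: of_nat_Suc)
  show ?case
  \<comment> \<open>One deflation contributes \<open>gauss_const n\<close>, divided by the n + 1
    choices of the eigenvalue that is split off.\<close>
  proof (intro exI[of _ "gauss_const n * K / c"] allI impI)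
    fix C :: "complex set" and ys :: "complex list"
    assume C: "closed C"
    define W where "W ys z = eig_weight C L z * exp (- (cmod z)\<^sup>2) * (\<Prod>y\<leftarrow>ys. (cmod (y - z))\<^sup>2)" for ys z
    have W0: "0 \<le> W ys z" for ys z
      unfolding W_def by (intro mult_nonneg_nonneg prod_list_nonneg) (auto simp: eig_weight_nonneg)
    have WM: "(\<lambda>z. W ys z) \<in> borel_measurable borel" for ys
    proof -
      have "(\<lambda>z. \<Prod>y\<leftarrow>ys. (cmod (y - z))\<^sup>2) \<in> borel_measurable borel"
        by (induction ys) auto
      then show ?thesis unfolding W_def using borel_measurable_eig_weight[OF C, of L] by measurable
    qed
    have WC: "W (z # ys) x = W ys x * (cmod (z - x))\<^sup>2" for z x by (simp add: W_def)
    let ?g = "\<lambda>p. ennreal (poly_weight C L ys p)"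
    have "(\<integral>\<^sup>+A. ennreal (poly_weight C L ys (chi (Suc n) A) * exp (- frob (Suc n) A)) \<partial>cleb (sq_idx (Suc n))) * c =
      of_nat (Suc n) * (\<integral>\<^sup>+A. ?g (chi (Suc n) A) * ennreal (exp (- frob (Suc n) A)) \<partial>cleb (sq_idx (Suc n)))"
      by (simp add: c_def ennreal_mult poly_weight_nonneg mult.commute)
    also have "\<dots> = gauss_const n * (\<integral>\<^sup>+z. ennreal (exp (- (cmod z)\<^sup>2)) *
       (\<integral>\<^sup>+B. ?g ([:- z, 1:] * chi n B) * ennreal ((cmod (poly (chi n B) z))\<^sup>2) * ennreal (exp (- frob n B)) \<partial>cleb (sq_idx n)) \<partial>lborel)"
    proof (rule nn_integral_Gaussian_deflation)
      have "(\<lambda>A. poly_weight C L ys (chi (Suc n) A)) \<in> borel_measurable (cleb (sq_idx (Suc n)))"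
        by (rule borel_measurable_poly_weight[of "\<lambda>x. x", OF _ C]) simp
      then show "(\<lambda>A. ?g (chi (Suc n) A)) \<in> borel_measurable (cleb (sq_idx (Suc n)))" by measurable
      have 1: "(\<lambda>p. poly_weight C L ys (chi n (snd p))) \<in> borel_measurable ((lborel :: complex measure) \<Otimes>\<^sub>M cleb (sq_idx n))"
        by (rule borel_measurable_poly_weight[OF _ C]) simp
      have 2: "(\<lambda>z. eig_weight C L z * (\<Prod>y\<leftarrow>ys. (cmod (y - z))\<^sup>2)) \<in> borel_measurable borel"
      proof -
        have "(\<lambda>z. \<Prod>y\<leftarrow>ys. (cmod (y - z))\<^sup>2) \<in> borel_measurable borel"
          by (induction ys) auto
        then show ?thesis using borel_measurable_eig_weight[OF C, of L] by measurable
      qed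
      have "(\<lambda>p. eig_weight C L (fst p) * (\<Prod>y\<leftarrow>ys. (cmod (y - fst p))\<^sup>2)) \<in> borel_measurable ((lborel :: complex measure) \<Otimes>\<^sub>M cleb (sq_idx n))"
        by (rule measurable_compose[OF _ 2]) simp
      then show "(\<lambda>(z, B). ?g ([:- z, 1:] * chi n B)) \<in> borel_measurable ((lborel :: complex measure) \<Otimes>\<^sub>M cleb (sq_idx n))"
        unfolding poly_weight_linear_factor case_prod_unfold using 1 by measurable
    qed
    also have "(\<integral>\<^sup>+z. ennreal (exp (- (cmod z)\<^sup>2)) *
       (\<integral>\<^sup>+B. ?g ([:- z, 1:] * chi n B) * ennreal ((cmod (poly (chi n B) z))\<^sup>2) * ennreal (exp (- frob n B)) \<partial>cleb (sq_idx n)) \<partial>lborel)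
      = (\<integral>\<^sup>+z. ennreal (W ys z) * (\<integral>\<^sup>+B. ennreal (poly_weight C L (z # ys) (chi n B) * exp (- frob n B)) \<partial>cleb (sq_idx n)) \<partial>lborel)"
    proof (rule nn_integral_cong)
      fix z :: complex
      define e where "e = eig_weight C L z * (\<Prod>y\<leftarrow>ys. (cmod (y - z))\<^sup>2)"
      have e: "0 \<le> e" unfolding e_def by (intro mult_nonneg_nonneg prod_list_nonneg) (auto simp: eig_weight_nonneg)
      have m: "(\<lambda>B. ennreal (poly_weight C L (z # ys) (chi n B) * exp (- frob n B))) \<in> borel_measurable (cleb (sq_idx n))"
        using borel_measurable_poly_weight[of "\<lambda>x. x" "cleb (sq_idx n)" n C L "z # ys"] C borel_measurable_frob[of "\<lambda>x. x" "cleb (sq_idx n)" n]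
        by measurable
      have "(\<integral>\<^sup>+B. ?g ([:- z, 1:] * chi n B) * ennreal ((cmod (poly (chi n B) z))\<^sup>2) * ennreal (exp (- frob n B)) \<partial>cleb (sq_idx n)) =
        (\<integral>\<^sup>+B. ennreal e * ennreal (poly_weight C L (z # ys) (chi n B) * exp (- frob n B)) \<partial>cleb (sq_idx n))"
      proof (rule nn_integral_cong)
        fix B
        have "?g ([:- z, 1:] * chi n B) * ennreal ((cmod (poly (chi n B) z))\<^sup>2) * ennreal (exp (- frob n B)) =
          ennreal (e * poly_weight C L ys (chi n B) * (cmod (poly (chi n B) z))\<^sup>2 * exp (- frob n B))"
          unfolding poly_weight_linear_factor e_def[symmetric] using e poly_weight_nonneg[of C L ys "chi n B"]
          by (simp add: ennreal_mult[symmetric])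
        also have "e * poly_weight C L ys (chi n B) * (cmod (poly (chi n B) z))\<^sup>2 * exp (- frob n B) =
           e * (poly_weight C L (z # ys) (chi n B) * exp (- frob n B))"
          unfolding poly_weight_Cons[symmetric] by (simp only: mult.assoc)
        finally show "?g ([:- z, 1:] * chi n B) * ennreal ((cmod (poly (chi n B) z))\<^sup>2) * ennreal (exp (- frob n B)) =
          ennreal e * ennreal (poly_weight C L (z # ys) (chi n B) * exp (- frob n B))"
          using e by (simp add: ennreal_mult poly_weight_nonneg)
      qed
      also have "\<dots> = ennreal e * (\<integral>\<^sup>+B. ennreal (poly_weight C L (z # ys) (chi n B) * exp (- frob n B)) \<partial>cleb (sq_idx n))"
        by (rule nn_integral_cmult[OF m])
      finally have inner: "(\<integral>\<^sup>+B. ?g ([:- z, 1:] * chi n B) * ennreal ((cmod (poly (chi n B) z))\<^sup>2) * ennreal (exp (- frob n B)) \<partial>cleb (sq_idx n)) =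
        ennreal e * (\<integral>\<^sup>+B. ennreal (poly_weight C L (z # ys) (chi n B) * exp (- frob n B)) \<partial>cleb (sq_idx n))" .
      show "ennreal (exp (- (cmod z)\<^sup>2)) *
         (\<integral>\<^sup>+B. ?g ([:- z, 1:] * chi n B) * ennreal ((cmod (poly (chi n B) z))\<^sup>2) * ennreal (exp (- frob n B)) \<partial>cleb (sq_idx n)) =
        ennreal (W ys z) * (\<integral>\<^sup>+B. ennreal (poly_weight C L (z # ys) (chi n B) * exp (- frob n B)) \<partial>cleb (sq_idx n))"
      proof -
        have "W ys z = exp (- (cmod z)\<^sup>2) * e" by (simp only: W_def e_def mult_ac)
        then have "ennreal (W ys z) = ennreal (exp (- (cmod z)\<^sup>2)) * ennreal e"
          using e by (simp only: ennreal_mult[OF exp_ge_zero])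
        then show ?thesis unfolding inner
          by (simp only: mult.assoc)
      qed
    qed
    \<comment> \<open>The induction hypothesis is applied to the longer list \<open>z # ys\<close>,
      hence its generality in the list.\<close>
    also have "\<dots> = (\<integral>\<^sup>+z. K * (\<integral>\<^sup>+x. ennreal (W ys z) * ennreal ((\<Prod>i<n. W (z # ys) (x i)) * (cmod (vandermonde n x))\<^sup>2) \<partial>cleb {..<n}) \<partial>lborel)"
    proof (rule nn_integral_cong)
      fix z :: complex
      have m: "(\<lambda>x. ennreal ((\<Prod>i<n. W (z # ys) (x i)) * (cmod (vandermonde n x))\<^sup>2)) \<in> borel_measurable (cleb {..<n})"
        unfolding vandermonde_def
        by (intro measurable_compose[OF _ measurable_ennreal] borel_measurable_times borel_measurable_prod borel_measurable_power borel_measurable_cmod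
            borel_measurable_diff measurable_compose[OF _ WM] borel_measurable_cleb_component[of "\<lambda>x. x" _ "{..<n}"]) auto
      show "ennreal (W ys z) * (\<integral>\<^sup>+B. ennreal (poly_weight C L (z # ys) (chi n B) * exp (- frob n B)) \<partial>cleb (sq_idx n)) =
        K * (\<integral>\<^sup>+x. ennreal (W ys z) * ennreal ((\<Prod>i<n. W (z # ys) (x i)) * (cmod (vandermonde n x))\<^sup>2) \<partial>cleb {..<n})"
        unfolding K[OF C] W_def[of "z # ys", symmetric] nn_integral_cmult[OF m] by (simp only: mult_ac)
    qed
    also have "\<dots> = (\<integral>\<^sup>+z. K * (\<integral>\<^sup>+x. ennreal ((\<Prod>i<Suc n. W ys ((x(n := z)) i)) * (cmod (vandermonde (Suc n) (x(n := z))))\<^sup>2) \<partial>cleb {..<n}) \<partial>lborel)"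
    proof (intro nn_integral_cong arg_cong2[of _ _ _ _ "(*)"] refl)
      fix z :: complex and x :: "nat \<Rightarrow> complex"
      have "(\<Prod>i<Suc n. W ys ((x(n := z)) i)) = (\<Prod>i<n. W ys (x i)) * W ys z"
        by (simp add: lessThan_Suc mult.commute cong: prod.cong_simp)
      moreover have "(cmod (vandermonde (Suc n) (x(n := z))))\<^sup>2 = (cmod (vandermonde n x))\<^sup>2 * (\<Prod>i<n. (cmod (z - x i))\<^sup>2)"
        by (simp add: vandermonde_insert norm_mult power_mult_distrib prod_norm[symmetric] prod_power_distrib)
      moreover have "(\<Prod>i<n. W (z # ys) (x i)) = (\<Prod>i<n. W ys (x i)) * (\<Prod>i<n. (cmod (z - x i))\<^sup>2)"
        by (simp add: WC prod.distrib)
      ultimately have "(\<Prod>i<Suc n. W ys ((x(n := z)) i)) * (cmod (vandermonde (Suc n) (x(n := z))))\<^sup>2 =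
          W ys z * ((\<Prod>i<n. W (z # ys) (x i)) * (cmod (vandermonde n x))\<^sup>2)"
        by (simp only: mult_ac)
      then show "ennreal (W ys z) * ennreal ((\<Prod>i<n. W (z # ys) (x i)) * (cmod (vandermonde n x))\<^sup>2) =
         ennreal ((\<Prod>i<Suc n. W ys ((x(n := z)) i)) * (cmod (vandermonde (Suc n) (x(n := z))))\<^sup>2)"
        using W0 by (simp only: ennreal_mult[OF W0 mult_nonneg_nonneg[OF prod_nonneg[OF W0] zero_le_power2]])
    qed
    also have "\<dots> = K * (\<integral>\<^sup>+x. ennreal ((\<Prod>i<Suc n. W ys (x i)) * (cmod (vandermonde (Suc n) x))\<^sup>2) \<partial>cleb {..<Suc n})"
    proof -
      define F where "F x = ennreal ((\<Prod>i<Suc n. W ys (x i)) * (cmod (vandermonde (Suc n) x))\<^sup>2)" for x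
      have F: "F \<in> borel_measurable (cleb (insert n {..<n}))"
        unfolding F_def vandermonde_def lessThan_Suc[symmetric]
        by (intro measurable_compose[OF _ measurable_ennreal] borel_measurable_times borel_measurable_prod borel_measurable_power borel_measurable_cmod
            borel_measurable_diff measurable_compose[OF _ WM] borel_measurable_cleb_component[of "\<lambda>x. x" _ "{..<Suc n}"]) auto
      have int: "(\<integral>\<^sup>+x. F x \<partial>cleb {..<Suc n}) = (\<integral>\<^sup>+z. \<integral>\<^sup>+x. F (x(n := z)) \<partial>cleb {..<n} \<partial>lborel)"
        unfolding lessThan_Suc by (rule cprod.product_nn_integral_insert_rev[OF _ _ F]) auto
      have m: "(\<lambda>z. \<integral>\<^sup>+x. F (x(n := z)) \<partial>cleb {..<n}) \<in> borel_measurable lborel"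
      proof (rule borel_measurable_nn_integral_cleb)
        have "(\<lambda>p. (snd p)(n := fst p)) \<in> measurable ((lborel :: complex measure) \<Otimes>\<^sub>M cleb {..<n}) (cleb (insert n {..<n}))"
          using measurable_compose[OF measurable_pair_swap' measurable_add_dim[of n "{..<n}" "\<lambda>_. lborel :: complex measure"]]
          by (simp add: case_prod_unfold)
        from measurable_compose[OF this F]
        show "(\<lambda>(z, x). F (x(n := z))) \<in> borel_measurable ((lborel :: complex measure) \<Otimes>\<^sub>M cleb {..<n})"
          by (simp add: case_prod_unfold)
      qed simp
      show ?thesis unfolding F_def[symmetric] int by (rule nn_integral_cmult[OF m])
    qed
    finally have eq: "(\<integral>\<^sup>+A. ennreal (poly_weight C L ys (chi (Suc n) A) * exp (- frob (Suc n) A)) \<partial>cleb (sq_idx (Suc n))) * c = gauss_const n * K * (\<integral>\<^sup>+x. ennreal ((\<Prod>i<Suc n. W ys (x i)) * (cmod (vandermonde (Suc n) x))\<^sup>2) \<partial>cleb {..<Suc n})"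
      by (simp only: mult.assoc)
    have "(\<integral>\<^sup>+A. ennreal (poly_weight C L ys (chi (Suc n) A) * exp (- frob (Suc n) A)) \<partial>cleb (sq_idx (Suc n))) = (\<integral>\<^sup>+A. ennreal (poly_weight C L ys (chi (Suc n) A) * exp (- frob (Suc n) A)) \<partial>cleb (sq_idx (Suc n))) * c / c"
      by (rule ennreal_mult_divide_eq[symmetric]) (use c in auto)
    also have "\<dots> = gauss_const n * K * (\<integral>\<^sup>+x. ennreal ((\<Prod>i<Suc n. W ys (x i)) * (cmod (vandermonde (Suc n) x))\<^sup>2) \<partial>cleb {..<Suc n}) / c" unfolding eq ..
    also have "\<dots> = gauss_const n * K / c * (\<integral>\<^sup>+x. ennreal ((\<Prod>i<Suc n. W ys (x i)) * (cmod (vandermonde (Suc n) x))\<^sup>2) \<partial>cleb {..<Suc n})"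
      by (simp only: ennreal_divide_times ennreal_times_divide)
    finally show "(\<integral>\<^sup>+A. ennreal (poly_weight C L ys (chi (Suc n) A) * exp (- frob (Suc n) A)) \<partial>cleb (sq_idx (Suc n))) =
      gauss_const n * K / c * (\<integral>\<^sup>+x. ennreal ((\<Prod>i<Suc n. eig_weight C L (x i) * exp (- (cmod (x i))\<^sup>2) * (\<Prod>y\<leftarrow>ys. (cmod (y - x i))\<^sup>2)) *
        (cmod (vandermonde (Suc n) x))\<^sup>2) \<partial>cleb {..<Suc n})"
      by (simp only: W_def)
  qed
qed

section \<open>From the matrix density to the spectral radius\<close>

lemma Re_det_adjoint_mult:
  assumes A: "A \<in> carrier_mat n n"
  shows "Re (Determinant.det (mat_adjoint A * A)) = (cmod (Determinant.det A))\<^sup>2"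
proof -
  have adj: "mat_adjoint A \<in> carrier_mat n n"
    using A by (intro carrier_matI) (auto simp: mat_adjoint_def)
  have "Determinant.det (mat_adjoint A) = cnj (Determinant.det A)"
  proof -
    have "Determinant.det (mat_adjoint A) = Determinant.det (transpose_mat (mat_adjoint A))"
      using det_transpose[OF adj] by simp
    also have "\<dots> = (\<Sum>p | p permutes {0..<n}. signof p * (\<Prod>i = 0..<n. cnj (A $$ (i, p i))))"
    proof -
      have "transpose_mat (mat_adjoint A) $$ (i, j) = cnj (A $$ (i, j))" if "i < n" "j < n" for i j
        using that A by (simp add: mat_adjoint_def mat_of_rows_def)
      then show ?thesis using adj
        by (subst det_def'[of _ n]) (auto intro!: sum.cong prod.cong simp: permutes_in_image)
    qed
    also have "\<dots> = cnj (Determinant.det A)"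
    proof -
      have cs: "cnj (signof q) = (signof q :: complex)" for q :: "nat \<Rightarrow> nat"
        by (cases q rule: sign_cases) auto
      show ?thesis unfolding det_def'[OF A] by (simp only: cnj_sum complex_cnj_mult cs cnj_prod)
    qed
    finally show ?thesis .
  qed
  then have "Determinant.det (mat_adjoint A * A) = cnj (Determinant.det A) * Determinant.det A"
    using det_mult[OF adj A] by simp
  also have "\<dots> = of_real ((cmod (Determinant.det A))\<^sup>2)"
    by (simp only: complex_norm_square mult.commute)
  finally show ?thesis by (simp only: Re_complex_of_real)
qed

lemma Re_trace_adjoint_mult: "Re (mat_trace (mat_adjoint (mat n n z) * mat n n z)) = frob n z"
proof -
  have "mat_trace (mat_adjoint (mat n n z) * mat n n z) = (\<Sum>i<n. \<Sum>k<n. cnj (z (k, i)) * z (k, i))"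
    by (simp add: mat_trace_def mat_adjoint_def mat_of_rows_def scalar_prod_def lessThan_atLeast0)
  also have "\<dots> = (\<Sum>k<n. \<Sum>i<n. cnj (z (k, i)) * z (k, i))" by (rule sum.swap)
  also have "\<dots> = of_real (frob n z)"
    unfolding frob_def of_real_sum complex_norm_square by (simp only: mult.commute)
  finally show ?thesis by (simp only: Re_complex_of_real)
qed

lemma cmod_poly_chi_0: "cmod (poly (chi n z) 0) = cmod (Determinant.det (mat n n z))"
proof -
  have "mat n n (\<lambda>(i, j). (if i = j then 0 else 0) - z (i, j)) = (- 1) \<cdot>\<^sub>m mat n n z"
    by (intro eq_matI) auto
  then show ?thesis unfolding poly_chi by (simp add: norm_mult norm_power)
qed

text \<open>The modulus of the characteristic polynomial at 0 is |det|, so the density is a function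
  of the characteristic polynomial times a Gaussian, as the deflation requires.\<close>

lemma induced_ginibre_weight_eq:
  "induced_ginibre_weight L (mat n n z) = poly_weight UNIV L [] (chi n z) * exp (- frob n z)"
proof -
  \<comment> \<open>True at d = 0 as well, where both powers are 0.\<close>
  have "((cmod d)\<^sup>2) powr L = cmod d powr (2 * L)" for d :: complex
    by (cases "d = 0") (simp_all add: powr_powr flip: powr_numeral)
  then show ?thesis
    unfolding induced_ginibre_weight_def Re_trace_adjoint_mult poly_weight_def
    by (subst Re_det_adjoint_mult[of _ n]) (simp_all add: cmod_poly_chi_0)
qed

lemma eig_weight_power:
  assumes "L > 0"
  shows "cmod z powr (2 * L) * exp (- (cmod z)\<^sup>2) * cmod z ^ k = ((cmod z)\<^sup>2) powr (L + real k / 2) * exp (- (cmod z)\<^sup>2)"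
proof (cases "z = 0")
  case False
  then have "((cmod z)\<^sup>2) powr (L + real k / 2) = cmod z powr (2 * L + real k)"
    by (simp add: powr_powr algebra_simps flip: powr_numeral)
  also have "\<dots> = cmod z powr (2 * L) * cmod z ^ k"
    using False by (simp add: powr_add powr_realpow)
  finally show ?thesis by simp
qed simp

text \<open>Dominated by the same weight without the restriction to \<open>C\<close>, whose radial
  integral is a complete Gamma function.\<close>

lemma integrable_eig_weight:
  assumes L: "L > 0" and C: "closed C"
  shows "integrable lborel (\<lambda>z. eig_weight C L z * exp (- (cmod z)\<^sup>2) * cmod z ^ k)"
proof (rule integrableI_bounded)
  show "(\<lambda>z. eig_weight C L z * exp (- (cmod z)\<^sup>2) * cmod z ^ k) \<in> borel_measurable lborel"
    using borel_measurable_eig_weight[OF C, of L] by measurable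
  have "(\<integral>\<^sup>+z. ennreal (norm (eig_weight C L z * exp (- (cmod z)\<^sup>2) * cmod z ^ k)) \<partial>lborel) \<le>
    (\<integral>\<^sup>+z. ennreal (((cmod z)\<^sup>2) powr (L + real k / 2) * exp (- (cmod z)\<^sup>2)) \<partial>lborel)"
    unfolding eig_weight_power[OF L, symmetric]
    by (intro nn_integral_mono ennreal_leI) (auto simp: eig_weight_def indicator_def)
  also have "\<dots> = ennreal pi * (\<integral>\<^sup>+y. ennreal (y powr (L + real k / 2) * exp (- y)) * indicator {0..} y \<partial>lborel)"
    by (rule nn_integral_radial) measurable
  also have "(\<integral>\<^sup>+y. ennreal (y powr (L + real k / 2) * exp (- y)) * indicator {0..} y \<partial>lborel) = upper_Gamma (L + real k / 2 + 1) 0"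
    by (simp add: upper_Gamma_def)
  also have "\<dots> = ennreal (Gamma (L + real k / 2 + 1))"
    using L by (intro upper_Gamma_zero) (simp add: add_pos_nonneg)
  also have "ennreal pi * \<dots> < \<infinity>" by (simp add: ennreal_mult_less_top)
  finally show "(\<integral>\<^sup>+z. ennreal (norm (eig_weight C L z * exp (- (cmod z)\<^sup>2) * cmod z ^ k)) \<partial>lborel) < \<infinity>" .
qed

lemma nn_integral_eig_weight_UNIV:
  assumes L: "L > 0"
  shows "(\<integral>\<^sup>+z. ennreal (eig_weight UNIV L z * exp (- (cmod z)\<^sup>2) * cmod z ^ (2 * k)) \<partial>lborel) = ennreal (pi * Gamma (L + real k + 1))"
proof -
  have e: "eig_weight UNIV L z * exp (- (cmod z)\<^sup>2) * cmod z ^ (2 * k) = ((cmod z)\<^sup>2) powr (L + real k) * exp (- (cmod z)\<^sup>2)" for z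
    using eig_weight_power[OF L, of z "2 * k"] by (simp add: eig_weight_def)
  have "(\<integral>\<^sup>+z. ennreal (eig_weight UNIV L z * exp (- (cmod z)\<^sup>2) * cmod z ^ (2 * k)) \<partial>lborel) =
    (\<integral>\<^sup>+z. ennreal (((cmod z)\<^sup>2) powr (L + real k) * exp (- (cmod z)\<^sup>2)) \<partial>lborel)"
    unfolding e ..
  also have "\<dots> = ennreal pi * (\<integral>\<^sup>+y. ennreal (y powr (L + real k) * exp (- y)) * indicator {0..} y \<partial>lborel)"
    by (rule nn_integral_radial) measurable
  also have "(\<integral>\<^sup>+y. ennreal (y powr (L + real k) * exp (- y)) * indicator {0..} y \<partial>lborel) = upper_Gamma (L + real k + 1) 0"
    by (simp add: upper_Gamma_def)
  also have "\<dots> = ennreal (Gamma (L + real k + 1))"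
    using L by (intro upper_Gamma_zero) simp
  finally show ?thesis using L Gamma_real_pos[of "L + real k + 1"] by (simp add: ennreal_mult)
qed

lemma Gamma_tail_le_1: "s > 0 \<Longrightarrow> t \<ge> 0 \<Longrightarrow> Gamma_tail s t \<le> 1"
proof -
  assume s: "s > 0" "t \<ge> 0"
  have "upper_Gamma s t \<le> upper_Gamma s 0"
    unfolding upper_Gamma_def using s by (intro nn_integral_mono) (auto simp: indicator_def)
  then have "enn2real (upper_Gamma s t) \<le> Gamma s"
    using upper_Gamma_zero[OF s(1)] Gamma_real_pos[OF s(1)] by (intro enn2real_leI) auto
  then show ?thesis using Gamma_real_pos[OF s(1)] by (simp add: Gamma_tail_def)
qed

lemma lower_Gamma:
  assumes s: "s > 0" and t: "t \<ge> 0"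
  shows "(\<integral>\<^sup>+y. ennreal (y powr (s - 1) * exp (- y)) * indicator {0..t} y \<partial>lborel) = ennreal (Gamma s * (1 - Gamma_tail s t))"
proof -
  define a where "a = (\<integral>\<^sup>+y. ennreal (y powr (s - 1) * exp (- y)) * indicator {0..t} y \<partial>lborel)"
  have "ennreal (Gamma s) = upper_Gamma s 0" using s by (simp add: upper_Gamma_zero)
  also have "\<dots> = (\<integral>\<^sup>+y. ennreal (y powr (s - 1) * exp (- y)) * indicator {0..t} y + ennreal (y powr (s - 1) * exp (- y)) * indicator {t..} y \<partial>lborel)"
    unfolding upper_Gamma_def
  proof (rule nn_integral_cong_AE)
    have "AE y in lborel. y \<noteq> t" by (rule AE_lborel_singleton)
    then show "AE y in lborel. ennreal (y powr (s - 1) * exp (- y)) * indicator {0..} y =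
       ennreal (y powr (s - 1) * exp (- y)) * indicator {0..t} y + ennreal (y powr (s - 1) * exp (- y)) * indicator {t..} y"
      by eventually_elim (use t in \<open>auto simp: indicator_def\<close>)
  qed
  also have "\<dots> = a + upper_Gamma s t"
    unfolding a_def upper_Gamma_def by (rule nn_integral_add) measurable
  also have "upper_Gamma s t = ennreal (enn2real (upper_Gamma s t))"
    using upper_Gamma_finite[OF s t] by simp
  finally have "a = ennreal (Gamma s) - ennreal (enn2real (upper_Gamma s t))"
    by (simp add: ennreal_add_diff_cancel_right)
  also have "\<dots> = ennreal (Gamma s - enn2real (upper_Gamma s t))"
    by (rule ennreal_minus) simp
  also have "Gamma s - enn2real (upper_Gamma s t) = Gamma s * (1 - Gamma_tail s t)"
    using Gamma_real_pos[OF s] by (simp add: Gamma_tail_def right_diff_distrib)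
  finally show ?thesis by (simp only: a_def)
qed

text \<open>In the variable |z|^2 the disc becomes the interval from 0 to r^2, which gives a lower
  incomplete Gamma integral.\<close>

lemma nn_integral_eig_weight_cball:
  assumes L: "L > 0" and r: "r \<ge> 0"
  shows "(\<integral>\<^sup>+z. ennreal (eig_weight (cball 0 r) L z * exp (- (cmod z)\<^sup>2) * cmod z ^ (2 * k)) \<partial>lborel) =
     ennreal (pi * Gamma (L + real k + 1)) * ennreal (1 - Gamma_tail (L + real k + 1) (r\<^sup>2))"
proof -
  define s where "s = L + real k + 1"
  have s: "s > 0" using L by (simp add: s_def)
  have "(\<integral>\<^sup>+z. ennreal (eig_weight (cball 0 r) L z * exp (- (cmod z)\<^sup>2) * cmod z ^ (2 * k)) \<partial>lborel) =
    (\<integral>\<^sup>+z. ennreal (((cmod z)\<^sup>2) powr (s - 1) * exp (- (cmod z)\<^sup>2)) * indicator {..r\<^sup>2} ((cmod z)\<^sup>2) \<partial>lborel)"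
  proof (rule nn_integral_cong)
    fix z :: complex
    have "z \<in> cball 0 r \<longleftrightarrow> (cmod z)\<^sup>2 \<le> r\<^sup>2" using r by (simp add: power2_le_iff_abs_le)
    then show "ennreal (eig_weight (cball 0 r) L z * exp (- (cmod z)\<^sup>2) * cmod z ^ (2 * k)) =
       ennreal (((cmod z)\<^sup>2) powr (s - 1) * exp (- (cmod z)\<^sup>2)) * indicator {..r\<^sup>2} ((cmod z)\<^sup>2)"
      using eig_weight_power[OF L, of z "2 * k"] by (auto simp: eig_weight_def indicator_def s_def)
  qed
  also have "\<dots> = ennreal pi * (\<integral>\<^sup>+y. ennreal (y powr (s - 1) * exp (- y)) * indicator {..r\<^sup>2} y * indicator {0..} y \<partial>lborel)"
    by (rule nn_integral_radial) measurable
  also have "(\<integral>\<^sup>+y. ennreal (y powr (s - 1) * exp (- y)) * indicator {..r\<^sup>2} y * indicator {0..} y \<partial>lborel) =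
     (\<integral>\<^sup>+y. ennreal (y powr (s - 1) * exp (- y)) * indicator {0..r\<^sup>2} y \<partial>lborel)"
    by (intro nn_integral_cong) (auto simp: indicator_def)
  also have "\<dots> = ennreal (Gamma s * (1 - Gamma_tail s (r\<^sup>2)))"
    using s by (rule lower_Gamma) simp
  also have "ennreal pi * \<dots> = ennreal (pi * Gamma s) * ennreal (1 - Gamma_tail s (r\<^sup>2))"
    using Gamma_real_pos[OF s] Gamma_tail_le_1[OF s, of "r\<^sup>2"] by (simp add: ennreal_mult[symmetric] mult.assoc)
  finally show ?thesis by (simp only: s_def)
qed

text \<open>For n \<ge> 1 the spectrum is finite and nonempty, so the maximum defining the radius is
  attained.\<close>

lemma spectral_radius_le_iff:
  assumes A: "A \<in> carrier_mat n n" and n: "n \<ge> 1"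
  shows "spectral_radius A \<le> r \<longleftrightarrow> (\<forall>z. poly (char_poly A) z = 0 \<longrightarrow> z \<in> cball 0 r)"
proof -
  have fin: "finite (norm ` spectrum A)" using card_finite_spectrum[OF A] by simp
  have ne: "norm ` spectrum A \<noteq> {}" using spectrum_non_empty[OF A] n by simp
  have "spectral_radius A \<le> r \<longleftrightarrow> (\<forall>z\<in>spectrum A. norm z \<le> r)"
    unfolding spectral_radius_def using Max_le_iff[OF fin ne] by simp
  then show ?thesis
    by (simp add: spectrum_def eigenvalue_root_char_poly[OF A])
qed

locale induced_ginibre_matrix =
  fixes P :: "'a measure" and n :: nat and L :: real and G :: "'a \<Rightarrow> complex mat"
  assumes L: "L > 0" and n: "n \<ge> 1" and ginibre: "induced_ginibre P n L G"
begin

lemma G_carrier: "\<omega> \<in> space P \<Longrightarrow> G \<omega> \<in> carrier_mat n n"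
  using ginibre by (simp add: induced_ginibre_def)

lemma entries_distributed: obtains c where "c > 0"
  "distributed P (cleb (sq_idx n)) (\<lambda>\<omega>. mat_entries n (G \<omega>)) (\<lambda>z. ennreal (c * induced_ginibre_weight L (mat n n z)))"
  using ginibre by (auto simp: induced_ginibre_def entries_lborel_def)

lemma mat_entries: "\<omega> \<in> space P \<Longrightarrow> mat n n (mat_entries n (G \<omega>)) = G \<omega>"
  using G_carrier[of \<omega>] by (intro eq_matI) (auto simp: mat_entries_def)

definition roots_in :: "complex set \<Rightarrow> 'a set" where
  "roots_in C = {\<omega> \<in> space P. \<forall>z. poly (char_poly (G \<omega>)) z = 0 \<longrightarrow> z \<in> C}"

lemma roots_in_eq:
  "roots_in C = (\<lambda>\<omega>. mat_entries n (G \<omega>)) -` {A \<in> space (cleb (sq_idx n)). \<forall>z. poly (chi n A) z = 0 \<longrightarrow> z \<in> C} \<inter> space P"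
proof -
  obtain c where d: "distributed P (cleb (sq_idx n)) (\<lambda>\<omega>. mat_entries n (G \<omega>)) (\<lambda>z. ennreal (c * induced_ginibre_weight L (mat n n z)))"
    by (rule entries_distributed)
  have "(\<lambda>\<omega>. mat_entries n (G \<omega>)) \<in> measurable P (cleb (sq_idx n))" using d by (rule distributed_measurable)
  then show ?thesis by (auto simp: roots_in_def mat_entries dest: measurable_space)
qed

text \<open>\<open>K\<close> is obtained before \<open>C\<close>, so one unknown constant serves all
  rotation-invariant closed sets; the invariance makes the weight radial, as
  \<open>nn_integral_vandermonde\<close> requires.\<close>

lemma emeasure_roots_in:
  obtains K where "\<And>C. closed C \<Longrightarrow> (\<And>d z. cmod d = 1 \<Longrightarrow> d * z \<in> C \<longleftrightarrow> z \<in> C) \<Longrightarrow>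
    roots_in C \<in> sets P \<and>
    emeasure P (roots_in C) = K * (\<Prod>k<n. \<integral>\<^sup>+z. ennreal (eig_weight C L z * exp (- (cmod z)\<^sup>2) * cmod z ^ (2 * k)) \<partial>lborel)"
proof -
  obtain c where c: "c > 0" and d: "distributed P (cleb (sq_idx n)) (\<lambda>\<omega>. mat_entries n (G \<omega>)) (\<lambda>z. ennreal (c * induced_ginibre_weight L (mat n n z)))"
    by (rule entries_distributed)
  obtain K where K: "\<And>C ys. closed C \<Longrightarrow>
     (\<integral>\<^sup>+A. ennreal (poly_weight C L ys (chi n A) * exp (- frob n A)) \<partial>cleb (sq_idx n)) =
     K * (\<integral>\<^sup>+x. ennreal ((\<Prod>i<n. eig_weight C L (x i) * exp (- (cmod (x i))\<^sup>2) * (\<Prod>y\<leftarrow>ys. (cmod (y - x i))\<^sup>2)) *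
        (cmod (vandermonde n x))\<^sup>2) \<partial>cleb {..<n})"
    using nn_integral_eigenvalues[of n L] by blast
  show ?thesis
  \<comment> \<open>Normalisation of the density, constant of the eigenvalue formula, and the
    factorial from the Vandermonde integral.\<close>
  proof (rule that[of "ennreal c * K * fact n"])
    fix C :: "complex set"
    assume C: "closed C" and rot: "\<And>d z. cmod d = 1 \<Longrightarrow> d * z \<in> C \<longleftrightarrow> z \<in> C"
    define E where "E = {A \<in> space (cleb (sq_idx n)). \<forall>z. poly (chi n A) z = 0 \<longrightarrow> z \<in> C}"
    have E: "E \<in> sets (cleb (sq_idx n))"
      unfolding E_def by (rule roots_outside_measurable[of "\<lambda>x. x", OF _ C]) simp
    have X: "(\<lambda>\<omega>. mat_entries n (G \<omega>)) \<in> measurable P (cleb (sq_idx n))" using d by (rule distributed_measurable)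
    have sets: "roots_in C \<in> sets P"
      unfolding roots_in_eq E_def[symmetric] by (rule measurable_sets[OF X E])
    have pm: "(\<lambda>A. poly_weight C L [] (chi n A)) \<in> borel_measurable (cleb (sq_idx n))"
      by (rule borel_measurable_poly_weight[of "\<lambda>x. x", OF _ C]) simp
    have fm: "frob n \<in> borel_measurable (cleb (sq_idx n))"
      by (rule borel_measurable_frob[of "\<lambda>x. x"]) simp
    have "emeasure P (roots_in C) = (\<integral>\<^sup>+A. ennreal (c * induced_ginibre_weight L (mat n n A)) * indicator E A \<partial>cleb (sq_idx n))"
      unfolding roots_in_eq E_def[symmetric] by (rule distributed_emeasure[OF d E])
    also have "\<dots> = (\<integral>\<^sup>+A. ennreal c * ennreal (poly_weight C L [] (chi n A) * exp (- frob n A)) \<partial>cleb (sq_idx n))"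
    proof (rule nn_integral_cong)
      fix A assume "A \<in> space (cleb (sq_idx n))"
      then show "ennreal (c * induced_ginibre_weight L (mat n n A)) * indicator E A =
        ennreal c * ennreal (poly_weight C L [] (chi n A) * exp (- frob n A))"
        unfolding induced_ginibre_weight_eq using c by (auto simp: E_def poly_weight_def indicator_def ennreal_mult)
    qed
    also have "\<dots> = ennreal c * (\<integral>\<^sup>+A. ennreal (poly_weight C L [] (chi n A) * exp (- frob n A)) \<partial>cleb (sq_idx n))"
      by (intro nn_integral_cmult measurable_compose[OF _ measurable_ennreal] borel_measurable_times pm
          measurable_compose[OF _ borel_measurable_exp] borel_measurable_uminus fm)
    also have "(\<integral>\<^sup>+A. ennreal (poly_weight C L [] (chi n A) * exp (- frob n A)) \<partial>cleb (sq_idx n)) =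
      K * (\<integral>\<^sup>+x. ennreal ((\<Prod>i<n. eig_weight C L (x i) * exp (- (cmod (x i))\<^sup>2)) * (cmod (vandermonde n x))\<^sup>2) \<partial>cleb {..<n})"
      using K[OF C, of "[]"] by simp
    also have "(\<integral>\<^sup>+x. ennreal ((\<Prod>i<n. eig_weight C L (x i) * exp (- (cmod (x i))\<^sup>2)) * (cmod (vandermonde n x))\<^sup>2) \<partial>cleb {..<n}) =
       fact n * (\<Prod>k<n. \<integral>\<^sup>+z. ennreal (eig_weight C L z * exp (- (cmod z)\<^sup>2) * cmod z ^ (2 * k)) \<partial>lborel)"
    proof (rule nn_integral_vandermonde)
      show "eig_weight C L (d * z) * exp (- (cmod (d * z))\<^sup>2) = eig_weight C L z * exp (- (cmod z)\<^sup>2)" if "cmod d = 1" for d z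
        using rot[OF that, of z] that by (simp add: eig_weight_def norm_mult indicator_def)
      show "(\<lambda>z. eig_weight C L z * exp (- (cmod z)\<^sup>2)) \<in> borel_measurable borel"
        using borel_measurable_eig_weight[OF C, of L] by measurable
      show "0 \<le> eig_weight C L z * exp (- (cmod z)\<^sup>2)" for z by (simp add: eig_weight_nonneg)
      show "integrable lborel (\<lambda>z. eig_weight C L z * exp (- (cmod z)\<^sup>2) * cmod z ^ k)" for k
        by (rule integrable_eig_weight[OF L C])
    qed
    finally show "roots_in C \<in> sets P \<and> emeasure P (roots_in C) = ennreal c * K * fact n *
       (\<Prod>k<n. \<integral>\<^sup>+z. ennreal (eig_weight C L z * exp (- (cmod z)\<^sup>2) * cmod z ^ (2 * k)) \<partial>lborel)"
      using sets by (simp only: mult.assoc simp_thms)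
  qed
qed

lemma spectral_radius_event: "{\<omega> \<in> space P. spectral_radius (G \<omega>) \<le> r} = roots_in (cball 0 r)"
  using spectral_radius_le_iff[OF G_carrier n] by (auto simp: roots_in_def)

lemma spectral_radius_measurable: "(\<lambda>\<omega>. spectral_radius (G \<omega>)) \<in> borel_measurable P"
proof (rule borel_measurableI_le)
  fix r
  obtain K where K: "\<And>C. closed C \<Longrightarrow> (\<And>d z. cmod d = 1 \<Longrightarrow> d * z \<in> C \<longleftrightarrow> z \<in> C) \<Longrightarrow>
    roots_in C \<in> sets P \<and>
    emeasure P (roots_in C) = K * (\<Prod>k<n. \<integral>\<^sup>+z. ennreal (eig_weight C L z * exp (- (cmod z)\<^sup>2) * cmod z ^ (2 * k)) \<partial>lborel)"
    using emeasure_roots_in by blast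
  have "roots_in (cball 0 r) \<in> sets P" using K[of "cball 0 r"] by (simp add: norm_mult)
  then show "{\<omega> \<in> space P. spectral_radius (G \<omega>) \<le> r} \<in> sets P" by (simp add: spectral_radius_event)
qed

text \<open>The event for \<open>UNIV\<close> has probability 1, which determines the constant; each
  factor is then a lower incomplete Gamma integral over its complete one.\<close>

theorem prob_spectral_radius_le:
  assumes r: "r \<ge> 0"
  shows "measure P {\<omega> \<in> space P. spectral_radius (G \<omega>) \<le> r} = (\<Prod>k<n. 1 - Gamma_tail (L + real k + 1) (r\<^sup>2))"
proof -
  interpret prob_space P using ginibre by (simp add: induced_ginibre_def)
  obtain K where K: "\<And>C. closed C \<Longrightarrow> (\<And>d z. cmod d = 1 \<Longrightarrow> d * z \<in> C \<longleftrightarrow> z \<in> C) \<Longrightarrow>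
    roots_in C \<in> sets P \<and>
    emeasure P (roots_in C) = K * (\<Prod>k<n. \<integral>\<^sup>+z. ennreal (eig_weight C L z * exp (- (cmod z)\<^sup>2) * cmod z ^ (2 * k)) \<partial>lborel)"
    using emeasure_roots_in by blast
  define g where "g = (\<Prod>k<n. ennreal (pi * Gamma (L + real k + 1)))"
  have "roots_in UNIV = space P" by (simp add: roots_in_def)
  then have 1: "K * g = 1"
    using K[of UNIV] emeasure_space_1 by (simp add: nn_integral_eig_weight_UNIV[OF L] g_def)
  have q: "0 \<le> 1 - Gamma_tail (L + real k + 1) (r\<^sup>2)" for k
    using Gamma_tail_le_1[of "L + real k + 1" "r\<^sup>2"] L by simp
  have "emeasure P (roots_in (cball 0 r)) = K * (\<Prod>k<n. ennreal (pi * Gamma (L + real k + 1)) * ennreal (1 - Gamma_tail (L + real k + 1) (r\<^sup>2)))"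
    using K[of "cball 0 r"] by (simp add: nn_integral_eig_weight_cball[OF L r] norm_mult)
  also have "\<dots> = K * g * (\<Prod>k<n. ennreal (1 - Gamma_tail (L + real k + 1) (r\<^sup>2)))"
    by (simp add: prod.distrib g_def mult.assoc)
  also have "\<dots> = ennreal (\<Prod>k<n. 1 - Gamma_tail (L + real k + 1) (r\<^sup>2))"
    unfolding 1 using q by (simp add: prod_ennreal)
  finally show ?thesis
    unfolding spectral_radius_event measure_def using q by (simp add: prod_nonneg)
qed

end

theorem theorem6:
  fixes \<alpha> :: real
    and M :: "nat \<Rightarrow> 'a measure"
    and G :: "nat \<Rightarrow> 'a \<Rightarrow> complex mat"
  assumes "\<alpha> > 0"
    and "\<And>N. N \<ge> 1 \<Longrightarrow> induced_ginibre (M N) N (\<alpha> * real N) (G N)"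
  shows "(\<forall>x::real.
            (\<lambda>N. measure (M N) {\<omega> \<in> space (M N).
                   scaled_spectral_radius \<alpha> N (G N \<omega>)
                     \<le> 1 + sqrt (gumbel_gamma \<alpha> N / (2 * (1 + \<alpha>) * real N))
                         + x / (2 * sqrt (2 * (1 + \<alpha>) * real N * gumbel_gamma \<alpha> N))})
            \<longlonglongrightarrow> exp (- exp (- x)))
       \<and> weak_conv_m
            (\<lambda>N. distr (M N) borel (\<lambda>\<omega>.
                   2 * sqrt (2 * (1 + \<alpha>) * real N * gumbel_gamma \<alpha> N)
                     * (scaled_spectral_radius \<alpha> N (G N \<omega>) - 1
                         - sqrt (gumbel_gamma \<alpha> N / (2 * (1 + \<alpha>) * real N)))))
            std_gumbel"
proof -
  define F where "F x N = measure (M N) {\<omega> \<in> space (M N).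
                   scaled_spectral_radius \<alpha> N (G N \<omega>)
                     \<le> 1 + sqrt (gumbel_gamma \<alpha> N / (2 * (1 + \<alpha>) * real N))
                         + x / (2 * sqrt (2 * (1 + \<alpha>) * real N * gumbel_gamma \<alpha> N))}" for x N
  define Y where "Y N \<omega> = 2 * sqrt (2 * (1 + \<alpha>) * real N * gumbel_gamma \<alpha> N)
                     * (scaled_spectral_radius \<alpha> N (G N \<omega>) - 1
                         - sqrt (gumbel_gamma \<alpha> N / (2 * (1 + \<alpha>) * real N)))" for N \<omega>
  have matrix: "induced_ginibre_matrix (M N) N (\<alpha> * real N) (G N)" if "N \<ge> 1" for N
    using assms that by (unfold_locales) auto
  have lim: "F x \<longlonglongrightarrow> exp (- exp (- x))" for x
  proof -
    interpret gumbel_scaling \<alpha> x using assms(1) by unfold_locales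
    \<comment> \<open>\<open>delta_pos\<close> makes the threshold nonnegative, as the exact formula
      for finite N requires.\<close>
    have "\<forall>\<^sub>F N in sequentially. (\<Prod>j<N. 1 - Gamma_tail (S N - real j) (t N)) = F x N"
      using delta_pos eventually_ge_at_top[of 1]
    proof eventually_elim
      case (elim N)
      interpret induced_ginibre_matrix "M N" N "\<alpha> * real N" "G N" by (rule matrix[OF elim(2)])
      have S: "S N > 0" using assms(1) elim(2) by (simp add: S_def)
      have "F x N = measure (M N) {\<omega> \<in> space (M N). spectral_radius (G N \<omega>) \<le> sqrt (S N) * (1 + \<delta> N)}"
        unfolding F_def scaled_spectral_radius_def \<delta>_def S_def \<gamma>_def
        using S by (intro arg_cong[of _ _ "measure (M N)"] Collect_cong) (auto simp: S_def pos_divide_le_eq mult_ac add_ac)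
      also have "\<dots> = (\<Prod>k<N. 1 - Gamma_tail (\<alpha> * real N + real k + 1) ((sqrt (S N) * (1 + \<delta> N))\<^sup>2))"
        using S elim(1) by (intro prob_spectral_radius_le) simp
      also have "(sqrt (S N) * (1 + \<delta> N))\<^sup>2 = t N"
        using S by (simp add: power_mult_distrib t_def)
      \<comment> \<open>Reversal of the product: the exact formula starts at the smallest shape,
        \<open>Gamma_product_limit\<close> at the largest, \<open>S N\<close>.\<close>
      also have "(\<Prod>k<N. 1 - Gamma_tail (\<alpha> * real N + real k + 1) (t N)) =
          (\<Prod>j<N. 1 - Gamma_tail (\<alpha> * real N + real (N - Suc j) + 1) (t N))"
        by (rule prod.nat_diff_reindex[symmetric])
      also have "\<dots> = (\<Prod>j<N. 1 - Gamma_tail (S N - real j) (t N))"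
      proof (rule prod.cong)
        fix j assume "j \<in> {..<N}"
        then have "\<alpha> * real N + real (N - Suc j) + 1 = S N - real j"
          by (simp add: S_def of_nat_diff algebra_simps)
        then show "1 - Gamma_tail (\<alpha> * real N + real (N - Suc j) + 1) (t N) = 1 - Gamma_tail (S N - real j) (t N)"
          by simp
      qed simp
      finally show ?case by simp
    qed
    with Gamma_product_limit show ?thesis by (rule Lim_transform_eventually)
  qed
  \<comment> \<open>Convergence of the distribution functions is shown at every point, each being a
    continuity point of the Gumbel law.\<close>
  have "weak_conv_m (\<lambda>N. distr (M N) borel (Y N)) std_gumbel"
    unfolding weak_conv_m_def weak_conv_def cdf_std_gumbel
  proof (intro allI impI)
    fix x
    interpret gumbel_scaling \<alpha> x using assms(1) by unfold_locales
    have "\<forall>\<^sub>F N in sequentially. F x N = cdf (distr (M N) borel (Y N)) x"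
      using gamma_S_pos eventually_ge_at_top[of 1]
    proof eventually_elim
      case (elim N)
      interpret induced_ginibre_matrix "M N" N "\<alpha> * real N" "G N" by (rule matrix[OF elim(2)])
      define a where "a = 2 * sqrt (2 * (1 + \<alpha>) * real N * gumbel_gamma \<alpha> N)"
      \<comment> \<open>Only for large N is \<gamma> known to be positive; then dividing by
        \<open>a\<close> preserves the inequality and the two events coincide.\<close>
      have "0 < 2 * (S N * gumbel_gamma \<alpha> N)"
        using elim(1) unfolding \<gamma>_def by simp
      moreover have "2 * (S N * gumbel_gamma \<alpha> N) = 2 * (1 + \<alpha>) * real N * gumbel_gamma \<alpha> N"
        by (simp only: S_def mult.assoc)
      ultimately have a: "a > 0"
        unfolding a_def by (simp only: real_sqrt_gt_0_iff zero_less_mult_iff[of "2 :: real" "sqrt _"] zero_less_numeral simp_thms)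
      have Y: "Y N \<in> borel_measurable (M N)"
        unfolding Y_def scaled_spectral_radius_def using spectral_radius_measurable by measurable
      have "cdf (distr (M N) borel (Y N)) x = measure (M N) {\<omega> \<in> space (M N). Y N \<omega> \<le> x}"
        unfolding cdf_def by (subst measure_distr[OF Y]) (auto intro!: arg_cong[of _ _ "measure (M N)"])
      also have "\<dots> = F x N"
        unfolding F_def Y_def a_def[symmetric]
        using a by (intro arg_cong[of _ _ "measure (M N)"] Collect_cong) (auto simp: pos_le_divide_eq algebra_simps le_divide_eq divide_simps)
      finally show ?case by simp
    qed
    with lim show "(\<lambda>N. cdf (distr (M N) borel (Y N)) x) \<longlonglongrightarrow> exp (- exp (- x))"
      by (rule Lim_transform_eventually)
  qed
  with lim show ?thesis unfolding F_def Y_def by blast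
qed

end
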